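(* Let $G$ be a finite simple planar graph with girth $g(G)$ and maximum degree $\Delta\geq 4$. (a) If $g(G)\geq 9$, then $\chi_i(G)\leq \Delta+1$. (b) If $g(G)\geq 13$, then $\chi_i(G)=\Delta$.
   Context: An injective coloring of a graph $G$ is an assignment of colors to the vertices of $G$ such that any two vertices having a common neighbor receive distinct colors (the coloring need not be proper). The injective chromatic number $\chi_i(G)$ is the minimum number of colors in an injective coloring of $G$. The girth $g(G)$ is the length of a shortest cycle in $G$. *)

theory Defs
  imports "HOL-Analysis.Analysis" "HOL-Library.Extended_Nat" "Graph_Theory.Pair_Digraph"
begin

text \<open>
  A finite simple graph is a \<^locale>\<open>pair_graph\<close>: a finite vertex set with a symmetric and
  irreflexive set of arcs, so that an undirected edge \<open>uv\<close> is the pair of arcs \<open>(u, v)\<close>, \<open>(v, u)\<close>.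
  Consequently the degree of a vertex is its out-degree.  Inserting \<open>0\<close> only affects the graph
  without vertices.
\<close>

definition max_degree :: "'a pair_pre_digraph \<Rightarrow> nat" where
  "max_degree G = Max (insert 0 (out_degree (with_proj G) ` pverts G))"

text \<open>
  The library notion of a cycle is the directed one, under which traversing a single edge
  back and forth is a cycle of length 2; the other cycles of a simple graph have length at least 3.
  The girth of a forest is \<open>\<infinity>\<close>, the infimum of the empty set.
\<close>

definition girth :: "'a pair_pre_digraph \<Rightarrow> enat" where
  "girth G = Inf {enat (length p) | p. pre_digraph.cycle (with_proj G) p \<and> 3 \<le> length p}"

text \<open>
  A drawing in the plane (here \<^typ>\<open>complex\<close>) without crossings: distinct vertices are distinct
  points, every edge is a simple arc joining its ends and containing no other vertex, and two
  different edges meet only in common ends.  The two arcs of an edge carry the same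
  curve, traversed in opposite directions.
\<close>

definition plane_drawing ::
    "'a pair_pre_digraph \<Rightarrow> ('a \<Rightarrow> complex) \<Rightarrow> ('a \<times> 'a \<Rightarrow> real \<Rightarrow> complex) \<Rightarrow> bool" where
  "plane_drawing G pos curve \<longleftrightarrow>
     inj_on pos (pverts G) \<and>
     (\<forall>(u, v) \<in> parcs G.
        arc (curve (u, v)) \<and>
        pathstart (curve (u, v)) = pos u \<and> pathfinish (curve (u, v)) = pos v \<and>
        curve (v, u) = reversepath (curve (u, v)) \<and>
        path_image (curve (u, v)) \<inter> pos ` pverts G = {pos u, pos v}) \<and>
     (\<forall>(u, v) \<in> parcs G. \<forall>(x, y) \<in> parcs G. {u, v} \<noteq> {x, y} \<longrightarrow>
        path_image (curve (u, v)) \<inter> path_image (curve (x, y)) \<subseteq> pos ` ({u, v} \<inter> {x, y}))"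

definition planar :: "'a pair_pre_digraph \<Rightarrow> bool" where
  "planar G \<longleftrightarrow> (\<exists>pos curve. plane_drawing G pos curve)"

definition injective_coloring :: "'a pair_pre_digraph \<Rightarrow> ('a \<Rightarrow> nat) \<Rightarrow> bool" where
  "injective_coloring G c \<longleftrightarrow>
     (\<forall>u \<in> pverts G. \<forall>v \<in> pverts G. u \<noteq> v \<longrightarrow>
        (\<exists>w \<in> pverts G. (u, w) \<in> parcs G \<and> (v, w) \<in> parcs G) \<longrightarrow> c u \<noteq> c v)"

definition injective_chromatic_number :: "'a pair_pre_digraph \<Rightarrow> nat" where
  "injective_chromatic_number G =
     (LEAST k. \<exists>c. injective_coloring G c \<and> card (c ` pverts G) = k)"

end

theory Submission
  imports Defs
begin

text \<open>
  Two vertices conflict if they have a common neighbor.  In an edge-minimal graph without an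
  injective coloring with \<open>K\<close> colors, every vertex outside the \<open>K\<close>-core of the conflict graph can be
  colored last, so no edge avoids the core.  A core vertex of conflict degree \<open>K\<close> inside the core
  that lies in two neighborhoods (blocks) behaves like an edge of a multigraph whose nodes are the
  blocks; a cycle of such edges to which another one is attached is degree-choosable, hence there
  are at most as many such vertices as blocks.  For \<open>K = \<Delta> + 1\<close> the relevant vertices are neighbors of
  degree 2 of certain 3-vertices, for \<open>K = \<Delta>\<close> they are mainly the ends of paths of three 2-vertices.
  This global bound combined with discharging shows \<open>7 * 2|E| \<ge> 18 |V|\<close> and \<open>11 * 2|E| \<ge> 26 |V|\<close>,
  respectively, which contradicts Euler's inequality \<open>(g - 2) |E| < g |V|\<close> for plane graphs of girth
  \<open>g = 9\<close> and \<open>g = 13\<close>.  The latter comes from Janiszewski's theorem and the Jordan curve theorem: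
  adding an edge that closes a cycle splits a face, an edge borders at most two faces, and the
  edges on the border of a face contain a cycle.
\<close>

subsection \<open>Euler inequality for plane drawings\<close>

text \<open>The densities are those that Euler forbids: with \<open>card E\<close> counting both
  arcs of every edge, girth 9 and girth 13 give \<open>7 * card E < 18 * card V\<close> and
  \<open>11 * card E < 26 * card V\<close>, so a vertex of degree d starts with charge 7d - 18 or
  11d - 26. Neighbors alone cannot cover every deficit; the rest comes from a common pot fed by
  vertices of degree \<Delta>, and the count of points against blocks says that the pot suffices. A
  cycle of points alone would not do: its conflict graph may be an odd cycle, which cannot be
  colored from equal lists of two colors. The attached point makes it choosable, and the price is
  that as many points as blocks must be tolerated. Short cycles are excluded in the coloring part so
  that some point of the cycle does not conflict with the attached one. The rules have no slack at
  the smallest degree they allow: \<Delta> = 4 for \<Delta> + 1 colors, \<Delta> = 5 for \<Delta>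
  colors. Hence \<Delta> = 4 with \<Delta> colors needs further points, 3-vertices and 4-vertices
  among them.\<close>

lemma arc_no_open_subset:
  fixes g :: "real \<Rightarrow> complex"
  assumes "arc g" "open D" "D \<noteq> {}"
  shows "\<not> D \<subseteq> path_image g"
proof
  assume D: "D \<subseteq> path_image g"
  obtain h where h: "homeomorphism {0..1} (path_image g) g h"
    using homeomorphism_arc[OF assms(1)] .
  have "continuous_on D h" "inj_on h D"
    using h D by (auto simp: homeomorphism_def intro: continuous_on_subset)
      (metis (no_types, lifting) inj_onI subsetD)
  then show False
    using invariance_of_dimension[of D h] assms by simp
qed

section \<open>Plane drawings as sets of points and arcs\<close>

definition edge_rel :: "complex set \<Rightarrow> complex set set \<Rightarrow> complex rel" where
  "edge_rel V \<B> = {(p, q). \<exists>A\<in>\<B>. A \<inter> V = {p, q}}"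

definition drawing :: "complex set \<Rightarrow> complex set set \<Rightarrow> complex set" where
  "drawing V \<B> = V \<union> \<Union>\<B>"

text \<open>A cycle is witnessed by an edge that is not a bridge. This matches the case split of the
  inductions over edges: the ends of a new edge are already connected or they are not.\<close>

definition has_cycle :: "complex set \<Rightarrow> complex set set \<Rightarrow> bool" where
  "has_cycle V \<B> \<longleftrightarrow> (\<exists>A\<in>\<B>. \<exists>p q. A \<inter> V = {p, q} \<and> (p, q) \<in> (edge_rel V (\<B> - {A}))\<^sup>*)"

text \<open>The connected components of the graph; an isolated vertex forms one of its own.\<close>

definition classes :: "complex set \<Rightarrow> complex set set \<Rightarrow> complex set set" where
  "classes V \<B> = (\<lambda>x. (edge_rel V \<B>)\<^sup>* `` {x}) ` V"

lemma edge_rel_mono: "\<B> \<subseteq> \<C> \<Longrightarrow> edge_rel V \<B> \<subseteq> edge_rel V \<C>"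
  by (auto simp: edge_rel_def)

lemma sym_edge_rel: "sym ((edge_rel V \<B>)\<^sup>*)"
  by (intro sym_rtrancl) (auto simp: sym_def edge_rel_def insert_commute)

text \<open>Edges are bare point sets without direction or parametrization, the form in which
  separation theorems speak about them. Parallel edges are allowed.\<close>

locale plane_graph =
  fixes V :: "complex set" and \<E> :: "complex set set"
  assumes fin_V: "finite V" and fin_E: "finite \<E>"
    and edge_arc: "A \<in> \<E> \<Longrightarrow> \<exists>g. arc g \<and> path_image g = A \<and> A \<inter> V = {pathstart g, pathfinish g}"
    and edges_meet: "A \<in> \<E> \<Longrightarrow> B \<in> \<E> \<Longrightarrow> A \<noteq> B \<Longrightarrow> A \<inter> B \<subseteq> V"
begin

lemma edge_arcE:
  assumes "A \<in> \<E>" "A \<inter> V = {p, q}"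
  obtains g where "arc g" "path_image g = A" "pathstart g = p" "pathfinish g = q"
proof -
  obtain g where g: "arc g" "path_image g = A" "A \<inter> V = {pathstart g, pathfinish g}"
    using edge_arc[OF assms(1)] by blast
  then consider "pathstart g = p" "pathfinish g = q" | "pathstart g = q" "pathfinish g = p"
    using assms(2) by (auto simp: doubleton_eq_iff)
  then show ?thesis
  proof cases
    case 1
    then show ?thesis using g that by blast
  next
    case 2
    then show ?thesis using g that[of "reversepath g"] by (simp add: arc_reversepath)
  qed
qed

lemma edge_ends:
  assumes "A \<in> \<E>"
  obtains p q where "A \<inter> V = {p, q}" "p \<noteq> q" "p \<in> V" "q \<in> V" "p \<in> A" "q \<in> A"
  using edge_arc[OF assms] arc_distinct_ends that by blast

lemma edge_ends_neq: "A \<in> \<E> \<Longrightarrow> A \<inter> V = {p, q} \<Longrightarrow> p \<noteq> q"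
  by (metis edge_arcE arc_distinct_ends)

lemma compact_edge: "A \<in> \<E> \<Longrightarrow> compact A"
  using edge_arc compact_arc_image by blast

lemma connected_edge_complement: "A \<in> \<E> \<Longrightarrow> connected (- A)"
  using edge_arc connected_arc_complement by fastforce

lemma edge_interior_connected: "A \<in> \<E> \<Longrightarrow> connected (A - V)"
  by (metis Diff_Int2 Diff_Int_distrib2 Int_Diff Int_absorb connected_simple_path_endless
      arc_imp_simple_path edge_arc Diff_Diff_Int Diff_Int Diff_cancel Un_empty_left)

lemma edge_interior_nonempty: "A \<in> \<E> \<Longrightarrow> A - V \<noteq> {}"
  by (metis Diff_Int Diff_cancel Un_empty_left nonempty_simple_path_endless
      arc_imp_simple_path edge_arc)

lemma edge_no_open_subset: "A \<in> \<E> \<Longrightarrow> open D \<Longrightarrow> D \<noteq> {} \<Longrightarrow> \<not> D \<subseteq> A"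
  using edge_arc arc_no_open_subset by metis

lemma edge_meets_drawing:
  assumes "insert A \<B> \<subseteq> \<E>" "A \<notin> \<B>"
  shows "A \<inter> drawing V \<B> = A \<inter> V"
  using assms edges_meet by (fastforce simp: drawing_def)

lemma compact_drawing: "\<B> \<subseteq> \<E> \<Longrightarrow> compact (drawing V \<B>)"
  unfolding drawing_def
  by (rule compact_Un[OF finite_imp_compact compact_Union])
     (auto intro: compact_edge fin_V finite_subset[OF _ fin_E])

lemma open_drawing_complement: "\<B> \<subseteq> \<E> \<Longrightarrow> open (- drawing V \<B>)"
  using compact_drawing compact_imp_closed by blast

text \<open>
  The part of the drawing reachable from \<open>p\<close> and the rest meet the edge in one point each, so
  Janiszewski's theorem applies twice.
\<close>

lemma bridge_same_face:
  assumes AB: "insert A \<B> \<subseteq> \<E>" "A \<notin> \<B>" and pq: "A \<inter> V = {p, q}"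
    and nc: "(p, q) \<notin> (edge_rel V \<B>)\<^sup>*"
    and ab: "connected_component (- drawing V \<B>) a b" "a \<notin> A" "b \<notin> A"
  shows "connected_component (- drawing V (insert A \<B>)) a b"
proof -
  define U where "U = {x\<in>V. (p, x) \<in> (edge_rel V \<B>)\<^sup>*}"
  define R1 where "R1 = U \<union> \<Union>{B\<in>\<B>. B \<inter> V \<subseteq> U}"
  define R2 where "R2 = (V - U) \<union> \<Union>{B\<in>\<B>. B \<inter> V \<subseteq> V - U}"
  have fin: "finite U" "finite (V - U)" "finite \<B>"
    using fin_V fin_E AB by (auto simp: U_def intro: finite_subset)
  have cE: "compact B" if "B \<in> \<B>" for B using that AB compact_edge by auto
  have c1: "compact R1" unfolding R1_def
    by (rule compact_Un[OF finite_imp_compact compact_Union]) (use fin cE in auto)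
  have c2: "compact R2" unfolding R2_def
    by (rule compact_Un[OF finite_imp_compact compact_Union]) (use fin cE in auto)
  have side: "B \<inter> V \<subseteq> U \<or> B \<inter> V \<subseteq> V - U" if B: "B \<in> \<B>" for B
  proof -
    obtain x y where xy: "B \<inter> V = {x, y}" "x \<in> V" "y \<in> V"
      using edge_ends[of B] AB B by (metis insert_subset subsetD)
    then have "(x, y) \<in> edge_rel V \<B>" "(y, x) \<in> edge_rel V \<B>"
      using B by (auto simp: edge_rel_def)
    then have "x \<in> U \<longleftrightarrow> y \<in> U"
      using xy by (auto simp: U_def intro: rtrancl.rtrancl_into_rtrancl)
    then show ?thesis using xy by auto
  qed
  have R12: "R1 \<union> R2 = drawing V \<B>"
  proof
    show "R1 \<union> R2 \<subseteq> drawing V \<B>"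
      by (auto simp: R1_def R2_def drawing_def U_def)
    show "drawing V \<B> \<subseteq> R1 \<union> R2"
      using side by (fastforce simp: R1_def R2_def drawing_def)
  qed
  have pU: "p \<in> U" "q \<notin> U" "p \<in> V" "q \<in> V" using pq nc by (auto simp: U_def)
  have BB: "B \<inter> B' \<subseteq> V" if "B \<in> \<B>" "B' \<in> \<B>" "B \<noteq> B'" for B B'
    using edges_meet AB that by (metis insert_subset subsetD)
  have AM: "A \<inter> drawing V \<B> = {p, q}" using edge_meets_drawing[OF AB] pq by simp
  have disj: "R1 \<inter> R2 = {}"
  proof -
    have False if x: "x \<in> R1" "x \<in> R2" for x
    proof (cases "x \<in> V")
      case True
      then show False using x by (auto simp: R1_def R2_def)
    next
      case False
      then obtain B B' where B: "B \<in> \<B>" "B \<inter> V \<subseteq> U" "x \<in> B" "B' \<in> \<B>" "B' \<inter> V \<subseteq> V - U" "x \<in> B'"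
        using x by (auto simp: R1_def R2_def U_def)
      then have "B \<noteq> B'"
        using edge_ends[of B] AB by (metis Diff_iff IntI insert_subset subsetD)
      then show False using B BB False by blast
    qed
    then show ?thesis by blast
  qed
  have pR: "p \<in> R1" "q \<in> R2" using pU by (auto simp: R1_def R2_def)
  have A1: "R1 \<inter> A = {p}" and A2: "(R1 \<union> A) \<inter> R2 = {q}"
  proof -
    have "R1 \<inter> A \<subseteq> {p, q}" "R2 \<inter> A \<subseteq> {p, q}" "p \<in> A" "q \<in> A"
      using AM by (auto simp flip: R12)
    moreover have "p \<notin> R2" "q \<notin> R1" using pR disj by auto
    ultimately show "R1 \<inter> A = {p}" "(R1 \<union> A) \<inter> R2 = {q}"
      using pR disj by auto
  qed
  have Ac: "compact A" using compact_edge AB by auto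
  have "connected_component (- R1) a b" "connected_component (- R2) a b"
    using ab(1) by (auto intro: connected_component_of_subset simp: R12[symmetric])
  moreover have "connected_component (- A) a b"
    using connected_edge_complement AB ab by (metis ComplI connected_iff_connected_component insert_subset)
  ultimately have "connected_component (- (R1 \<union> A)) a b"
    by (intro Janiszewski[OF c1 compact_imp_closed[OF Ac]]) (simp_all add: A1)
  then have "connected_component (- ((R1 \<union> A) \<union> R2)) a b"
    by (intro Janiszewski[OF compact_Un[OF c1 Ac] compact_imp_closed[OF c2]])
       (use A2 \<open>connected_component (- R2) a b\<close> in simp_all)
  moreover have "(R1 \<union> A) \<union> R2 = drawing V (insert A \<B>)"
    using R12 by (auto simp: drawing_def)
  ultimately show ?thesis by simp
qed

section \<open>Closing an edge to a Jordan curve\<close>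

lemma connecting_arc:
  assumes "\<B> \<subseteq> \<E>" "(p, q) \<in> (edge_rel V \<B>)\<^sup>*" "p \<in> V" "p \<noteq> q"
  obtains g where "arc g" "path_image g \<subseteq> drawing V \<B>" "pathstart g = p" "pathfinish g = q"
proof -
  have "path_component (drawing V \<B>) p q"
    using assms(2)
  proof (induction rule: rtrancl_induct)
    case base
    then show ?case using assms(3) by (simp add: drawing_def path_component_refl)
  next
    case (step y z)
    then obtain A where A: "A \<in> \<B>" "A \<inter> V = {y, z}" by (auto simp: edge_rel_def)
    then obtain g where "arc g" "path_image g = A" "pathstart g = y" "pathfinish g = z"
      using edge_arcE assms(1) by (metis subsetD)
    then have "path_component (drawing V \<B>) y z"
      using A unfolding path_component_def drawing_def
      by (metis Union_upper arc_imp_path sup.coboundedI2)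
    then show ?case using step.IH path_component_trans by blast
  qed
  then show ?thesis
    using assms(4) that unfolding path_component_def
    by (metis (no_types, lifting) path_contains_arc order_trans)
qed

text \<open>The last equation prepares Janiszewski's theorem: the Jordan curve meets the old drawing
  in an arc, hence in a connected set.\<close>

lemma closing_curve:
  assumes AB: "insert A \<B> \<subseteq> \<E>" "A \<notin> \<B>" and pq: "A \<inter> V = {p, q}"
    and conn: "(p, q) \<in> (edge_rel V \<B>)\<^sup>*"
  obtains c g where "arc g" "path_image g \<subseteq> drawing V \<B>" "simple_path c" "pathfinish c = pathstart c"
    "path_image c = A \<union> path_image g" "drawing V \<B> \<inter> path_image c = path_image g"
proof -
  have ne: "p \<noteq> q" using edge_ends_neq AB pq by auto
  obtain g where g: "arc g" "path_image g \<subseteq> drawing V \<B>" "pathstart g = p" "pathfinish g = q"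
    using connecting_arc[OF _ conn _ ne] AB pq by (metis Int_iff insertI1 insert_subset)
  obtain h where h: "arc h" "path_image h = A" "pathstart h = q" "pathfinish h = p"
    using edge_arcE[of A q p] AB pq by (auto simp: insert_commute)
  have AM: "A \<inter> drawing V \<B> = {p, q}" using edge_meets_drawing[OF AB] pq by simp
  have pqg: "{p, q} \<subseteq> path_image g"
    using g by (metis empty_subsetI insert_subset pathfinish_in_path_image pathstart_in_path_image)
  have "simple_path (h +++ g)"
    using g h AM by (intro simple_path_join_loop) auto
  moreover have "path_image (h +++ g) = A \<union> path_image g"
    using g h by (simp add: path_image_join)
  moreover have "drawing V \<B> \<inter> (A \<union> path_image g) = path_image g"
    using AM g(2) pqg by blast
  ultimately show ?thesis
    using that[of g "h +++ g"] g h by auto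
qed

text \<open>Janiszewski's theorem for the old drawing and the curve: their intersection is the arc
  \<open>g\<close>, and neither of them separates \<open>a\<close> from \<open>b\<close>.\<close>

lemma same_side_same_face:
  assumes "\<B> \<subseteq> \<E>" "arc g" "simple_path c" "pathfinish c = pathstart c"
    "path_image c = A \<union> path_image g" "drawing V \<B> \<inter> path_image c = path_image g"
    and ab: "connected_component (- drawing V \<B>) a b" "connected_component (- path_image c) a b"
  shows "connected_component (- drawing V (insert A \<B>)) a b"
proof -
  have "connected_component (- (drawing V \<B> \<union> path_image c)) a b"
    by (rule Janiszewski)
       (use assms compact_drawing closed_simple_path_image[of c] connected_arc_image[of g] in auto)
  moreover have "drawing V \<B> \<union> path_image c = drawing V (insert A \<B>)"
    using assms by (auto simp: drawing_def)
  ultimately show ?thesis by simp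
qed

section \<open>Faces and their refinement by a new edge\<close>

definition face_at :: "complex set set \<Rightarrow> complex \<Rightarrow> complex set" where
  "face_at \<B> x = connected_component_set (- drawing V \<B>) x"

abbreviation faces :: "complex set set \<Rightarrow> complex set set" where
  "faces \<B> \<equiv> components (- drawing V \<B>)"

lemma face_at_eq_iff:
  "x \<notin> drawing V \<B> \<Longrightarrow> y \<notin> drawing V \<B> \<Longrightarrow>
    face_at \<B> x = face_at \<B> y \<longleftrightarrow> connected_component (- drawing V \<B>) x y"
  by (simp add: face_at_def connected_component_eq_eq)

lemma face_at_eq: "y \<in> face_at \<B> x \<Longrightarrow> face_at \<B> y = face_at \<B> x"
  unfolding face_at_def by (rule connected_component_eq)

lemma facesE:
  assumes "C \<in> faces \<B>"
  obtains x where "x \<notin> drawing V \<B>" "C = face_at \<B> x"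
  using assms by (auto simp: face_at_def components_def)

lemma face_atI: "x \<notin> drawing V \<B> \<Longrightarrow> face_at \<B> x \<in> faces \<B>"
  by (auto simp: face_at_def components_def)

lemma open_face: "\<B> \<subseteq> \<E> \<Longrightarrow> C \<in> faces \<B> \<Longrightarrow> open C"
  using open_components open_drawing_complement by blast

text \<open>The face of \<open>\<B>\<close> that contains the face \<open>C\<close> of a larger drawing.\<close>

definition coarse :: "complex set set \<Rightarrow> complex set \<Rightarrow> complex set" where
  "coarse \<B> C = face_at \<B> (SOME x. x \<in> C)"

text \<open>The choice in \<open>coarse\<close> does not matter, because a face of the larger
  drawing lies inside a single face of the smaller one.\<close>

lemma coarse_face_at:
  assumes "x \<notin> drawing V (insert A \<B>)"
  shows "coarse \<B> (face_at (insert A \<B>) x) = face_at \<B> x"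
proof -
  let ?C = "face_at (insert A \<B>) x"
  have "x \<in> ?C" using assms by (simp add: face_at_def connected_component_refl)
  then have y: "(SOME x. x \<in> ?C) \<in> ?C" by (rule someI)
  have sub: "- drawing V (insert A \<B>) \<subseteq> - drawing V \<B>" by (auto simp: drawing_def)
  have "connected_component (- drawing V \<B>) x (SOME x. x \<in> ?C)"
    using y connected_component_of_subset[OF _ sub] by (simp add: face_at_def)
  then show ?thesis
    unfolding coarse_def by (intro face_at_eq) (simp add: face_at_def)
qed

lemma faces_refine:
  assumes AB: "insert A \<B> \<subseteq> \<E>"
  shows "coarse \<B> ` faces (insert A \<B>) = faces \<B>"
proof
  show "coarse \<B> ` faces (insert A \<B>) \<subseteq> faces \<B>"
  proof clarify
    fix C assume "C \<in> faces (insert A \<B>)"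
    then obtain x where "x \<notin> drawing V (insert A \<B>)" "C = face_at (insert A \<B>) x" by (rule facesE)
    then show "coarse \<B> C \<in> faces \<B>"
      using coarse_face_at face_atI by (auto simp: drawing_def)
  qed
  show "faces \<B> \<subseteq> coarse \<B> ` faces (insert A \<B>)"
  proof
    fix D assume D: "D \<in> faces \<B>"
    then have "open D" "D \<noteq> {}" "D \<subseteq> - drawing V \<B>"
      using open_face[OF _ D] AB in_components_nonempty[OF D] in_components_subset[OF D] by auto
    \<comment> \<open>An arc contains no nonempty open set, so each old face keeps a point off the
      new edge.\<close>
    then obtain x where x: "x \<in> D" "x \<notin> A" "x \<notin> drawing V \<B>"
      using edge_no_open_subset[of A D] AB by blast
    then have nx: "x \<notin> drawing V (insert A \<B>)" by (auto simp: drawing_def)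
    have "D = face_at \<B> x"
      using D x(1) by (metis facesE face_at_eq)
    then show "D \<in> coarse \<B> ` faces (insert A \<B>)"
      using coarse_face_at[OF nx] face_atI[OF nx] by blast
  qed
qed

lemma bridge_coarse_inj:
  assumes AB: "insert A \<B> \<subseteq> \<E>" "A \<notin> \<B>" and pq: "A \<inter> V = {p, q}"
    and nc: "(p, q) \<notin> (edge_rel V \<B>)\<^sup>*"
  shows "inj_on (coarse \<B>) (faces (insert A \<B>))"
proof (rule inj_onI)
  fix C D assume C: "C \<in> faces (insert A \<B>)" and D: "D \<in> faces (insert A \<B>)"
    and eq: "coarse \<B> C = coarse \<B> D"
  obtain x where x: "x \<notin> drawing V (insert A \<B>)" "C = face_at (insert A \<B>) x"
    using C by (rule facesE)
  obtain y where y: "y \<notin> drawing V (insert A \<B>)" "D = face_at (insert A \<B>) y"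
    using D by (rule facesE)
  have nin: "x \<notin> drawing V \<B>" "y \<notin> drawing V \<B>" "x \<notin> A" "y \<notin> A"
    using x y by (auto simp: drawing_def)
  then have "connected_component (- drawing V \<B>) x y"
    using eq coarse_face_at[OF x(1)] coarse_face_at[OF y(1)] face_at_eq_iff[OF nin(1,2)]
    unfolding x(2) y(2) by simp
  then have "connected_component (- drawing V (insert A \<B>)) x y"
    using bridge_same_face[OF AB pq nc _ nin(3,4)] by blast
  then show "C = D"
    unfolding x(2) y(2) using face_at_eq_iff[OF x(1) y(1)] by simp
qed

text \<open>\<open>J\<close> is a Jordan curve through \<open>A\<close> inside the drawing, and its
  side distinguishes the pieces of one old face. Some old face really is cut: near an inner point of
  \<open>A\<close> there are points on both sides of \<open>J\<close> in a ball that avoids the old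
  drawing.\<close>

lemma cycle_edge_two_faces:
  assumes AB: "insert A \<B> \<subseteq> \<E>" "A \<notin> \<B>" and pq: "A \<inter> V = {p, q}"
    and conn: "(p, q) \<in> (edge_rel V \<B>)\<^sup>*"
  obtains J where
    "inj_on (\<lambda>C. (coarse \<B> C, C \<subseteq> inside J)) (faces (insert A \<B>))"
    "\<exists>C\<in>faces (insert A \<B>). \<exists>D\<in>faces (insert A \<B>). C \<noteq> D \<and> coarse \<B> C = coarse \<B> D"
proof -
  obtain c g where c: "arc g" "path_image g \<subseteq> drawing V \<B>" "simple_path c" "pathfinish c = pathstart c"
    "path_image c = A \<union> path_image g" "drawing V \<B> \<inter> path_image c = path_image g"
    by (rule closing_curve[OF AB pq conn])
  define J where "J = path_image c"
  have JS: "J \<subseteq> drawing V (insert A \<B>)"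
    using c by (auto simp: J_def drawing_def)
  have Jord: "inside J \<inter> outside J = {}" "inside J \<union> outside J = - J"
    "connected (inside J)" "connected (outside J)"
    "frontier (inside J) = J" "frontier (outside J) = J"
    using Jordan_inside_outside[OF c(3,4)] by (auto simp: J_def)
  have off: "inside J \<subseteq> - J" "outside J \<subseteq> - J" using Jord by blast+
  have side: "face_at (insert A \<B>) x \<subseteq> inside J \<longleftrightarrow> x \<in> inside J" if "x \<notin> drawing V (insert A \<B>)" for x
  proof
    have "x \<in> face_at (insert A \<B>) x"
      using that by (simp add: face_at_def connected_component_refl)
    then show "face_at (insert A \<B>) x \<subseteq> inside J \<Longrightarrow> x \<in> inside J" by blast
    show "face_at (insert A \<B>) x \<subseteq> inside J" if "x \<in> inside J"
    proof
      fix y assume "y \<in> face_at (insert A \<B>) x"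
      then have "connected_component (- J) x y"
        using connected_component_of_subset[of _ x y "- J"] JS by (auto simp: face_at_def)
      then show "y \<in> inside J" using inside_same_component that by blast
    qed
  qed
  have inj: "inj_on (\<lambda>C. (coarse \<B> C, C \<subseteq> inside J)) (faces (insert A \<B>))"
  proof (rule inj_onI)
    fix C D assume C: "C \<in> faces (insert A \<B>)" and D: "D \<in> faces (insert A \<B>)"
      and eq: "(coarse \<B> C, C \<subseteq> inside J) = (coarse \<B> D, D \<subseteq> inside J)"
    obtain x where x: "x \<notin> drawing V (insert A \<B>)" "C = face_at (insert A \<B>) x"
      using C by (rule facesE)
    obtain y where y: "y \<notin> drawing V (insert A \<B>)" "D = face_at (insert A \<B>) y"
      using D by (rule facesE)
    have nin: "x \<notin> drawing V \<B>" "y \<notin> drawing V \<B>"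
      using x y by (auto simp: drawing_def)
    then have 1: "connected_component (- drawing V \<B>) x y"
      using eq coarse_face_at[OF x(1)] coarse_face_at[OF y(1)] face_at_eq_iff[OF nin(1,2)]
      unfolding x(2) y(2) by simp
    have "x \<in> inside J \<longleftrightarrow> y \<in> inside J" using eq x y side by simp
    moreover have "x \<in> - J" "y \<in> - J" using x y JS by auto
    ultimately have "connected_component (- J) x y"
    proof (cases "x \<in> inside J")
      case True
      then show ?thesis using Jord \<open>x \<in> inside J \<longleftrightarrow> y \<in> inside J\<close>
        unfolding connected_component_def by (intro exI[of _ "inside J"] conjI) (use off in blast)+
    next
      case False
      then have "x \<in> outside J" "y \<in> outside J"
        using Jord \<open>x \<in> inside J \<longleftrightarrow> y \<in> inside J\<close> \<open>x \<in> - J\<close> \<open>y \<in> - J\<close> by blast+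
      then show ?thesis using Jord
        unfolding connected_component_def by (intro exI[of _ "outside J"] conjI) (use off in blast)+
    qed
    then have "connected_component (- drawing V (insert A \<B>)) x y"
      using same_side_same_face[OF _ c(1,3-6) 1] AB by (auto simp: J_def)
    then show "C = D"
      unfolding x(2) y(2) using face_at_eq_iff[OF x(1) y(1)] by simp
  qed
  have "\<exists>C\<in>faces (insert A \<B>). \<exists>D\<in>faces (insert A \<B>). C \<noteq> D \<and> coarse \<B> C = coarse \<B> D"
  proof -
    obtain m where m: "m \<in> A" "m \<notin> V" using edge_interior_nonempty[of A] AB by auto
    then have "m \<notin> drawing V \<B>" using edge_meets_drawing[OF AB] by auto
    then obtain e where e: "e > 0" "ball m e \<subseteq> - drawing V \<B>"
      using open_drawing_complement[of \<B>] AB by (metis ComplI insert_subset openE)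
    have "m \<in> closure (inside J)" "m \<in> closure (outside J)"
      using Jord m c by (auto simp: frontier_def J_def)
    then obtain x y where xy: "x \<in> inside J" "dist x m < e" "y \<in> outside J" "dist y m < e"
      using e(1) by (meson closure_approachable)
    have "A \<subseteq> J" using c(5) by (auto simp: J_def)
    then have nA: "x \<notin> A" "y \<notin> A" using xy off by auto
    have b: "x \<in> ball m e" "y \<in> ball m e" using xy by (auto simp: dist_commute)
    have nx: "x \<notin> drawing V (insert A \<B>)" and ny: "y \<notin> drawing V (insert A \<B>)"
      using b e nA by (auto simp: drawing_def)
    have "connected_component (- drawing V \<B>) x y"
      unfolding connected_component_def using b e(2) by (intro exI[of _ "ball m e"]) auto
    then have "face_at \<B> x = face_at \<B> y"
      using face_at_eq_iff nx ny by (auto simp: drawing_def)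
    moreover have "face_at (insert A \<B>) x \<noteq> face_at (insert A \<B>) y"
      using side[OF nx] side[OF ny] xy Jord(1) by blast
    ultimately show ?thesis
      using coarse_face_at[OF nx] coarse_face_at[OF ny] face_atI[OF nx] face_atI[OF ny]
      by (intro bexI[of _ "face_at (insert A \<B>) x"] bexI[of _ "face_at (insert A \<B>) y"]) auto
  qed
  then show ?thesis using inj that by blast
qed

section \<open>Counting faces and components\<close>

lemma connected_compl_V: "connected (- V)"
  using connected_open_delete_finite[OF open_UNIV convex_connected[OF convex_UNIV] _ fin_V]
  by (simp add: Compl_eq_Diff_UNIV)

text \<open>Each new edge at most doubles the number of faces, since old face and side of
  \<open>J\<close> determine the new face.\<close>

lemma finite_faces: "\<B> \<subseteq> \<E> \<Longrightarrow> finite (faces \<B>)"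
proof -
  assume B: "\<B> \<subseteq> \<E>"
  then have "finite \<B>" using fin_E finite_subset by blast
  then show ?thesis using B
  proof (induction \<B> rule: finite_induct)
    case empty
    have "faces {} \<subseteq> {- V}"
      using connected_eq_components_subset_sing[of "- V"] connected_compl_V by (simp add: drawing_def)
    then show ?case by (rule finite_subset) simp
  next
    case (insert A \<B>)
    obtain p q where pq: "A \<inter> V = {p, q}" by (rule edge_ends[of A]) (use insert.prems in auto)
    have fin: "finite (coarse \<B> ` faces (insert A \<B>))"
      using faces_refine[OF insert.prems] insert by auto
    show ?case
    proof (cases "(p, q) \<in> (edge_rel V \<B>)\<^sup>*")
      case True
      then obtain J where J: "inj_on (\<lambda>C. (coarse \<B> C, C \<subseteq> inside J)) (faces (insert A \<B>))"
        using cycle_edge_two_faces[OF insert.prems insert.hyps(2) pq] by blast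
      have "finite ((\<lambda>C. (coarse \<B> C, C \<subseteq> inside J)) ` faces (insert A \<B>))"
        by (rule finite_subset[of _ "coarse \<B> ` faces (insert A \<B>) \<times> UNIV"]) (use fin in auto)
      then show ?thesis using J finite_imageD by blast
    next
      case False
      then show ?thesis
        using bridge_coarse_inj[OF insert.prems insert.hyps(2) pq] fin finite_imageD by blast
    qed
  qed
qed

lemma classes_insert_bridge:
  assumes pq: "A \<inter> V = {p, q}" and nc: "(p, q) \<notin> (edge_rel V \<B>)\<^sup>*"
  shows "card (classes V (insert A \<B>)) + 1 \<le> card (classes V \<B>)"
proof -
  let ?r = "(edge_rel V \<B>)\<^sup>*" and ?r' = "(edge_rel V (insert A \<B>))\<^sup>*"
  let ?P = "?r `` {p}" and ?Q = "?r `` {q}"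
  have sub: "?r \<subseteq> ?r'" by (intro rtrancl_mono edge_rel_mono) auto
  have eq: "?r' `` (?r `` {x}) = ?r' `` {x}" for x using sub by (auto intro: rtrancl_trans)
  have V: "p \<in> V" "q \<in> V" using pq by auto
  then have PQ: "?P \<in> classes V \<B>" "?Q \<in> classes V \<B>" by (auto simp: classes_def)
  have "(p, q) \<in> ?r'" "(q, p) \<in> ?r'"
    using pq by (auto simp: edge_rel_def insert_commute)
  then have "?r' `` ?P = ?r' `` ?Q" unfolding eq by (auto intro: rtrancl_trans)
  moreover have "?P \<noteq> ?Q" using nc by auto
  ultimately have "?r' `` ?Q \<in> (\<lambda>C. ?r' `` C) ` (classes V \<B> - {?Q})"
    using PQ by (intro image_eqI[of _ _ ?P]) auto
  then have "(\<lambda>C. ?r' `` C) ` classes V \<B> = (\<lambda>C. ?r' `` C) ` (classes V \<B> - {?Q})"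
    using PQ(2) by (metis image_insert insert_Diff insert_absorb)
  moreover have "(\<lambda>C. ?r' `` C) ` classes V \<B> = classes V (insert A \<B>)"
    unfolding classes_def image_image eq by simp
  ultimately have "card (classes V (insert A \<B>)) \<le> card (classes V \<B> - {?Q})"
    using fin_V card_image_le[of "classes V \<B> - {?Q}" "\<lambda>C. ?r' `` C"] by (simp add: classes_def)
  moreover have "card (classes V \<B>) > 0"
    using PQ fin_V by (auto simp: classes_def card_gt_0_iff)
  ultimately show ?thesis using PQ(2) by (simp add: card_Diff_singleton)
qed

lemma classes_insert_eq:
  assumes "A \<inter> V = {p, q}" "(p, q) \<in> (edge_rel V \<B>)\<^sup>*"
  shows "classes V (insert A \<B>) = classes V \<B>"
proof -
  have rel: "edge_rel V (insert A \<B>) = edge_rel V \<B> \<union> {(p, q), (q, p)}"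
    using assms by (auto simp: edge_rel_def doubleton_eq_iff)
  have "(edge_rel V (insert A \<B>))\<^sup>* = (edge_rel V \<B>)\<^sup>*"
    unfolding rel using assms(2) sym_edge_rel[of V \<B>]
    by (intro rtrancl_subset) (auto dest: symD)
  then show ?thesis by (simp add: classes_def)
qed

text \<open>A new edge either merges two components or closes a cycle, and in the latter case it
  creates a face; both preserve the inequality.\<close>

lemma euler_le:
  assumes "\<B> \<subseteq> \<E>"
  shows "card \<B> + card (classes V \<B>) + 1 \<le> card (faces \<B>) + card V"
proof -
  have "finite \<B>" using assms fin_E finite_subset by blast
  then show ?thesis using assms
  proof (induction \<B> rule: finite_induct)
    case empty
    have "faces {} \<noteq> {}"
      using fin_V infinite_UNIV_char_0[where 'a = complex]
      by (simp add: drawing_def) (metis Compl_empty_eq double_compl)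
    then have "card (faces {}) \<ge> 1"
      using finite_faces[of "{}"] by (simp add: Suc_le_eq card_gt_0_iff)
    moreover have "card (classes V {}) \<le> card V"
      by (simp add: classes_def card_image_le fin_V)
    ultimately show ?case by simp
  next
    case (insert A \<B>)
    obtain p q where pq: "A \<inter> V = {p, q}" by (rule edge_ends[of A]) (use insert.prems in auto)
    have fin: "finite (faces (insert A \<B>))" using finite_faces insert.prems by blast
    have ref: "coarse \<B> ` faces (insert A \<B>) = faces \<B>" by (rule faces_refine[OF insert.prems])
    show ?case
    proof (cases "(p, q) \<in> (edge_rel V \<B>)\<^sup>*")
      case True
      have "\<exists>C\<in>faces (insert A \<B>). \<exists>D\<in>faces (insert A \<B>). C \<noteq> D \<and> coarse \<B> C = coarse \<B> D"
        by (rule cycle_edge_two_faces[OF insert.prems insert.hyps(2) pq True])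
      then obtain C D where CD: "C \<in> faces (insert A \<B>)" "D \<in> faces (insert A \<B>)" "C \<noteq> D"
        "coarse \<B> C = coarse \<B> D" by auto
      have "faces \<B> = coarse \<B> ` (faces (insert A \<B>) - {D})"
      proof -
        have "coarse \<B> D \<in> coarse \<B> ` (faces (insert A \<B>) - {D})"
          using CD by (intro image_eqI[of _ _ C]) auto
        then show ?thesis using ref CD(2) by (metis image_insert insert_Diff insert_absorb)
      qed
      then have "card (faces \<B>) \<le> card (faces (insert A \<B>) - {D})"
        using card_image_le fin by (metis finite_Diff)
      also have "\<dots> = card (faces (insert A \<B>)) - 1" using CD fin by simp
      finally have "card (faces \<B>) + 1 \<le> card (faces (insert A \<B>))"
        using CD fin card_gt_0_iff[of "faces (insert A \<B>)"] by fastforce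
      then show ?thesis
        using insert True pq classes_insert_eq by auto
    next
      case False
      have "card (faces \<B>) \<le> card (faces (insert A \<B>))"
        using ref card_image_le fin by metis
      then show ?thesis
        using insert classes_insert_bridge[OF pq False] by auto
    qed
  qed
qed

text \<open>In an acyclic drawing every edge is a bridge at the moment it is added, and bridges do
  not separate.\<close>

lemma acyclic_one_face:
  assumes "\<B> \<subseteq> \<E>" "\<not> has_cycle V \<B>"
  shows "connected (- drawing V \<B>)"
proof -
  have "finite \<B>" using assms fin_E finite_subset by blast
  then show ?thesis using assms
  proof (induction \<B> rule: finite_induct)
    case empty
    show ?case using connected_compl_V by (simp add: drawing_def)
  next
    case (insert A \<B>)
    obtain p q where pq: "A \<inter> V = {p, q}" by (rule edge_ends[of A]) (use insert.prems in auto)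
    have nc: "(p, q) \<notin> (edge_rel V \<B>)\<^sup>*"
      using insert.prems insert.hyps pq by (auto simp: has_cycle_def)
    have "\<not> has_cycle V \<B>"
    proof
      assume "has_cycle V \<B>"
      then obtain B x y where B: "B \<in> \<B>" "B \<inter> V = {x, y}" "(x, y) \<in> (edge_rel V (\<B> - {B}))\<^sup>*"
        by (auto simp: has_cycle_def)
      then have "(x, y) \<in> (edge_rel V (insert A \<B> - {B}))\<^sup>*"
        using rtrancl_mono[OF edge_rel_mono[of "\<B> - {B}" "insert A \<B> - {B}" V]]
        by (auto intro: subsetD)
      then have "has_cycle V (insert A \<B>)"
        unfolding has_cycle_def using B(1,2)
        by (intro bexI[of _ B] exI[of _ x] exI[of _ y]) auto
      then show False using insert.prems by simp
    qed
    then have "connected (- drawing V \<B>)" using insert by auto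
    then show ?case
      using bridge_same_face[OF insert.prems(1) insert.hyps(2) pq nc]
      unfolding connected_iff_connected_component by (auto simp: drawing_def)
  qed
qed

section \<open>Borders of faces and the girth bound\<close>

definition border :: "complex set \<Rightarrow> complex set set" where
  "border C = {A\<in>\<E>. closure C \<inter> (A - V) \<noteq> {}}"

text \<open>An acyclic border would have a connected complement. This complement contains
  \<open>C\<close> and avoids its frontier, so it equals \<open>C\<close>; then nothing of the
  drawing lies off the border, which must consist of all edges, including those of a cycle.\<close>

lemma border_has_cycle:
  assumes cyc: "has_cycle V \<E>" and C: "C \<in> faces \<E>"
  shows "has_cycle V (border C)"
proof (rule ccontr)
  assume nc: "\<not> has_cycle V (border C)"
  have sub: "border C \<subseteq> \<E>" by (auto simp: border_def)
  let ?F = "drawing V (border C)"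
  have conn: "connected (- ?F)" by (rule acyclic_one_face[OF sub nc])
  have Co: "open C" "C \<noteq> {}" "C \<subseteq> - drawing V \<E>"
    using open_face[OF _ C] in_components_nonempty[OF C] in_components_subset[OF C] by auto
  have fr: "frontier C \<subseteq> ?F"
  proof
    fix x assume x: "x \<in> frontier C"
    have "x \<in> drawing V \<E>"
    proof (rule ccontr)
      assume nx: "x \<notin> drawing V \<E>"
      have op: "open (face_at \<E> x)" "x \<in> face_at \<E> x"
        using open_face[OF _ face_atI[OF nx]] nx by (auto simp: face_at_def connected_component_refl)
      have "x \<in> closure C" using x by (simp add: frontier_def)
      then have "C \<inter> face_at \<E> x \<noteq> {}"
        using op open_Int_closure_eq_empty[of "face_at \<E> x" C] by blast
      then have "C = face_at \<E> x"
        using C face_atI[OF nx] components_eq by blast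
      then show False using x op Co by (simp add: frontier_def interior_open)
    qed
    then consider "x \<in> V" | A where "A \<in> \<E>" "x \<in> A" "x \<notin> V" by (auto simp: drawing_def)
    then show "x \<in> ?F"
    proof cases
      case 2
      then have "A \<in> border C" using x by (auto simp: border_def frontier_def)
      then show ?thesis using 2 by (auto simp: drawing_def)
    qed (simp add: drawing_def)
  qed
  have "C \<subseteq> - ?F" using Co sub by (auto simp: drawing_def)
  have "- ?F \<subseteq> C"
  proof (rule ccontr)
    assume "\<not> - ?F \<subseteq> C"
    then have "- ?F \<inter> frontier C \<noteq> {}"
      using conn \<open>C \<subseteq> - ?F\<close> Co by (intro connected_Int_frontier) auto
    then show False using fr by auto
  qed
  then have "drawing V \<E> \<subseteq> ?F" using Co by auto
  have "\<E> \<subseteq> border C"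
  proof
    fix A assume A: "A \<in> \<E>"
    obtain m where m: "m \<in> A" "m \<notin> V" using edge_interior_nonempty[OF A] by auto
    then have "m \<in> ?F" using \<open>drawing V \<E> \<subseteq> ?F\<close> A by (auto simp: drawing_def)
    then obtain B where B: "B \<in> border C" "m \<in> B" using m by (auto simp: drawing_def)
    then show "A \<in> border C" using edges_meet[OF A, of B] sub m by auto
  qed
  then show False using nc cyc sub by (metis subset_antisym)
qed

text \<open>All faces bordering \<open>A\<close> lie in the one face of the drawing without
  \<open>A\<close> that contains the inner points of \<open>A\<close>, and adding \<open>A\<close>
  cuts that face into at most two.\<close>

lemma edge_borders_le_2:
  assumes A: "A \<in> \<E>"
  shows "card {C\<in>faces \<E>. A \<in> border C} \<le> 2"
proof -
  define \<B> where "\<B> = \<E> - {A}"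
  have ins: "insert A \<B> = \<E>" and AB: "insert A \<B> \<subseteq> \<E>" "A \<notin> \<B>" and BE: "\<B> \<subseteq> \<E>"
    using A by (auto simp: \<B>_def)
  obtain p q where pq: "A \<inter> V = {p, q}" by (rule edge_ends[OF A])
  let ?F = "{C\<in>faces \<E>. A \<in> border C}"
  have int: "A - V \<subseteq> - drawing V \<B>" using edge_meets_drawing[OF AB] by auto
  obtain m where m: "m \<in> A" "m \<notin> V" using edge_interior_nonempty[OF A] by auto
  have crs: "coarse \<B> C = face_at \<B> m" if C: "C \<in> ?F" for C
  proof -
    obtain x where x: "x \<notin> drawing V \<E>" "C = face_at \<E> x" using C facesE by blast
    obtain n where n: "n \<in> closure C" "n \<in> A" "n \<notin> V" using C by (auto simp: border_def)
    have nS: "n \<notin> drawing V \<B>" using n int by auto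
    have "open (face_at \<B> n)" "n \<in> face_at \<B> n"
      using open_face[OF BE face_atI[OF nS]] nS by (auto simp: face_at_def connected_component_refl)
    then obtain y where y: "y \<in> C" "y \<in> face_at \<B> n"
      using n open_Int_closure_eq_empty[of "face_at \<B> n" C] by blast
    have yS: "y \<notin> drawing V \<E>" using y C in_components_subset by blast
    then have "C = face_at \<E> y"
      using y(1) face_at_eq unfolding x(2) by blast
    then have "coarse \<B> C = face_at \<B> y" using coarse_face_at[of y A \<B>] yS ins by simp
    also have "\<dots> = face_at \<B> n" using y(2) by (rule face_at_eq)
    also have "\<dots> = face_at \<B> m"
    proof -
      have "connected_component (- drawing V \<B>) n m"
        unfolding connected_component_def using edge_interior_connected[OF A] int n m by blast
      then show ?thesis by (intro face_at_eq[symmetric]) (simp add: face_at_def)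
    qed
    finally show ?thesis .
  qed
  show ?thesis
  proof (cases "(p, q) \<in> (edge_rel V \<B>)\<^sup>*")
    case True
    then obtain J where J: "inj_on (\<lambda>C. (coarse \<B> C, C \<subseteq> inside J)) (faces \<E>)"
      using cycle_edge_two_faces[OF AB pq] ins by metis
    have "inj_on (\<lambda>C. C \<subseteq> inside J) ?F"
      using J crs by (auto simp: inj_on_def)
    then have "card ?F \<le> card (UNIV :: bool set)"
      by (intro card_inj_on_le) auto
    then show ?thesis by simp
  next
    case False
    then have "inj_on (coarse \<B>) (faces \<E>)" using bridge_coarse_inj[OF AB pq] ins by metis
    then have "C = D" if "C \<in> ?F" "D \<in> ?F" for C D
      using that crs by (auto simp: inj_on_def)
    then have "card ?F \<le> 1" by (simp add: card_le_Suc0_iff_eq[OF finite_subset[OF _ finite_faces[of \<E>]]])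
    then show ?thesis by simp
  qed
qed

text \<open>With a cycle, every border has at least \<open>g\<close> edges, each counted for at most
  two faces, and this is put into Euler's inequality. Without a cycle there is one face and fewer
  edges than vertices.\<close>

theorem euler_girth:
  assumes girth: "\<And>\<B>. \<B> \<subseteq> \<E> \<Longrightarrow> has_cycle V \<B> \<Longrightarrow> g \<le> card \<B>"
    and ne: "\<E> \<noteq> {}" and g: "g \<ge> 2"
  shows "(g - 2) * card \<E> < g * card V"
proof -
  have "V \<noteq> {}" using ne edge_ends by (metis all_not_in_conv)
  then have cls: "card (classes V \<E>) \<ge> 1"
    using fin_V by (simp add: classes_def Suc_le_eq card_gt_0_iff)
  have eu: "card \<E> + card (classes V \<E>) + 1 \<le> card (faces \<E>) + card V" by (rule euler_le) simp
  have Vpos: "card V > 0" using \<open>V \<noteq> {}\<close> fin_V by (simp add: card_gt_0_iff)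
  show ?thesis
  proof (cases "has_cycle V \<E>")
    case True
    have fF: "finite (faces \<E>)" by (rule finite_faces) simp
    have "g * card (faces \<E>) \<le> (\<Sum>C\<in>faces \<E>. card (border C))"
      using sum_mono[of "faces \<E>" "\<lambda>_. g" "\<lambda>C. card (border C)"] girth border_has_cycle[OF True]
      by (simp add: border_def mult.commute)
    also have "\<dots> = (\<Sum>C\<in>faces \<E>. \<Sum>A\<in>\<E>. if A \<in> border C then 1 else 0)"
      using fin_E by (intro sum.cong refl) (simp add: border_def sum.If_cases Int_def)
    also have "\<dots> = (\<Sum>A\<in>\<E>. \<Sum>C\<in>faces \<E>. if A \<in> border C then 1 else 0)" by (rule sum.swap)
    also have "\<dots> = (\<Sum>A\<in>\<E>. card {C\<in>faces \<E>. A \<in> border C})"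
      using fF by (intro sum.cong refl) (simp add: sum.If_cases Int_def)
    also have "\<dots> \<le> (\<Sum>A\<in>\<E>. 2)" by (intro sum_mono edge_borders_le_2)
    finally have "g * card (faces \<E>) \<le> 2 * card \<E>" by simp
    moreover have "g * (card \<E> + 2) \<le> g * (card (faces \<E>) + card V)"
      using eu cls by (intro mult_left_mono) auto
    ultimately have "g * card \<E> + 2 * g \<le> 2 * card \<E> + g * card V" by (simp add: algebra_simps)
    then have "g * card \<E> - 2 * card \<E> < g * card V"
      using g Vpos mult_pos_pos[of g "card V"] by linarith
    then show ?thesis by (simp add: diff_mult_distrib)
  next
    case False
    have "faces \<E> \<subseteq> {- drawing V \<E>}"
      using acyclic_one_face[OF subset_refl False] connected_eq_components_subset_sing by blast
    then have "card (faces \<E>) \<le> 1"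
      using card_mono[of "{- drawing V \<E>}" "faces \<E>"] by simp
    then have "card \<E> < card V" using eu cls by linarith
    then have "g * card \<E> < g * card V" using g by simp
    moreover have "(g - 2) * card \<E> \<le> g * card \<E>" by (intro mult_right_mono) auto
    ultimately show ?thesis by linarith
  qed
qed

end

subsection \<open>List colorings and cycles of blocks\<close>

definition list_colorable :: "('a \<Rightarrow> 'a set) \<Rightarrow> 'a set \<Rightarrow> ('a \<Rightarrow> 'c set) \<Rightarrow> bool" where
  "list_colorable C S L \<longleftrightarrow>
     (\<exists>f. (\<forall>v\<in>S. f v \<in> L v) \<and> (\<forall>v\<in>S. \<forall>u\<in>S. u \<in> C v \<longrightarrow> f u \<noteq> f v))"

text \<open>Connectedness of the conflict graph on \<open>S\<close>, stated through a conflict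
  leaving every proper part, as the greedy argument consumes it.\<close>

definition linked :: "('a \<Rightarrow> 'a set) \<Rightarrow> 'a set \<Rightarrow> bool" where
  "linked C S \<longleftrightarrow> (\<forall>A\<subseteq>S. A \<noteq> {} \<longrightarrow> A \<noteq> S \<longrightarrow> (\<exists>a\<in>A. \<exists>b\<in>S - A. b \<in> C a))"

locale symmetric_conflict =
  fixes C :: "'a \<Rightarrow> 'a set"
  assumes conf_sym: "u \<in> C v \<Longrightarrow> v \<in> C u" and conf_irrefl: "v \<notin> C v"
begin

lemma list_colorable_insert:
  assumes "x \<notin> S" "a \<in> L x"
    and "list_colorable C S (\<lambda>v. L v - (if v \<in> C x then {a} else {}))"
  shows "list_colorable C (insert x S) L"
proof -
  obtain f where f: "\<forall>v\<in>S. f v \<in> L v - (if v \<in> C x then {a} else {})"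
    "\<forall>v\<in>S. \<forall>u\<in>S. u \<in> C v \<longrightarrow> f u \<noteq> f v"
    using assms(3) unfolding list_colorable_def by blast
  show ?thesis
    unfolding list_colorable_def
  proof (intro exI[of _ "f(x := a)"] conjI ballI impI)
    fix v assume "v \<in> insert x S"
    then show "(f(x := a)) v \<in> L v" using f assms(1,2) by (auto split: if_splits)
  next
    fix v u assume "v \<in> insert x S" "u \<in> insert x S" "u \<in> C v"
    then show "(f(x := a)) u \<noteq> (f(x := a)) v"
      using f assms(1) conf_sym[of u v] conf_irrefl by (auto split: if_splits)
  qed
qed

text \<open>The vertex found for \<open>A = S\<close> is colored last: its conflicts cannot exhaust
  its list.\<close>

lemma list_colorable_greedy:
  assumes "finite S" "\<And>v. v \<in> S \<Longrightarrow> finite (L v)"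
    and "\<And>A. A \<subseteq> S \<Longrightarrow> A \<noteq> {} \<Longrightarrow> \<exists>v\<in>A. card (C v \<inter> A) < card (L v)"
  shows "list_colorable C S L"
  using assms
proof (induction S rule: finite_psubset_induct)
  case (psubset S)
  show ?case
  proof (cases "S = {}")
    case True
    then show ?thesis by (simp add: list_colorable_def)
  next
    case False
    then obtain v where v: "v \<in> S" "card (C v \<inter> S) < card (L v)" using psubset.prems(2)[of S] by auto
    have "list_colorable C (S - {v}) L"
      by (rule psubset.IH) (use psubset.prems v in blast)+
    then obtain f where f: "\<forall>x\<in>S - {v}. f x \<in> L x"
      "\<forall>x\<in>S - {v}. \<forall>u\<in>S - {v}. u \<in> C x \<longrightarrow> f u \<noteq> f x"
      unfolding list_colorable_def by blast
    have "card (f ` (C v \<inter> S)) < card (L v)"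
      using v(2) card_image_le[of "C v \<inter> S" f] psubset.hyps by auto
    then have "\<not> L v \<subseteq> f ` (C v \<inter> S)"
      using card_mono[of "f ` (C v \<inter> S)" "L v"] psubset.hyps by fastforce
    then obtain a where a: "a \<in> L v" "a \<notin> f ` (C v \<inter> S)" by blast
    show ?thesis
      unfolding list_colorable_def
    proof (intro exI[of _ "f(v := a)"] conjI ballI impI)
      fix x assume "x \<in> S"
      then show "(f(v := a)) x \<in> L x" using f a by auto
    next
      fix x u assume "x \<in> S" "u \<in> S" "u \<in> C x"
      then show "(f(v := a)) u \<noteq> (f(v := a)) x"
        using f a conf_sym[of u x] conf_irrefl by auto
    qed
  qed
qed

text \<open>In a proper part, a vertex with a conflict leaving the part has a color to spare; only
  the whole of \<open>S\<close> needs the surplus at \<open>s\<close>.\<close>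

lemma list_colorable_linked:
  assumes "finite S" "linked C S" and L: "\<And>v. v \<in> S \<Longrightarrow> finite (L v) \<and> card (C v \<inter> S) \<le> card (L v)"
    and s: "s \<in> S" "card (C s \<inter> S) < card (L s)"
  shows "list_colorable C S L"
proof (rule list_colorable_greedy)
  fix A assume A: "A \<subseteq> S" "A \<noteq> {}"
  show "\<exists>v\<in>A. card (C v \<inter> A) < card (L v)"
  proof (cases "A = S")
    case True
    then show ?thesis using s by auto
  next
    case False
    then obtain a b where ab: "a \<in> A" "b \<in> S - A" "b \<in> C a"
      using A assms(2) unfolding linked_def by blast
    then have "C a \<inter> A \<subset> C a \<inter> S" using A by auto
    then have "card (C a \<inter> A) < card (C a \<inter> S)" using assms(1) by (simp add: psubset_card_mono)
    then show ?thesis using ab A L[of a] by force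
  qed
qed (use assms in auto)

text \<open>
  The degree-choosability argument: if all colorings failed, then deleting any color \<open>\<gamma>\<close> of the list
  of \<open>p\<close> would leave the same list at all vertices of \<open>S\<close>, although a vertex conflicting with \<open>p\<close>
  loses \<open>\<gamma>\<close> and another one does not.
\<close>

lemma list_colorable_ear:
  assumes fin: "finite S" and lk: "linked C S" and lk2: "\<And>v. v \<in> S \<Longrightarrow> linked C (S - {v})"
    and p: "p \<notin> S" and L: "\<And>v. v \<in> insert p S \<Longrightarrow> finite (L v) \<and> card (C v \<inter> insert p S) \<le> card (L v)"
    and m: "m \<in> S" "m \<in> C p" and m': "m' \<in> S" "m' \<in> C p" "m' \<noteq> m" and s: "s \<in> S" "s \<notin> C p"
  shows "list_colorable C (insert p S) L"
proof (rule ccontr)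
  assume nc: "\<not> list_colorable C (insert p S) L"
  define M where "M a v = L v - (if v \<in> C p then {a} else {})" for a v
  have fM: "finite (M a v)" if "v \<in> S" for a v using L that by (auto simp: M_def)
  have split: "C v \<inter> insert p S = (if v \<in> C p then insert p (C v \<inter> S) else C v \<inter> S)" for v
    using conf_sym by auto
  have degM: "card (C v \<inter> S) \<le> card (M a v)" if "v \<in> S" for a v
  proof (cases "v \<in> C p")
    case True
    then have "card (C v \<inter> S) + 1 \<le> card (L v)"
      using L[of v] that p fin by (simp add: split)
    then show ?thesis using True L[of v] that by (auto simp: M_def card_Diff_singleton_if)
  next
    case False
    then show ?thesis using L[of v] that by (simp add: M_def split)
  qed
  have bad: "\<not> list_colorable C S (M a)" if "a \<in> L p" for a
  proof -
    have "M a = (\<lambda>v. L v - (if v \<in> C p then {a} else {}))" by (simp add: M_def fun_eq_iff)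
    then show ?thesis using nc list_colorable_insert[of p S a L, OF p that] by auto
  qed
  have eqcard: "card (M a v) = card (C v \<inter> S)" if "a \<in> L p" "v \<in> S" for a v
    using bad[OF that(1)] list_colorable_linked[OF fin lk, of "M a" v] degM fM that
    by (metis le_neq_implies_less)
  \<comment> \<open>If \<open>v\<close> took a color absent from the list of its neighbor
    \<open>u\<close>, then \<open>u\<close> would gain a surplus in \<open>S - {v}\<close>, which is
    still connected, and the rest could be colored.\<close>
  have subM: "M a v \<subseteq> M a u" if a: "a \<in> L p" and v: "v \<in> S" and u: "u \<in> S" "u \<in> C v" for a u v
  proof (rule ccontr)
    assume "\<not> M a v \<subseteq> M a u"
    then obtain x where x: "x \<in> M a v" "x \<notin> M a u" by blast
    let ?N = "\<lambda>w. M a w - (if w \<in> C v then {x} else {})"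
    have "list_colorable C (S - {v}) ?N"
    proof (rule list_colorable_linked[where s = u])
      show "u \<in> S - {v}" using u conf_irrefl by auto
      have "C u \<inter> (S - {v}) \<subset> C u \<inter> S" using v u conf_sym by auto
      then have "card (C u \<inter> (S - {v})) < card (C u \<inter> S)" using fin by (simp add: psubset_card_mono)
      also have "\<dots> \<le> card (M a u)" using degM u by blast
      also have "M a u = ?N u" using x by auto
      finally show "card (C u \<inter> (S - {v})) < card (?N u)" .
      fix w assume w: "w \<in> S - {v}"
      show "finite (?N w) \<and> card (C w \<inter> (S - {v})) \<le> card (?N w)"
      proof (cases "w \<in> C v")
        case True
        then have "C w \<inter> (S - {v}) = (C w \<inter> S) - {v}" "v \<in> C w \<inter> S" using v conf_sym by auto
        then have "card (C w \<inter> (S - {v})) = card (C w \<inter> S) - 1" using fin by simp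
        then show ?thesis using degM[of w a] fM[of w a] w True by (auto simp: card_Diff_singleton_if)
      next
        case False
        then have "C w \<inter> (S - {v}) = C w \<inter> S" using conf_sym by auto
        then show ?thesis using degM[of w a] fM[of w a] w False by auto
      qed
    qed (use fin lk2 v in auto)
    then have "list_colorable C (insert v (S - {v})) (M a)"
      using list_colorable_insert[of v "S - {v}" x "M a"] x by auto
    then show False using bad[OF a] v by (simp add: insert_absorb)
  qed
  have same: "M a v = M a s" if a: "a \<in> L p" and v: "v \<in> S" for a v
  proof (rule ccontr)
    assume ne: "M a v \<noteq> M a s"
    let ?A = "{w\<in>S. M a w = M a s}"
    have "?A \<subseteq> S" "?A \<noteq> {}" "?A \<noteq> S" using s v ne by auto
    then obtain x y where xy: "x \<in> ?A" "y \<in> S - ?A" "y \<in> C x"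
      using lk unfolding linked_def by meson
    then have "M a x = M a y"
      using subM[OF a, of x y] subM[OF a, of y x] conf_sym by auto
    then show False using xy by auto
  qed
  have "{m, m'} \<subseteq> C p \<inter> insert p S" using m m' by auto
  then have "card {m, m'} \<le> card (L p)"
    using L[of p] fin by (meson card_mono finite.insertI finite_Int insertI1 le_trans)
  then have "\<not> card (L p) \<le> 1" using m' by auto
  then obtain a b where ab: "a \<in> L p" "b \<in> L p" "a \<noteq> b"
    using card_le_Suc0_iff_eq[of "L p"] L[of p] by auto
  have "L m - {a} = L s" "L m - {b} = L s"
    using same[OF ab(1) m(1)] same[OF ab(2) m(1)] m s by (simp_all add: M_def)
  \<comment> \<open>A color outside \<open>L m\<close> would not shorten that list when given to
    \<open>p\<close>, so \<open>M\<close> at \<open>m\<close> would exceed its exact size. Hence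
    \<open>a\<close> and \<open>b\<close> both lie in \<open>L m\<close>, and removing one or the
    other leaves different sets.\<close>
  moreover have "c \<in> L m" if "c \<in> L p" for c
  proof (rule ccontr)
    assume "c \<notin> L m"
    then have "card (L m) = card (C m \<inter> S)" using eqcard[OF that m(1)] m by (simp add: M_def)
    then show False using L[of m] m p fin by (simp add: split)
  qed
  ultimately show False using ab by blast
qed

end

text \<open>
  The cycle \<open>M\<close> appears as a minimal nonempty set of points with at least as many points as blocks.
\<close>

lemma attached_cycle:
  fixes \<beta> :: "'a \<Rightarrow> 'b set"
  assumes "finite P" "\<And>p. p \<in> P \<Longrightarrow> card (\<beta> p) = 2" "card (\<Union>(\<beta> ` P)) < card P"
  obtains M p where "M \<subseteq> P" "M \<noteq> {}" "p \<in> P - M" "\<beta> p \<inter> \<Union>(\<beta> ` M) \<noteq> {}"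
    "card (\<Union>(\<beta> ` M)) \<le> card M"
    "\<And>A. A \<subset> M \<Longrightarrow> A \<noteq> {} \<Longrightarrow> card A < card (\<Union>(\<beta> ` A))"
proof -
  have "\<exists>M p. M \<subseteq> P \<and> M \<noteq> {} \<and> p \<in> P - M \<and> \<beta> p \<inter> \<Union>(\<beta> ` M) \<noteq> {} \<and> card (\<Union>(\<beta> ` M)) \<le> card M
      \<and> (\<forall>A. A \<subset> M \<longrightarrow> A \<noteq> {} \<longrightarrow> card A < card (\<Union>(\<beta> ` A)))"
    using assms
  proof (induction P rule: finite_psubset_induct)
    case (psubset P)
    have fb: "finite (\<beta> p)" if "p \<in> P" for p
      using psubset.prems(1)[OF that] by (metis card.infinite zero_neq_numeral)
    define Q where "Q M \<longleftrightarrow> M \<subseteq> P \<and> M \<noteq> {} \<and> card (\<Union>(\<beta> ` M)) \<le> card M" for M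
    have "Q P" using psubset.prems by (auto simp: Q_def)
    then obtain M where "Q M" and least: "\<And>A. Q A \<Longrightarrow> card M \<le> card A"
      using ex_has_least_nat[of Q P card] by blast
    then have M: "M \<subseteq> P \<and> M \<noteq> {} \<and> card (\<Union>(\<beta> ` M)) \<le> card M" by (simp add: Q_def)
    have fM: "finite M" using M psubset.hyps finite_subset by blast
    have min: "card A < card (\<Union>(\<beta> ` A))" if "A \<subset> M" "A \<noteq> {}" for A
    proof (rule ccontr)
      assume "\<not> ?thesis"
      then have "Q A" using that M by (auto simp: Q_def)
      then have "card M \<le> card A" by (rule least)
      then show False using that(1) fM psubset_card_mono[of M A] by simp
    qed
    show ?case
    proof (cases "\<exists>p\<in>P - M. \<beta> p \<inter> \<Union>(\<beta> ` M) \<noteq> {}")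
      case True
      then obtain p where "p \<in> P - M" "\<beta> p \<inter> \<Union>(\<beta> ` M) \<noteq> {}" by blast
      then show ?thesis using M min by (intro exI[of _ M] exI[of _ p]) auto
    next
      case False
      let ?R = "P - M"
      \<comment> \<open>Now \<open>M\<close> shares no block with the rest and has exactly as many
        blocks as points, so the surplus of points survives in \<open>P - M\<close>.\<close>
      have disj: "\<Union>(\<beta> ` ?R) \<inter> \<Union>(\<beta> ` M) = {}" using False by blast
      have "\<beta> ` P = \<beta> ` ?R \<union> \<beta> ` M" using M by blast
      then have "card (\<Union>(\<beta> ` P)) = card (\<Union>(\<beta> ` ?R)) + card (\<Union>(\<beta> ` M))"
        using disj psubset.hyps fM fb M by (simp add: card_Un_disjoint subset_iff)
      moreover have "card (\<Union>(\<beta> ` M)) \<ge> card M"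
      proof (rule ccontr)
        assume lt: "\<not> ?thesis"
        obtain x where x: "x \<in> M" using M by auto
        show False
        proof (cases "M - {x} = {}")
          case True
          then have "M = {x}" using x by auto
          then show False using lt psubset.prems(1)[of x] M by auto
        next
          case False
          have "card (M - {x}) < card (\<Union>(\<beta> ` (M - {x})))" using min[OF _ False] x by auto
          also have "\<dots> \<le> card (\<Union>(\<beta> ` M))" using fM fb M by (intro card_mono) auto
          finally show False using lt x fM by (simp add: card_Diff_singleton)
        qed
      qed
      moreover have "card P = card ?R + card M"
        using M psubset.hyps fM by (metis card_Diff_subset card_mono le_add_diff_inverse2)
      moreover have "card (\<Union>(\<beta> ` M)) \<le> card M" using M by simp
      ultimately have "card (\<Union>(\<beta> ` ?R)) < card ?R" using psubset.prems by linarith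
      moreover have "?R \<subset> P" using M by blast
      ultimately obtain M' p where "M' \<subseteq> ?R" "M' \<noteq> {}" "p \<in> ?R - M'" "\<beta> p \<inter> \<Union>(\<beta> ` M') \<noteq> {}"
        "card (\<Union>(\<beta> ` M')) \<le> card M'" "\<forall>A. A \<subset> M' \<longrightarrow> A \<noteq> {} \<longrightarrow> card A < card (\<Union>(\<beta> ` A))"
        using psubset.IH[of ?R] psubset.prems(1) by auto
      then show ?thesis by blast
    qed
  qed
  then show ?thesis using that by auto
qed

text \<open>By minimality, removing a point of \<open>M\<close> loses no block, so every block
  carries at least two points; the 2 |M| incidences leave room for exactly two. The other claims say
  that \<open>M\<close> is connected, and remains so after losing a point.\<close>

lemma cycle_structure:
  fixes \<beta> :: "'a \<Rightarrow> 'b set"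
  assumes fin: "finite M" and ne: "M \<noteq> {}" and two: "\<And>p. p \<in> M \<Longrightarrow> card (\<beta> p) = 2"
    and le: "card (\<Union>(\<beta> ` M)) \<le> card M"
    and min: "\<And>A. A \<subset> M \<Longrightarrow> A \<noteq> {} \<Longrightarrow> card A < card (\<Union>(\<beta> ` A))"
  shows "w \<in> \<Union>(\<beta> ` M) \<Longrightarrow> card {v\<in>M. w \<in> \<beta> v} = 2"
    and "A \<subset> M \<Longrightarrow> A \<noteq> {} \<Longrightarrow> \<exists>a\<in>A. \<exists>b\<in>M - A. \<beta> a \<inter> \<beta> b \<noteq> {}"
    and "v \<in> M \<Longrightarrow> A \<subset> M - {v} \<Longrightarrow> A \<noteq> {} \<Longrightarrow> \<exists>a\<in>A. \<exists>b\<in>M - {v} - A. \<beta> a \<inter> \<beta> b \<noteq> {}"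
proof -
  have fb: "finite (\<beta> p)" if "p \<in> M" for p
    using two[OF that] by (metis card.infinite zero_neq_numeral)
  have fB: "finite (\<Union>(\<beta> ` A))" if "A \<subseteq> M" for A
    using that fin fb by (auto intro: finite_subset)
  have m2: "M - {v} \<noteq> {}" if "v \<in> M" for v
  proof
    assume "M - {v} = {}"
    then have "M = {v}" using that by auto
    then show False using le two[OF that] by auto
  qed
  have drop: "\<Union>(\<beta> ` (M - {v})) = \<Union>(\<beta> ` M)" "card (\<Union>(\<beta> ` M)) = card M" if v: "v \<in> M" for v
  proof -
    have "card (M - {v}) < card (\<Union>(\<beta> ` (M - {v})))" using min m2[OF v] v by blast
    then have "card M \<le> card (\<Union>(\<beta> ` (M - {v})))" using v fin by (simp add: card_Diff_singleton)
    then have ge: "card (\<Union>(\<beta> ` M)) \<le> card (\<Union>(\<beta> ` (M - {v})))" using le by linarith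
    have sub: "\<Union>(\<beta> ` (M - {v})) \<subseteq> \<Union>(\<beta> ` M)" by auto
    show eq: "\<Union>(\<beta> ` (M - {v})) = \<Union>(\<beta> ` M)"
      using card_seteq[OF fB[of M] sub ge] by simp
    show "card (\<Union>(\<beta> ` M)) = card M"
      using \<open>card M \<le> card (\<Union>(\<beta> ` (M - {v})))\<close> le eq by simp
  qed
  have all2: "card {v\<in>M. w \<in> \<beta> v} \<ge> 2" if w: "w \<in> \<Union>(\<beta> ` M)" for w
  proof -
    obtain v where v: "v \<in> M" "w \<in> \<beta> v" using w by auto
    then obtain v' where v': "v' \<in> M - {v}" "w \<in> \<beta> v'" using drop(1)[OF v(1)] w by blast
    then have "{v, v'} \<subseteq> {v\<in>M. w \<in> \<beta> v}" using v by auto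
    then have "card {v, v'} \<le> card {v\<in>M. w \<in> \<beta> v}" using fin by (intro card_mono) auto
    then show ?thesis using v' by auto
  qed
  have "(\<Sum>w\<in>\<Union>(\<beta> ` M). card {v\<in>M. w \<in> \<beta> v}) = (\<Sum>w\<in>\<Union>(\<beta> ` M). \<Sum>v\<in>M. if w \<in> \<beta> v then 1 else 0)"
    using fin by (intro sum.cong refl) (simp add: sum.If_cases Int_def)
  also have "\<dots> = (\<Sum>v\<in>M. \<Sum>w\<in>\<Union>(\<beta> ` M). if w \<in> \<beta> v then 1 else 0)" by (rule sum.swap)
  also have "\<dots> = (\<Sum>v\<in>M. 2)"
  proof (intro sum.cong refl)
    fix v assume "v \<in> M"
    then have "\<Union>(\<beta> ` M) \<inter> \<beta> v = \<beta> v" by auto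
    then show "(\<Sum>w\<in>\<Union>(\<beta> ` M). if w \<in> \<beta> v then 1 else 0) = (2::nat)"
      using two[OF \<open>v \<in> M\<close>] fB[of M] by (simp add: sum.If_cases)
  qed
  also have "\<dots> = 2 * card M" by simp
  finally have tot: "(\<Sum>w\<in>\<Union>(\<beta> ` M). card {v\<in>M. w \<in> \<beta> v}) = 2 * card M" .
  show "card {v\<in>M. w \<in> \<beta> v} = 2" if w: "w \<in> \<Union>(\<beta> ` M)" for w
  proof (rule ccontr)
    assume "card {v\<in>M. w \<in> \<beta> v} \<noteq> 2"
    then have "card {v\<in>M. w \<in> \<beta> v} > 2" using all2[OF w] by linarith
    then have "(\<Sum>w\<in>\<Union>(\<beta> ` M). 2) < (\<Sum>w\<in>\<Union>(\<beta> ` M). card {v\<in>M. w \<in> \<beta> v})"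
      using all2 w fB[of M] by (intro sum_strict_mono_ex1) auto
    then show False using tot drop(2) w by auto
  qed
  \<comment> \<open>Both parts have more blocks than points, so with disjoint blocks there would be
    at least \<open>card N + 2\<close> blocks, but there are at most \<open>card M\<close>.\<close>
  have sep: False
    if "A \<union> B = N" "A \<inter> B = {}" "A \<noteq> {}" "B \<noteq> {}" "N \<subseteq> M" "card M \<le> card N + 1"
      and no: "\<forall>a\<in>A. \<forall>b\<in>B. \<beta> a \<inter> \<beta> b = {}" for A B N
  proof -
    have AB: "A \<subset> M" "B \<subset> M" using that by auto
    have "\<Union>(\<beta> ` A) \<inter> \<Union>(\<beta> ` B) = {}" using no by blast
    then have "card (\<Union>(\<beta> ` A)) + card (\<Union>(\<beta> ` B)) = card (\<Union>(\<beta> ` A) \<union> \<Union>(\<beta> ` B))"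
      using fB AB by (intro card_Un_disjoint[symmetric]) auto
    also have "\<dots> \<le> card (\<Union>(\<beta> ` M))" using AB fB[of M] by (intro card_mono) auto
    also have "\<dots> \<le> card M" by (rule le)
    finally have "card (\<Union>(\<beta> ` A)) + card (\<Union>(\<beta> ` B)) \<le> card M" .
    moreover have "card A < card (\<Union>(\<beta> ` A))" "card B < card (\<Union>(\<beta> ` B))"
      using min AB that by auto
    moreover have "card N = card A + card B"
      using that AB fin by (metis card_Un_disjoint finite_subset psubset_imp_subset)
    ultimately show False using that by linarith
  qed
  show "\<exists>a\<in>A. \<exists>b\<in>M - A. \<beta> a \<inter> \<beta> b \<noteq> {}" if "A \<subset> M" "A \<noteq> {}" for A
  proof (rule ccontr)
    assume "\<not> ?thesis"
    moreover have "card M \<le> card M + 1" by simp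
    ultimately show False by (intro sep[of A "M - A" M]) (use that in blast)+
  qed
  show "\<exists>a\<in>A. \<exists>b\<in>M - {v} - A. \<beta> a \<inter> \<beta> b \<noteq> {}" if "v \<in> M" "A \<subset> M - {v}" "A \<noteq> {}" for v A
  proof -
    have c: "card M \<le> card (M - {v}) + 1" using fin that(1) by (simp add: card_Diff_singleton)
    show ?thesis
    proof (rule ccontr)
      assume "\<not> ?thesis"
      then show False by (intro sep[of A "M - {v} - A" "M - {v}"]) (use that c in blast)+
    qed
  qed
qed

subsection \<open>Edge-minimal graphs without an injective coloring\<close>

lemma card_colors_left:
  fixes c :: "'a \<Rightarrow> nat"
  assumes "finite X"
  shows "K \<le> card ({..<K} - c ` X) + card X"
proof -
  have "card {..<K} - card (c ` X) \<le> card ({..<K} - c ` X)"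
    using assms by (intro diff_card_le_card_Diff) simp
  moreover have "card (c ` X) \<le> card X" using assms by (rule card_image_le)
  ultimately show ?thesis by simp
qed

lemma card_2_other:
  assumes "card A = 2" "w \<in> A"
  obtains w' where "A = {w, w'}" "w' \<noteq> w"
proof -
  obtain x y where "A = {x, y}" "x \<noteq> y" using assms(1) by (auto simp: card_2_iff)
  then show ?thesis using assms(2) that[of x] that[of y] by (auto simp: insert_commute)
qed

definition nb :: "'a rel \<Rightarrow> 'a \<Rightarrow> 'a set" where
  "nb E v = E `` {v}"

definition conf :: "'a rel \<Rightarrow> 'a \<Rightarrow> 'a set" where
  "conf E v = (\<Union>w\<in>nb E v. nb E w) - {v}"

text \<open>All elements of the type are colored. Those without edges have no conflicts, so passing
  to fewer edges requires no bookkeeping of vertex sets.\<close>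

definition inj_colorable :: "'a rel \<Rightarrow> nat \<Rightarrow> bool" where
  "inj_colorable E K \<longleftrightarrow> (\<exists>c. (\<forall>v. c v < K) \<and> (\<forall>v. \<forall>u\<in>conf E v. c u \<noteq> c v))"

definition core :: "'a rel \<Rightarrow> nat \<Rightarrow> 'a set" where
  "core E K = \<Union>{S. S \<subseteq> Field E \<and> (\<forall>v\<in>S. K \<le> card (conf E v \<inter> S))}"

locale simple_graph =
  fixes E :: "'a rel"
  assumes finite_E: "finite E" and sym_E: "sym E" and irrefl_E: "irrefl E"
begin

lemma nb_sym: "u \<in> nb E v \<longleftrightarrow> v \<in> nb E u"
  using sym_E by (auto simp: nb_def sym_def)

lemma nb_irrefl: "v \<notin> nb E v"
  using irrefl_E by (auto simp: nb_def irrefl_def)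

lemma nb_neq: "u \<in> nb E v \<Longrightarrow> u \<noteq> v"
  using nb_irrefl by auto

lemma edge_nb: "(u, v) \<in> E \<longleftrightarrow> v \<in> nb E u"
  by (simp add: nb_def)

lemma finite_nb: "finite (nb E v)"
  unfolding nb_def using finite_E by (rule finite_Image)

lemma finite_conf: "finite (conf E v)"
  unfolding conf_def using finite_nb by auto

lemma nb_Field: "u \<in> nb E v \<Longrightarrow> u \<in> Field E" "u \<in> nb E v \<Longrightarrow> v \<in> Field E"
  by (auto simp: nb_def Field_def)

lemma Field_nb: "v \<in> Field E \<Longrightarrow> nb E v \<noteq> {}"
  using sym_E by (auto simp: nb_def Field_def sym_def)

lemma finite_Field: "finite (Field E)"
  using finite_E by (rule finite_Field)

lemma conf_iff: "u \<in> conf E v \<longleftrightarrow> u \<noteq> v \<and> (\<exists>w. w \<in> nb E v \<and> w \<in> nb E u)"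
  unfolding conf_def using nb_sym by auto

lemma conf_subset_Field: "conf E v \<subseteq> Field E"
  using nb_Field by (auto simp: conf_def)

sublocale symmetric_conflict "conf E"
  by unfold_locales (auto simp: conf_iff)

end

text \<open>An edge is deleted with both its arcs. The excluded cycles are those that would let the
  point \<open>s\<close> in \<open>points_le_blocks\<close> conflict with the attached point, or
  make the vertices in that argument coincide.\<close>

locale critical = simple_graph E for E :: "'a rel" +
  fixes K :: nat
  assumes K_pos: "K > 0"
    and not_colorable: "\<not> inj_colorable E K"
    and edge_minimal: "(u, v) \<in> E \<Longrightarrow> inj_colorable (E - {(u, v), (v, u)}) K"
    and no_C3: "b \<in> nb E a \<Longrightarrow> c \<in> nb E b \<Longrightarrow> a \<notin> nb E c"
    and no_C4: "a \<noteq> c \<Longrightarrow> b \<noteq> d \<Longrightarrow> b \<in> nb E a \<Longrightarrow> c \<in> nb E b \<Longrightarrow> d \<in> nb E c \<Longrightarrow> a \<notin> nb E d"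
    and no_C6: "distinct [a, b, c, d, e, f] \<Longrightarrow> b \<in> nb E a \<Longrightarrow> c \<in> nb E b \<Longrightarrow> d \<in> nb E c
      \<Longrightarrow> e \<in> nb E d \<Longrightarrow> f \<in> nb E e \<Longrightarrow> a \<notin> nb E f"
begin

abbreviation "N \<equiv> nb E"
abbreviation "F \<equiv> conf E"
abbreviation "Q \<equiv> core E K"

lemma core_Field: "Q \<subseteq> Field E"
  by (auto simp: core_def)

lemma finite_core: "finite Q"
  using core_Field finite_Field finite_subset by blast

lemma core_max: "S \<subseteq> Field E \<Longrightarrow> (\<And>v. v \<in> S \<Longrightarrow> K \<le> card (F v \<inter> S)) \<Longrightarrow> S \<subseteq> Q"
  by (auto simp: core_def)

lemma core_deg: "v \<in> Q \<Longrightarrow> K \<le> card (F v \<inter> Q)"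
proof -
  assume "v \<in> Q"
  then obtain S where S: "v \<in> S" "S \<subseteq> Field E" "\<forall>v\<in>S. K \<le> card (F v \<inter> S)"
    by (auto simp: core_def)
  then have "S \<subseteq> Q" by (intro core_max) auto
  then have "card (F v \<inter> S) \<le> card (F v \<inter> Q)" by (intro card_mono) (auto simp: finite_conf)
  then show ?thesis using S by force
qed

lemma not_core: "F v \<inter> Q \<subseteq> X \<Longrightarrow> finite X \<Longrightarrow> card X < K \<Longrightarrow> v \<notin> Q"
  using core_deg[of v] card_mono[of X "F v \<inter> Q"] by auto

text \<open>A proper coloring of the core would extend greedily: every nonempty \<open>A\<close>
  outside has a vertex with fewer than \<open>K\<close> conflicts in \<open>A \<union> Q\<close>,
  since otherwise \<open>A \<union> Q\<close> would belong to the core.\<close>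

lemma core_not_colorable:
  assumes "\<And>v. v \<in> Q \<Longrightarrow> c v < K" "\<And>u v. v \<in> Q \<Longrightarrow> u \<in> Q \<Longrightarrow> u \<in> F v \<Longrightarrow> c u \<noteq> c v"
  shows False
proof -
  define L where "L v = {..<K} - c ` (F v \<inter> Q)" for v
  have LK: "K \<le> card (L v) + card (F v \<inter> Q)" for v
    unfolding L_def by (rule card_colors_left) (simp add: finite_conf)
  have "list_colorable F (Field E - Q) L"
  proof (rule list_colorable_greedy)
    show "finite (Field E - Q)" using finite_Field by simp
    show "finite (L v)" for v by (simp add: L_def)
    fix A assume A: "A \<subseteq> Field E - Q" "A \<noteq> {}"
    have "\<not> A \<union> Q \<subseteq> Q" using A by auto
    then obtain v where v: "v \<in> A \<union> Q" "card (F v \<inter> (A \<union> Q)) < K"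
      using core_max[of "A \<union> Q"] A core_Field by (meson Diff_subset le_sup_iff not_le_imp_less order_trans)
    have un: "card (F v \<inter> (A \<union> Q)) = card (F v \<inter> A) + card (F v \<inter> Q)"
      using A finite_conf by (subst card_Un_disjoint[symmetric]) (auto simp: Int_Un_distrib)
    have "v \<in> A" using v un core_deg[of v] by auto
    moreover have "card (F v \<inter> A) < card (L v)" using LK[of v] v un by linarith
    ultimately show "\<exists>v\<in>A. card (F v \<inter> A) < card (L v)" by blast
  qed
  then obtain f where f: "\<forall>v\<in>Field E - Q. f v \<in> L v"
    "\<forall>v\<in>Field E - Q. \<forall>u\<in>Field E - Q. u \<in> F v \<longrightarrow> f u \<noteq> f v"
    unfolding list_colorable_def by blast
  define c' where "c' v = (if v \<in> Q then c v else if v \<in> Field E then f v else 0)" for v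
  have "c' v < K" for v using f assms K_pos by (auto simp: c'_def L_def)
  moreover have "c' u \<noteq> c' v" if u: "u \<in> F v" for u v
  proof -
    have "v \<in> F u" "u \<in> Field E" "v \<in> Field E" using u conf_sym conf_subset_Field by blast+
    moreover have "f x \<noteq> c y \<and> c y \<noteq> f x" if "x \<in> Field E - Q" "y \<in> F x \<inter> Q" for x y
      using f(1) that unfolding L_def by (metis DiffD2 imageI)
    ultimately show ?thesis using f(2) assms(2) u by (auto simp: c'_def)
  qed
  ultimately show False using not_colorable unfolding inj_colorable_def by blast
qed

text \<open>Deleting the edge only forgets conflicts that \<open>u\<close> has through
  \<open>v\<close> or \<open>v\<close> has through \<open>u\<close>. If these vertices are recolored
  or outside the core, the coloring of the smaller graph stays valid on \<open>Q - S\<close>, and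
  \<open>L\<close> lists the colors it leaves. The alternative \<open>N u = {v}\<close> is for a
  leaf: no conflict passes through \<open>u\<close>.\<close>

lemma reducible:
  assumes e: "(u, v) \<in> E" and S: "S \<subseteq> Q" and u: "u \<in> S \<or> u \<notin> Q" and v: "v \<in> S \<or> v \<notin> Q \<or> N u = {v}"
  obtains L :: "'a \<Rightarrow> nat set" where "\<And>x. finite (L x)" "\<And>x. K \<le> card (L x) + card (F x \<inter> (Q - S))"
    "\<not> list_colorable F S L"
proof -
  obtain c where c: "\<forall>x. c x < K" "\<forall>x. \<forall>y\<in>conf (E - {(u, v), (v, u)}) x. c y \<noteq> c x"
    using edge_minimal[OF e] unfolding inj_colorable_def by blast
  have key: "c y \<noteq> c x" if xy: "x \<in> Q - S" "y \<in> Q - S" "y \<in> F x" for x y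
  proof -
    obtain w where w: "(x, w) \<in> E" "(w, y) \<in> E" "y \<noteq> x"
      using xy(3) by (auto simp: conf_def nb_def)
    have "N u = {v} \<Longrightarrow> w = u \<Longrightarrow> x = y"
      using w nb_sym[of x u] by (auto simp: edge_nb)
    then have "(x, w) \<notin> {(u, v), (v, u)}" "(w, y) \<notin> {(u, v), (v, u)}"
      using u v xy w(3) by auto
    then have "y \<in> conf (E - {(u, v), (v, u)}) x" using w by (auto simp: conf_def nb_def)
    then show ?thesis using c(2) by blast
  qed
  define L where "L x = {..<K} - c ` (F x \<inter> (Q - S))" for x
  have "K \<le> card (L x) + card (F x \<inter> (Q - S))" for x
    unfolding L_def by (rule card_colors_left) (simp add: finite_conf)
  moreover have "\<not> list_colorable F S L"
  proof
    assume "list_colorable F S L"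
    then obtain f where f: "\<forall>v\<in>S. f v \<in> L v" "\<forall>v\<in>S. \<forall>u\<in>S. u \<in> F v \<longrightarrow> f u \<noteq> f v"
      unfolding list_colorable_def by blast
    show False
    proof (rule core_not_colorable[of "\<lambda>x. if x \<in> S then f x else c x"])
      show "(if x \<in> S then f x else c x) < K" for x using f c by (auto simp: L_def)
      fix x y assume xy: "x \<in> Q" "y \<in> Q" "y \<in> F x"
      then have "x \<in> F y" using conf_sym by blast
      moreover have "f x \<noteq> c y \<and> c y \<noteq> f x" if "x \<in> S" "y \<in> F x \<inter> (Q - S)" for x y
        using f(1) that unfolding L_def by (metis DiffD2 imageI)
      ultimately show "(if y \<in> S then f y else c y) \<noteq> (if x \<in> S then f x else c x)"
        using f(2) key xy by auto
    qed
  qed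
  ultimately show ?thesis using that[of L] by (simp add: L_def)
qed

lemma edge_meets_core: "u \<in> N v \<Longrightarrow> u \<in> Q \<or> v \<in> Q"
proof (rule ccontr)
  assume e: "u \<in> N v" and n: "\<not> (u \<in> Q \<or> v \<in> Q)"
  obtain L :: "'a \<Rightarrow> nat set" where "\<not> list_colorable F {} L"
    by (rule reducible[of v u "{}"]) (use e n in \<open>auto simp: edge_nb\<close>)
  then show False by (simp add: list_colorable_def)
qed

lemma conf_card_le:
  assumes "N v \<subseteq> W" "finite W"
  shows "card (F v \<inter> X) \<le> (\<Sum>w\<in>W. card (N w - {v}))"
proof -
  have "F v \<inter> X \<subseteq> (\<Union>w\<in>W. N w - {v})" using assms by (auto simp: conf_def)
  then have "card (F v \<inter> X) \<le> card (\<Union>w\<in>W. N w - {v})"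
    using assms finite_nb by (intro card_mono) auto
  also have "\<dots> \<le> (\<Sum>w\<in>W. card (N w - {v}))" by (rule card_UN_le[OF assms(2)])
  finally show ?thesis .
qed

text \<open>A leaf conflicts only with the other neighbors of \<open>v\<close>, fewer than
  \<open>K\<close>. So it is outside the core, and deleting its edge forgets no conflict between
  core vertices.\<close>

lemma no_leaf: "card (N v) \<le> K \<Longrightarrow> N u \<noteq> {v}"
proof
  assume K: "card (N v) \<le> K" and l: "N u = {v}"
  then have uv: "u \<in> N v" using nb_sym[of v u] by auto
  have "F u \<inter> Q \<subseteq> N v - {u}" using l by (auto simp: conf_def)
  moreover have "card (N v - {u}) < K"
    using uv K finite_nb[of v] card_gt_0_iff[of "N v"] by (auto simp: card_Diff_singleton)
  ultimately have nQ: "u \<notin> Q" using not_core finite_nb by blast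
  obtain L :: "'a \<Rightarrow> nat set" where "\<not> list_colorable F {} L"
    by (rule reducible[of u v "{}"]) (use uv l nQ in \<open>auto simp: edge_nb\<close>)
  then show False by (simp add: list_colorable_def)
qed

text \<open>\<open>free\<close> provides the edge to delete at the attached point, and
  \<open>tight\<close> makes every remaining list at least as long as the degree.
  \<open>full\<close> admits points with neighbors besides their two blocks: the block of attachment
  carries three points, so the attached point must have \<open>\<beta> p = N p\<close>, and all its
  conflicts are under control.\<close>

lemma points_le_blocks:
  assumes P: "P \<subseteq> Q" and \<beta>: "\<And>p. p \<in> P \<Longrightarrow> \<beta> p \<subseteq> N p" "\<And>p. p \<in> P \<Longrightarrow> card (\<beta> p) = 2"
    and tight: "\<And>p. p \<in> P \<Longrightarrow> card (F p \<inter> Q) \<le> K"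
    and free: "\<And>p. p \<in> P \<Longrightarrow> \<exists>x\<in>N p. x \<notin> Q"
    and full: "\<And>p w. p \<in> P \<Longrightarrow> \<beta> p \<noteq> N p \<Longrightarrow> w \<in> \<beta> p \<Longrightarrow> card {q\<in>P. w \<in> \<beta> q} \<le> 2"
  shows "card P \<le> card (\<Union>(\<beta> ` P))"
proof (rule ccontr)
  assume "\<not> ?thesis"
  then have lt: "card (\<Union>(\<beta> ` P)) < card P" by simp
  have finP: "finite P" using P finite_core finite_subset by blast
  obtain M p where M: "M \<subseteq> P" "M \<noteq> {}" and p: "p \<in> P - M" "\<beta> p \<inter> \<Union>(\<beta> ` M) \<noteq> {}"
    and le: "card (\<Union>(\<beta> ` M)) \<le> card M"
    and min: "\<And>A. A \<subset> M \<Longrightarrow> A \<noteq> {} \<Longrightarrow> card A < card (\<Union>(\<beta> ` A))"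
    using attached_cycle[OF finP \<beta>(2) lt] by metis
  have finM: "finite M" using M finP finite_subset by blast
  have two: "card (\<beta> q) = 2" if "q \<in> M" for q using \<beta>(2) that M by blast
  have cyc1: "card {v\<in>M. w \<in> \<beta> v} = 2" if "w \<in> \<Union>(\<beta> ` M)" for w
    by (rule cycle_structure(1)[of M \<beta> w]) (use finM M(2) two le min that in blast)+
  have cyc2: "\<exists>a\<in>A. \<exists>b\<in>M - A. \<beta> a \<inter> \<beta> b \<noteq> {}" if "A \<subset> M" "A \<noteq> {}" for A
    by (rule cycle_structure(2)[of M \<beta> A]) (use finM M(2) two le min that in blast)+
  have cyc3: "\<exists>a\<in>A. \<exists>b\<in>M - {v} - A. \<beta> a \<inter> \<beta> b \<noteq> {}" if "v \<in> M" "A \<subset> M - {v}" "A \<noteq> {}" for v A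
    by (rule cycle_structure(3)[of M \<beta> v A]) (use finM M(2) two le min that in blast)+
  have share: "b \<in> F a" if "a \<in> P" "b \<in> P" "a \<noteq> b" "\<beta> a \<inter> \<beta> b \<noteq> {}" for a b
  proof -
    obtain w where "w \<in> \<beta> a" "w \<in> \<beta> b" using \<open>\<beta> a \<inter> \<beta> b \<noteq> {}\<close> by blast
    then have "w \<in> N a" "w \<in> N b" using \<beta>(1) that by blast+
    then show ?thesis using that by (auto simp: conf_iff)
  qed
  have lk: "linked F M"
    unfolding linked_def
  proof (intro allI impI)
    fix A assume "A \<subseteq> M" "A \<noteq> {}" "A \<noteq> M"
    then obtain a b where "a \<in> A" "b \<in> M - A" "\<beta> a \<inter> \<beta> b \<noteq> {}" using cyc2[of A] by blast
    then show "\<exists>a\<in>A. \<exists>b\<in>M - A. b \<in> F a" using share[of a b] M \<open>A \<subseteq> M\<close> by blast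
  qed
  have lk2: "linked F (M - {v})" if v: "v \<in> M" for v
    unfolding linked_def
  proof (intro allI impI)
    fix A assume "A \<subseteq> M - {v}" "A \<noteq> {}" "A \<noteq> M - {v}"
    then obtain a b where "a \<in> A" "b \<in> M - {v} - A" "\<beta> a \<inter> \<beta> b \<noteq> {}" using cyc3[OF v, of A] by blast
    then show "\<exists>a\<in>A. \<exists>b\<in>M - {v} - A. b \<in> F a" using share[of a b] M \<open>A \<subseteq> M - {v}\<close> by blast
  qed
  obtain w where w: "w \<in> \<beta> p" "w \<in> \<Union>(\<beta> ` M)" using p by blast
  obtain m m' where m: "{v\<in>M. w \<in> \<beta> v} = {m, m'}" "m \<noteq> m'" using cyc1[OF w(2)] by (auto simp: card_2_iff)
  then have mM: "m \<in> M" "m' \<in> M" "w \<in> \<beta> m" "w \<in> \<beta> m'" by blast+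
  have mF: "m \<in> F p" "m' \<in> F p"
    using share[of p m] share[of p m'] p(1) mM M w(1) by blast+
  have "{p, m, m'} \<subseteq> {q\<in>P. w \<in> \<beta> q}" using p(1) M(1) mM w(1) by auto
  moreover have "p \<noteq> m" "p \<noteq> m'" using p(1) mM by auto
  then have "card {p, m, m'} = 3" using m(2) by simp
  ultimately have gt2: "card {q\<in>P. w \<in> \<beta> q} > 2" using finP card_mono[of "{q\<in>P. w \<in> \<beta> q}" "{p, m, m'}"] by simp
  have Np: "\<beta> p = N p"
  proof (rule ccontr)
    assume "\<beta> p \<noteq> N p"
    then have "card {q\<in>P. w \<in> \<beta> q} \<le> 2" using full[of p w] p(1) w(1) by blast
    then show False using gt2 by simp
  qed
  obtain w' where w': "N p = {w, w'}" "w' \<noteq> w"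
    using card_2_other[of "N p" w] \<beta>(2)[of p] p(1) w(1) unfolding Np by blast
  obtain w1 where w1: "w1 \<in> \<beta> m" "w1 \<noteq> w"
    using card_2_other[OF two[OF mM(1)] mM(3)] by blast
  have "w1 \<in> \<Union>(\<beta> ` M)" using w1 mM by blast
  then obtain s where s: "s \<in> M" "w1 \<in> \<beta> s" "s \<noteq> m"
    using card_2_other[OF cyc1[of w1], of m] w1 mM(1) by blast
  have nbs: "w \<in> N p" "w' \<in> N p" "w \<in> N m" "w1 \<in> N m" "w1 \<in> N s"
    using w' mM w1 s \<beta>(1) M by blast+
  have pm: "p \<noteq> m" "p \<noteq> s" using p mM s by auto
  \<comment> \<open>A conflict between \<open>s\<close> and \<open>p\<close> would run through
    \<open>w\<close> or \<open>w'\<close>, closing a cycle of length 4 or 6.\<close>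
  have sF: "s \<notin> F p"
  proof
    assume "s \<in> F p"
    then consider "w \<in> N s" | "w' \<in> N s" using w' by (auto simp: conf_iff)
    then show False
    proof cases
      case 1
      then show ?thesis using no_C4[of w w1 m s] nbs w1 s(3) nb_sym by metis
    next
      case 2
      show ?thesis
      proof (cases "w' = w1")
        case True
        then show ?thesis using no_C4[of w w' m p] nbs w' pm nb_sym by metis
      next
        case False
        have "w1 \<noteq> p" "w' \<noteq> m" "w \<noteq> s"
          using no_C3[of w m p] no_C3[of w p m] no_C3[of w m w1] nbs nb_sym by metis+
        then have "distinct [p, w, m, w1, s, w']"
          using pm w' w1 s False nbs 2 nb_neq by auto
        then show ?thesis using no_C6[of p w m w1 s w'] nbs 2 nb_sym by metis
      qed
    qed
  qed
  obtain x where x: "x \<in> N p" "x \<notin> Q" using free p by blast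
  obtain L :: "'a \<Rightarrow> nat set" where L: "\<And>x. finite (L x)"
      "\<And>x. K \<le> card (L x) + card (F x \<inter> (Q - insert p M))" "\<not> list_colorable F (insert p M) L"
    by (rule reducible[of p x "insert p M"]) (use x p M P in \<open>auto simp: edge_nb\<close>)
  have "finite (L v) \<and> card (F v \<inter> insert p M) \<le> card (L v)" if "v \<in> insert p M" for v
  proof -
    have vP: "v \<in> P" using that p M by auto
    have "F v \<inter> Q = (F v \<inter> (Q - insert p M)) \<union> (F v \<inter> insert p M)" using p M P by auto
    moreover have "card ((F v \<inter> (Q - insert p M)) \<union> (F v \<inter> insert p M)) =
        card (F v \<inter> (Q - insert p M)) + card (F v \<inter> insert p M)"
      using finite_conf by (intro card_Un_disjoint) auto
    ultimately have "card (F v \<inter> Q) = card (F v \<inter> (Q - insert p M)) + card (F v \<inter> insert p M)"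
      by simp
    then show ?thesis using tight[OF vP] L(1,2)[of v] by linarith
  qed
  then have "list_colorable F (insert p M) L"
    using list_colorable_ear[OF finM lk lk2 _ _ mM(1) mF(1) mM(2) mF(2) _ s(1) sF] p(1) m(2) by auto
  then show False using L(3) by blast
qed

end

subsection \<open>One extra color\<close>

context simple_graph
begin

abbreviation "dg v \<equiv> card (nb E v)"

lemma nb_sum_swap:
  fixes f :: "'a \<Rightarrow> 'a \<Rightarrow> 'b::comm_monoid_add"
  assumes "finite X" "finite Y"
  shows "(\<Sum>x\<in>X. \<Sum>y\<in>nb E x \<inter> Y. f x y) = (\<Sum>y\<in>Y. \<Sum>x\<in>nb E y \<inter> X. f x y)"
proof -
  have restrict: "(\<Sum>u\<in>nb E v \<inter> Z. g u) = (\<Sum>u\<in>Z. if u \<in> nb E v then g u else 0)"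
    if "finite Z" for g :: "'a \<Rightarrow> 'b" and v Z
    using sum.inter_restrict[OF that, of g "nb E v"] by (simp add: Int_commute)
  have "(\<Sum>x\<in>X. \<Sum>y\<in>nb E x \<inter> Y. f x y) = (\<Sum>y\<in>Y. \<Sum>x\<in>X. if y \<in> nb E x then f x y else 0)"
    unfolding restrict[OF assms(2)] by (rule sum.swap)
  also have "\<dots> = (\<Sum>y\<in>Y. \<Sum>x\<in>nb E y \<inter> X. f x y)"
    unfolding restrict[OF assms(1)] by (intro sum.cong refl) (simp add: nb_sym)
  finally show ?thesis .
qed

lemma double_count:
  assumes "finite X" "finite Y"
  shows "(\<Sum>x\<in>X. card (nb E x \<inter> Y)) = (\<Sum>y\<in>Y. card (nb E y \<inter> X))"
  using nb_sum_swap[OF assms, of "\<lambda>_ _. 1 :: nat"] by simp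

text \<open>This lets charge sent between neighbors enter the balance of each vertex without
  changing the total.\<close>

lemma transfer_balance:
  fixes t :: "'a \<Rightarrow> 'a \<Rightarrow> 'b::ab_group_add"
  assumes "finite X"
  shows "(\<Sum>v\<in>X. \<Sum>u\<in>nb E v \<inter> X. t u v - t v u) = 0"
  using nb_sum_swap[OF assms assms, of t] by (simp add: sum_subtractf)

lemma card_E: "card E = (\<Sum>v\<in>Field E. dg v)"
proof -
  have "E = (SIGMA v:Field E. nb E v)" by (auto simp: nb_def Field_def)
  then show ?thesis using card_SigmaI[of "Field E" "nb E"] finite_Field finite_nb by simp
qed

end

locale bounded_critical = critical +
  fixes D :: nat
  assumes deg_le: "dg v \<le> D" and D_le_K: "D \<le> K" and D_ge: "4 \<le> D"
begin

abbreviation "V \<equiv> Field E"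

lemma deg_ge_2: "v \<in> V \<Longrightarrow> 2 \<le> dg v"
proof (rule ccontr)
  assume v: "v \<in> V" and "\<not> 2 \<le> dg v"
  moreover have "dg v \<noteq> 0" using Field_nb[OF v] finite_nb[of v] by simp
  ultimately have "dg v = 1" by simp
  then obtain u where "N v = {u}" by (auto simp: card_1_singleton_iff)
  then show False using no_leaf[of u v] deg_le[of u] D_le_K by simp
qed

lemma nb_deg_ge_2: "u \<in> N v \<Longrightarrow> 2 \<le> dg u"
  using deg_ge_2 nb_Field by blast

lemma nb_2_other:
  assumes "dg a = 2" "u \<in> N a"
  obtains x where "N a = {u, x}" "x \<noteq> u" "a \<in> N u" "a \<in> N x"
proof -
  obtain x where x: "N a = {u, x}" "x \<noteq> u" using card_2_other[OF assms] .
  then have "a \<in> N u" "a \<in> N x" using nb_sym[of a u] nb_sym[of a x] by auto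
  then show ?thesis using x that by blast
qed

lemma conf_le_sum: "card (F v \<inter> X) \<le> (\<Sum>w\<in>N v. dg w - 1)"
proof -
  have "card (F v \<inter> X) \<le> (\<Sum>w\<in>N v. card (N w - {v}))"
    by (rule conf_card_le) (auto simp: finite_nb)
  also have "\<dots> = (\<Sum>w\<in>N v. dg w - 1)"
    using nb_sym finite_nb by (intro sum.cong refl) (simp add: card_Diff_singleton)
  finally show ?thesis .
qed

lemma conf_le_2: "N a = {u, x} \<Longrightarrow> u \<noteq> x \<Longrightarrow> card (F a \<inter> X) \<le> (dg u - 1) + (dg x - 1)"
  using conf_le_sum[of a X] by simp

lemma not_core_card: "card (F v \<inter> Q) < K \<Longrightarrow> v \<notin> Q"
  using core_deg[of v] by auto

lemma not_core_2: "N a = {u, x} \<Longrightarrow> u \<noteq> x \<Longrightarrow> (dg u - 1) + (dg x - 1) < K \<Longrightarrow> a \<notin> Q"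
  using conf_le_2[of a u x Q] not_core_card[of a] by simp

definition T :: "'a set" where "T = {v\<in>V. dg v = 2}"
definition B :: "'a set" where "B = {v\<in>V. 3 \<le> dg v}"

lemma finite_TB: "finite T" "finite B"
  using finite_Field by (auto simp: T_def B_def)

lemma VBT: "V = B \<union> T" "B \<inter> T = {}"
  using deg_ge_2 by (force simp: B_def T_def)+

lemma T_iff: "a \<in> T \<longleftrightarrow> dg a = 2"
proof
  assume d: "dg a = 2"
  then have "N a \<noteq> {}" by auto
  then show "a \<in> T" using d nb_Field by (auto simp: T_def)
qed (simp add: T_def)

lemma card_split:
  "card V = card B + card T" "int (card E) = (\<Sum>v\<in>B. int (dg v)) + 2 * int (card T)"
proof -
  show "card V = card B + card T"
    unfolding VBT(1) using finite_TB VBT(2) by (intro card_Un_disjoint) auto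
  have "card E = (\<Sum>v\<in>B. dg v) + (\<Sum>v\<in>T. dg v)"
    unfolding card_E VBT(1) using finite_TB VBT(2) by (intro sum.union_disjoint) auto
  also have "(\<Sum>v\<in>T. dg v) = 2 * card T" by (simp add: T_def)
  finally show "int (card E) = (\<Sum>v\<in>B. int (dg v)) + 2 * int (card T)" by simp
qed

end

section \<open>Discharging with K = D + 1\<close>

locale critical_succ = bounded_critical +
  assumes K_eq: "K = D + 1"
begin

definition nbs2 :: "'a \<Rightarrow> 'a set" where "nbs2 v = {u\<in>N v. dg u = 2}"
text \<open>After paying 2 to each 2-neighbor, a 3-vertex with charge 7 * 3 - 18 = 3 is left with -3
  in \<open>A3\<close> and -1 in \<open>A2\<close>. The condition on the third neighbor in
  \<open>A2\<close> keeps the conflicts at 1 + 1 + (D - 2) < K.\<close>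

definition A3 :: "'a set" where "A3 = {v\<in>V. dg v = 3 \<and> nbs2 v = N v}"
definition A2 :: "'a set" where
  "A2 = {v\<in>V. dg v = 3 \<and> card (nbs2 v) = 2 \<and> (\<exists>w\<in>N v. dg w \<noteq> 2 \<and> dg w < D)}"

lemma finite_nbs2: "finite (nbs2 v)" and nbs2_sub: "nbs2 v \<subseteq> N v" and card_nbs2: "card (nbs2 v) \<le> dg v"
  using finite_nb[of v] by (auto simp: nbs2_def intro: card_mono)

text \<open>Both ends would have at most 1 + (D - 1) < K conflicts, so the edge would avoid the
  core.\<close>

lemma two_not_adjacent: "dg a = 2 \<Longrightarrow> b \<in> N a \<Longrightarrow> dg b \<noteq> 2"
proof
  assume a: "dg a = 2" and b: "b \<in> N a" "dg b = 2"
  obtain x where "N a = {b, x}" "x \<noteq> b" "a \<in> N b" using nb_2_other[OF a b(1)] by blast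
  then have "a \<notin> Q" using not_core_2[of a b x] b deg_le[of x] D_ge K_eq by auto
  obtain y where "N b = {a, y}" "y \<noteq> a" using nb_2_other[OF b(2) \<open>a \<in> N b\<close>] by blast
  then have "b \<notin> Q" using not_core_2[of b a y] a deg_le[of y] D_ge K_eq by auto
  then show False using edge_meets_core[OF b(1)] \<open>a \<notin> Q\<close> by blast
qed

lemma third_nb:
  assumes "dg v = 3" "card (nbs2 v) = 2"
  obtains w where "N v = insert w (nbs2 v)" "w \<notin> nbs2 v" "dg w \<noteq> 2" "w \<in> N v"
proof -
  have "card (N v - nbs2 v) = 1" using assms nbs2_sub finite_nbs2 by (simp add: card_Diff_subset)
  then obtain w where "N v - nbs2 v = {w}" by (auto simp: card_1_singleton_iff)
  then show ?thesis using that[of w] nbs2_sub[of v] by (auto simp: nbs2_def)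
qed

lemma sum_nbs2: "(\<Sum>w\<in>nbs2 v. dg w - 1) = card (nbs2 v)"
  by (simp add: nbs2_def)

lemma A_not_core: "v \<in> A3 \<union> A2 \<Longrightarrow> v \<notin> Q"
proof -
  assume "v \<in> A3 \<union> A2"
  then consider "v \<in> A3" | "v \<in> A2" by blast
  then have "(\<Sum>w\<in>N v. dg w - 1) < K"
  proof cases
    case 1
    then have "(\<Sum>w\<in>N v. dg w - 1) = 3" using sum_nbs2[of v] by (simp add: A3_def)
    then show ?thesis using D_ge K_eq by simp
  next
    case 2
    then have v: "dg v = 3" "card (nbs2 v) = 2" by (auto simp: A2_def)
    obtain w where w: "N v = insert w (nbs2 v)" "w \<notin> nbs2 v" "dg w \<noteq> 2" "w \<in> N v" by (rule third_nb[OF v])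
    obtain w' where w': "w' \<in> N v" "dg w' \<noteq> 2" "dg w' < D" using 2 by (auto simp: A2_def)
    then have "w' \<notin> nbs2 v" by (simp add: nbs2_def)
    then have "dg w < D" using w w' by auto
    moreover have "(\<Sum>x\<in>N v. dg x - 1) = (dg w - 1) + 2"
      using sum_nbs2[of v] v finite_nbs2[of v] w(2) unfolding w(1) by simp
    ultimately show ?thesis using K_eq D_ge by simp
  qed
  then show "v \<notin> Q" using conf_le_sum[of v Q] not_core_card[of v] by simp
qed

text \<open>As \<open>v\<close> is outside the core, \<open>a\<close> is in it and needs D + 1
  conflicts. Only 2 come through \<open>v\<close>, so \<open>x\<close> must provide D - 1.\<close>

lemma point_nbs:
  assumes "dg a = 2" "v \<in> N a" "v \<in> A3 \<union> A2"
  obtains x where "N a = {v, x}" "x \<noteq> v" "dg x = D" "a \<in> Q" "card (F a \<inter> Q) \<le> K"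
proof -
  obtain x where x: "N a = {v, x}" "x \<noteq> v" using nb_2_other[OF assms(1,2)] by blast
  have v: "dg v = 3" using assms(3) by (auto simp: A3_def A2_def)
  have aQ: "a \<in> Q" using edge_meets_core[OF assms(2)] A_not_core[OF assms(3)] by blast
  have "card (F a \<inter> Q) \<le> 2 + (dg x - 1)" using conf_le_2[of a v x Q] x v by simp
  moreover have "K \<le> card (F a \<inter> Q)" by (rule core_deg[OF aQ])
  ultimately have "dg x = D" "card (F a \<inter> Q) \<le> K" using deg_le[of x] K_eq D_ge by linarith+
  then show ?thesis using that x aQ by blast
qed

text \<open>The points are the 2-neighbors of \<open>A3 \<union> A2\<close>; the blocks are these
  3-vertices and vertices of degree D. The bound reads 3 |A3| + 2 |A2| \<le> |A3| + |A2| +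
  |VD|.\<close>

lemma A_count: "2 * card A3 + card A2 \<le> card {v\<in>V. dg v = D}"
proof -
  define A where "A = A3 \<union> A2"
  define P where "P = {a\<in>V. dg a = 2 \<and> N a \<inter> A \<noteq> {}}"
  have fin: "finite A3" "finite A2" "finite A" "finite P" "finite {v\<in>V. dg v = D}"
    using finite_Field by (auto simp: A3_def A2_def A_def P_def)
  have disj: "A3 \<inter> A2 = {}"
    using card_nbs2 by (auto simp: A3_def A2_def)
  have PE: "\<exists>v x. v \<in> A \<and> N a = {v, x} \<and> x \<noteq> v \<and> dg x = D \<and> a \<in> Q \<and> card (F a \<inter> Q) \<le> K \<and> v \<notin> Q"
    if a: "a \<in> P" for a
  proof -
    obtain v where v: "v \<in> N a" "v \<in> A" using a by (auto simp: P_def)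
    have "dg a = 2" using a by (simp add: P_def)
    then show ?thesis
      by (rule point_nbs[of a v]) (use v A_not_core[of v] in \<open>auto simp: A_def\<close>)
  qed
  have "card P \<le> card (\<Union>(N ` P))"
  proof (rule points_le_blocks)
    show "P \<subseteq> Q" using PE by blast
    show "\<exists>x\<in>N p. x \<notin> Q" if "p \<in> P" for p using PE[OF that] by auto
    show "card (F p \<inter> Q) \<le> K" if "p \<in> P" for p using PE[OF that] by auto
  qed (auto simp: P_def)
  also have "\<dots> \<le> card (A \<union> {v\<in>V. dg v = D})"
  proof (rule card_mono)
    show "\<Union>(N ` P) \<subseteq> A \<union> {v\<in>V. dg v = D}"
    proof clarify
      fix a w assume a: "a \<in> P" "w \<in> N a" "w \<notin> A"
      then obtain v x where "v \<in> A" "N a = {v, x}" "dg x = D" using PE by blast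
      then show "w \<in> V \<and> dg w = D" using a nb_Field by auto
    qed
  qed (use fin in auto)
  also have "\<dots> \<le> card A3 + card A2 + card {v\<in>V. dg v = D}"
    using card_Un_le[of A "{v\<in>V. dg v = D}"] card_Un_le[of A3 A2] by (simp add: A_def)
  finally have up: "card P \<le> card A3 + card A2 + card {v\<in>V. dg v = D}" .
  have "card (N a \<inter> A) = 1" if a: "a \<in> P" for a
  proof -
    obtain v x where vx: "v \<in> A" "N a = {v, x}" "dg x = D" using PE[OF a] by blast
    then have "x \<notin> A" using D_ge by (auto simp: A_def A3_def A2_def)
    then have "N a \<inter> A = {v}" using vx by auto
    then show ?thesis by simp
  qed
  then have "card P = (\<Sum>a\<in>P. card (N a \<inter> A))" by simp
  also have "\<dots> = (\<Sum>v\<in>A. card (N v \<inter> P))" by (rule double_count) (use fin in auto)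
  also have "\<dots> = (\<Sum>v\<in>A. card (nbs2 v))"
  proof (intro sum.cong refl arg_cong[of _ _ card])
    fix v assume v: "v \<in> A"
    show "N v \<inter> P = nbs2 v"
      using v nb_sym nb_Field by (auto simp: P_def nbs2_def)
  qed
  also have "\<dots> = (\<Sum>v\<in>A3. card (nbs2 v)) + (\<Sum>v\<in>A2. card (nbs2 v))"
    unfolding A_def by (rule sum.union_disjoint) (use fin disj in auto)
  also have "\<dots> = 3 * card A3 + 2 * card A2"
    by (simp add: A3_def A2_def)
  finally show ?thesis using up by linarith
qed

text \<open>A 2-vertex has charge -4 and gets 2 from each neighbor. A vertex of degree D gives 1 to
  every neighbor in \<open>C\<close> and 2 to the pot; the pot gives 4 to each vertex of
  \<open>A3\<close> and 2 to each of \<open>A2\<close>, which is covered by twice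
  \<open>A_count\<close>.\<close>

lemma dense: "18 * card V \<le> 7 * card E"
proof -
  define VD where "VD = {v\<in>V. dg v = D}"
  define C where "C = {v\<in>V. dg v = 3 \<and> card (nbs2 v) = 2 \<and> v \<notin> A2}"
  define t :: "'a \<Rightarrow> 'a \<Rightarrow> int" where "t u v = (if u \<in> VD \<and> v \<in> C then 1 else 0)" for u v
  define \<psi> :: "'a \<Rightarrow> int" where
    "\<psi> v = 7 * int (dg v) - 18 - 2 * int (card (nbs2 v)) + (\<Sum>u\<in>N v \<inter> B. t u v - t v u)
      + (if v \<in> A3 then 4 else 0) + (if v \<in> A2 then 2 else 0) - (if v \<in> VD then 2 else 0)" for v
  have fin: "finite B" "finite T" "finite VD" using finite_Field finite_TB by (auto simp: VD_def)
  have subB: "A3 \<subseteq> B" "A2 \<subseteq> B" "VD \<subseteq> B" using D_ge by (auto simp: A3_def A2_def VD_def B_def)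
  have nonneg: "\<psi> v \<ge> 0" if v: "v \<in> B" for v
  proof -
    have d3: "3 \<le> dg v" and vV: "v \<in> V" using v by (auto simp: B_def)
    have in_nonneg: "(\<Sum>u\<in>N v \<inter> B. t u v) \<ge> 0" by (intro sum_nonneg) (simp add: t_def)
    have split: "(\<Sum>u\<in>N v \<inter> B. t u v - t v u) = (\<Sum>u\<in>N v \<inter> B. t u v) - (\<Sum>u\<in>N v \<inter> B. t v u)"
      by (rule sum_subtractf)
    show ?thesis
    proof (cases "v \<in> VD")
      \<comment> \<open>The extreme case is D = 4 with four 2-neighbors: 28 - 18 - 8 - 2 = 0. A
        neighbor in \<open>C\<close> costs 1 in place of 2.\<close>
      case True
      have "(\<Sum>u\<in>N v \<inter> B. t v u) \<le> int (card (N v - nbs2 v))"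
      proof -
        have "(\<Sum>u\<in>N v \<inter> B. t v u) \<le> (\<Sum>u\<in>N v \<inter> B. 1)" by (intro sum_mono) (simp add: t_def)
        also have "\<dots> = int (card (N v \<inter> B))" by simp
        also have "\<dots> \<le> int (card (N v - nbs2 v))"
          using finite_nb by (intro of_nat_mono card_mono) (auto simp: B_def nbs2_def)
        finally show ?thesis .
      qed
      also have "card (N v - nbs2 v) = dg v - card (nbs2 v)"
        using nbs2_sub finite_nbs2 by (simp add: card_Diff_subset)
      finally show ?thesis
        using True in_nonneg split card_nbs2[of v] D_ge by (auto simp: \<psi>_def VD_def)
    next
      case False
      then have "(\<Sum>u\<in>N v \<inter> B. t v u) = 0" by (simp add: t_def)
      then have *: "\<psi> v \<ge> 7 * int (dg v) - 18 - 2 * int (card (nbs2 v)) + (\<Sum>u\<in>N v \<inter> B. t u v)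
         + (if v \<in> A3 then 4 else 0) + (if v \<in> A2 then 2 else 0)"
        using False split by (simp add: \<psi>_def)
      consider "dg v \<ge> 4" | "dg v = 3" "card (nbs2 v) = 3" | "dg v = 3" "card (nbs2 v) = 2" "v \<in> A2"
        | "dg v = 3" "card (nbs2 v) = 2" "v \<notin> A2" | "dg v = 3" "card (nbs2 v) \<le> 1"
        using d3 card_nbs2[of v] by linarith
      then show ?thesis
      proof cases
        case 1
        then show ?thesis using * in_nonneg card_nbs2[of v] by (auto split: if_splits)
      next
        case 2
        then have "nbs2 v = N v" using nbs2_sub finite_nb by (intro card_subset_eq) auto
        then have "v \<in> A3" using 2 vV by (simp add: A3_def)
        then show ?thesis using * 2 in_nonneg by (auto split: if_splits)
      next
        case 3
        then show ?thesis using * in_nonneg by (auto split: if_splits)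
      next
        case 4
        obtain w where w: "N v = insert w (nbs2 v)" "w \<notin> nbs2 v" "dg w \<noteq> 2" "w \<in> N v"
          by (rule third_nb[OF 4(1,2)])
        have "\<not> dg w < D" using 4 w(3,4) vV by (auto simp: A2_def)
        then have "w \<in> VD" using deg_le[of w] w(4) nb_Field by (force simp: VD_def)
        moreover have "v \<in> C" using 4 vV by (simp add: C_def)
        ultimately have "t w v = 1" by (simp add: t_def)
        moreover have "t w v \<le> (\<Sum>u\<in>N v \<inter> B. t u v)"
          using w(4) \<open>w \<in> VD\<close> subB finite_nb by (intro member_le_sum) (auto simp: t_def)
        ultimately show ?thesis using * 4 by (auto split: if_splits)
      next
        case 5
        then show ?thesis using * in_nonneg by (auto split: if_splits)
      qed
    qed
  qed
  have "(\<Sum>v\<in>B. card (nbs2 v)) = (\<Sum>v\<in>B. card (N v \<inter> T))"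
    using nb_Field by (intro sum.cong refl arg_cong[of _ _ card]) (auto simp: nbs2_def T_def)
  also have "\<dots> = (\<Sum>a\<in>T. card (N a \<inter> B))" by (rule double_count) (use fin in auto)
  also have "\<dots> = (\<Sum>a\<in>T. 2)"
  proof (intro sum.cong refl)
    fix a assume a: "a \<in> T"
    then have "N a \<inter> B = N a"
      using two_not_adjacent[of a] nb_deg_ge_2[of _ a] nb_Field by (force simp: B_def T_def)
    then show "card (N a \<inter> B) = 2" using a by (simp add: T_def)
  qed
  finally have n2T: "(\<Sum>v\<in>B. card (nbs2 v)) = 2 * card T" by simp
  have i1: "(\<Sum>v\<in>B. if v \<in> S then c else 0) = c * int (card S)" if "S \<subseteq> B" for S and c :: int
    using fin that by (simp add: sum.If_cases Int_absorb1 Int_absorb2 Int_commute)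
  have "0 \<le> (\<Sum>v\<in>B. \<psi> v)" by (intro sum_nonneg nonneg)
  also have "\<dots> = 7 * (\<Sum>v\<in>B. int (dg v)) - 18 * int (card B) - 2 * (\<Sum>v\<in>B. int (card (nbs2 v)))
     + (\<Sum>v\<in>B. \<Sum>u\<in>N v \<inter> B. t u v - t v u) + 4 * int (card A3) + 2 * int (card A2) - 2 * int (card VD)"
    unfolding \<psi>_def by (simp add: sum.distrib sum_subtractf sum_distrib_left[symmetric] i1 subB del: sum.If_cases)
  also have "(\<Sum>v\<in>B. \<Sum>u\<in>N v \<inter> B. t u v - t v u) = 0" by (rule transfer_balance[OF fin(1)])
  also have "(\<Sum>v\<in>B. int (card (nbs2 v))) = 2 * int (card T)"
    using n2T by (metis of_nat_mult of_nat_numeral of_nat_sum)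
  finally have "18 * int (card B) + 4 * int (card T) \<le> 7 * (\<Sum>v\<in>B. int (dg v))"
    using A_count by (simp add: VD_def)
  then have "18 * int (card V) \<le> 7 * int (card E)" using card_split by simp
  then show ?thesis by linarith
qed

end

subsection \<open>Exactly as many colors as the maximum degree\<close>

locale critical_eq = bounded_critical +
  assumes K_eq: "K = D"
begin

definition mid :: "'a set" where "mid = {d\<in>T. \<forall>c\<in>N d. dg c = 2}"

definition thread :: "'a \<Rightarrow> 'a \<Rightarrow> 'a \<Rightarrow> 'a \<Rightarrow> bool" where
  "thread u a b w \<longleftrightarrow> dg a = 2 \<and> dg b = 2 \<and> N a = {u, b} \<and> N b = {a, w} \<and> 3 \<le> dg u \<and> 3 \<le> dg w"

lemma fin: "finite T" "finite B" "finite mid"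
  using finite_TB by (auto simp: mid_def)

lemma thread_sym: "thread u a b w \<Longrightarrow> thread w b a u"
  by (auto simp: thread_def insert_commute)

lemma thread_unique: "thread u a b w \<Longrightarrow> thread u a b' w' \<Longrightarrow> b' = b \<and> w' = w"
  by (auto simp: thread_def doubleton_eq_iff)

lemma thread_nb: "thread u a b w \<Longrightarrow> a \<in> N u \<and> b \<in> N a \<and> b \<in> N w"
  using nb_sym[of u a] nb_sym[of w b] by (auto simp: thread_def)

lemma thread_not_mid: "thread u a b w \<Longrightarrow> N a \<inter> mid = {} \<and> a \<notin> mid"
  by (auto simp: thread_def mid_def T_def)

lemma mid_not_core: "d \<in> mid \<Longrightarrow> d \<notin> Q"
proof -
  assume d: "d \<in> mid"
  then have "dg d = 2" by (simp add: mid_def T_def)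
  then obtain c e where ce: "N d = {c, e}" "c \<noteq> e" by (auto simp: card_2_iff)
  then have "dg c = 2" "dg e = 2" using d by (auto simp: mid_def)
  then show "d \<notin> Q" using not_core_2[OF ce] K_eq D_ge by simp
qed

text \<open>There are at most \<open>K\<close> conflicts altogether, and a core vertex has at least
  that many inside the core, so none lies outside.\<close>

lemma tight_2:
  assumes "N a = {u, x}" "u \<noteq> x" "a \<in> Q" "dg u + dg x \<le> K + 2" "2 \<le> dg u" "2 \<le> dg x"
  shows "F a \<subseteq> Q" "card (F a \<inter> Q) \<le> K"
proof -
  show "card (F a \<inter> Q) \<le> K" using conf_le_2[of a u x Q] assms by simp
  have "card (F a) \<le> K" using conf_le_2[of a u x UNIV] assms by simp
  also have "\<dots> \<le> card (F a \<inter> Q)" by (rule core_deg[OF assms(3)])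
  finally have "F a \<inter> Q = F a" using card_seteq[of "F a" "F a \<inter> Q"] finite_conf by blast
  then show "F a \<subseteq> Q" by blast
qed

text \<open>\<open>d\<close> has two conflicts and is outside the core, so \<open>c\<close> is
  inside. It needs K = D conflicts and has one through \<open>d\<close>; hence \<open>x\<close> has
  full degree. In particular no path of four 2-vertices exists.\<close>

lemma mid_nb:
  assumes "d \<in> mid" "c \<in> N d"
  obtains x where "N c = {d, x}" "x \<noteq> d" "dg x = D" "c \<in> Q" "dg c = 2" "c \<notin> mid" "x \<notin> mid"
    "card (F c \<inter> Q) \<le> K" "F c \<subseteq> Q"
proof -
  have dc: "dg c = 2" "dg d = 2" using assms by (auto simp: mid_def T_def)
  have "d \<in> N c" using assms(2) nb_sym by blast
  then obtain x where x: "N c = {d, x}" "x \<noteq> d" using nb_2_other[OF dc(1)] by blast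
  have cQ: "c \<in> Q" using edge_meets_core[OF assms(2)] mid_not_core[OF assms(1)] by blast
  have "card (F c \<inter> Q) \<le> 1 + (dg x - 1)" using conf_le_2[of c d x Q] x dc by simp
  then have dx: "dg x = D" using core_deg[OF cQ] deg_le[of x] K_eq D_ge by linarith
  have "F c \<subseteq> Q" "card (F c \<inter> Q) \<le> K"
    using tight_2[OF x(1) not_sym[OF x(2)] cQ] dx dc K_eq D_ge by auto
  moreover have "c \<notin> mid" "x \<notin> mid" using dx x D_ge by (auto simp: mid_def T_def)
  ultimately show ?thesis using that x cQ dc dx by blast
qed

lemma two_cases:
  assumes "a \<in> T"
  obtains (mid) "a \<in> mid" | (three) d x where "N a = {d, x}" "d \<in> mid" "x \<noteq> d" "dg x = D" "a \<notin> mid" "x \<notin> mid"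
    | (two) u b w where "thread u a b w" | (iso) "\<forall>u\<in>N a. 3 \<le> dg u" "a \<notin> mid"
proof (cases "a \<in> mid")
  case False
  have da: "dg a = 2" using assms by (simp add: T_iff)
  obtain u where u: "u \<in> N a" "dg u \<noteq> 2" using False assms by (auto simp: mid_def)
  then have u3: "3 \<le> dg u" using nb_deg_ge_2[of u a] by simp
  obtain b where b: "N a = {u, b}" "b \<noteq> u" "a \<in> N b" using nb_2_other[OF da u(1)] by blast
  show ?thesis
  proof (cases "dg b = 2")
    case True
    obtain w where w: "N b = {a, w}" "w \<noteq> a" "w \<in> N b" using nb_2_other[OF True b(3)] by blast
    show ?thesis
    proof (cases "dg w = 2")
      case dw: True
      have bm: "b \<in> mid" using True dw w da by (simp add: mid_def T_iff)
      obtain x where "N a = {b, x}" "x \<noteq> b" "dg x = D" "x \<notin> mid" using mid_nb[OF bm b(3)] by metis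
      then show ?thesis using three[of b x] bm False by blast
    next
      case False
      then have "3 \<le> dg w" using nb_deg_ge_2[of w b] w by simp
      then have "thread u a b w" using da True b w u3 by (simp add: thread_def)
      then show ?thesis by (rule two)
    qed
  next
    case nb2: False
    then have "3 \<le> dg b" using nb_deg_ge_2[of b a] b by simp
    then show ?thesis using iso b u3 False by simp
  qed
qed (rule mid)

text \<open>The conflicts of \<open>a\<close> are \<open>w\<close> and the at most D - 1 other
  neighbors of \<open>u\<close>. This just reaches K = D, so no loss is affordable.\<close>

lemma thread_end_not_core:
  assumes "thread u a b w" "w \<notin> Q \<or> dg u < D"
  shows "a \<notin> Q"
proof -
  have ab: "N a = {u, b}" "N b = {a, w}" "a \<in> N u" "u \<noteq> b" "a \<noteq> w" "dg b = 2"
    using assms(1) thread_nb[OF assms(1)] by (auto simp: thread_def)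
  show ?thesis
  proof (cases "w \<in> Q")
    case True
    then show ?thesis using not_core_2[of a u b] ab assms K_eq D_ge by simp
  next
    case False
    have "F a \<inter> Q \<subseteq> N u - {a}" using ab False by (auto simp: conf_def)
    moreover have "card (N u - {a}) < K"
      using ab(3) finite_nb[of u] deg_le[of u] K_eq D_ge by (simp add: card_Diff_singleton)
    ultimately show ?thesis using not_core[of a "N u - {a}"] finite_nb by simp
  qed
qed

text \<open>The edge between \<open>a\<close> and \<open>b\<close> meets the core. If
  \<open>a\<close> is in it then \<open>dg u = D\<close> and \<open>w \<in> Q\<close>; symmetrically
  for \<open>b\<close>.\<close>

lemma thread_ends:
  assumes "thread u a b w"
  shows "dg u = D \<or> dg w = D" "u \<in> Q \<or> w \<in> Q" "u \<notin> Q \<Longrightarrow> dg u = D"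
proof -
  have e: "a \<in> Q \<or> b \<in> Q" using edge_meets_core[of b a] thread_nb[OF assms] by blast
  note 1 = thread_end_not_core[OF assms] and 2 = thread_end_not_core[OF thread_sym[OF assms]]
  show "dg u = D \<or> dg w = D" using e 1 2 deg_le[of u] deg_le[of w] by linarith
  show "u \<in> Q \<or> w \<in> Q" using e 1 2 by blast
  show "u \<notin> Q \<Longrightarrow> dg u = D" using e 1 2 deg_le[of u] by linarith
qed

text \<open>
  A 2-vertex has charge \<open>11 * 2 - 26 = -4\<close>.  A path of three 2-vertices receives 3 from each of its
  end neighbors; the missing 6 are credited to its middle vertex.
\<close>

lemma thread_payment:
  fixes hp :: "'a \<Rightarrow> 'a \<Rightarrow> int"
  assumes iso: "\<And>a u. a \<in> T \<Longrightarrow> u \<in> N a \<Longrightarrow> \<forall>u\<in>N a. 3 \<le> dg u \<Longrightarrow> 2 \<le> hp u a"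
    and three: "\<And>d a u. d \<in> mid \<Longrightarrow> N a = {d, u} \<Longrightarrow> dg u = D \<Longrightarrow> 3 \<le> hp u a"
    and two: "\<And>u a b w. thread u a b w \<Longrightarrow> 8 \<le> hp u a + hp w b"
  shows "4 * int (card T) \<le> (\<Sum>u\<in>B. \<Sum>a\<in>N u \<inter> T. hp u a) + 6 * int (card mid)"
proof -
  define r where "r a = (\<Sum>u\<in>N a \<inter> B. hp u a)" for a
  \<comment> \<open>Balances are doubled so that the two 2-vertices of a thread can average: each
    hands its receipts to the other, which leaves \<open>r a + r b - 8\<close> at both. A middle
    vertex holds 12 - 8 = 4 and gives 2 to each end, where the balance is at least 2 * 3 - 8 =
    -2.\<close>
  define t where "t a b = (if a \<in> mid then 2 else if b \<in> mid then 0 else r a)" for a b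
  have nonneg: "0 \<le> 2 * r a - 8 + (if a \<in> mid then 12 else 0) + (\<Sum>b\<in>N a \<inter> T. t b a - t a b)"
    if a: "a \<in> T" for a
    using a
  proof (cases rule: two_cases)
    case mid
    have "N a \<inter> B = {}" using mid by (auto simp: mid_def B_def)
    then have r0: "r a = 0" by (simp add: r_def)
    have NT: "N a \<inter> T = N a" using mid by (auto simp: mid_def T_iff)
    have "(\<Sum>b\<in>N a. t b a - t a b) = (\<Sum>b\<in>N a. - 2)"
    proof (intro sum.cong refl)
      fix b assume "b \<in> N a"
      then have "b \<notin> mid" using mid_nb[OF mid] by metis
      then show "t b a - t a b = - 2" using mid by (simp add: t_def)
    qed
    also have "\<dots> = - 4" using a by (simp add: T_iff)
    finally show ?thesis using r0 NT mid by simp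
  next
    case (three d x)
    have "dg d = 2" using three by (simp add: mid_def T_iff)
    then have "N a \<inter> B = {x}" "N a \<inter> T = {d}"
      using three D_ge nb_Field[of x a] by (auto simp: T_iff B_def)
    then have "r a = hp x a" "(\<Sum>b\<in>N a \<inter> T. t b a - t a b) = 2"
      using three by (auto simp: r_def t_def)
    then show ?thesis using assms(2)[OF three(2,1,4)] by simp
  next
    case (two u b w)
    have "N a \<inter> B = {u}" "N a \<inter> T = {b}" "N b \<inter> B = {w}"
      using two nb_Field[of u a] nb_Field[of w b] by (auto simp: thread_def T_iff B_def)
    moreover have "a \<notin> mid" "b \<notin> mid" using thread_not_mid[OF two] thread_not_mid[OF thread_sym[OF two]] by auto
    ultimately show ?thesis using assms(3)[OF two] by (simp add: r_def t_def)
  next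
    case iso
    then have "N a \<inter> T = {}" "N a \<inter> B = N a" using nb_Field[of _ a] by (auto simp: T_iff B_def)
    moreover have "(\<Sum>u\<in>N a. hp u a) \<ge> (\<Sum>u\<in>N a. 2)" using assms(1) a iso by (intro sum_mono) auto
    ultimately show ?thesis using a iso(2) by (simp add: r_def T_iff)
  qed
  have "mid \<subseteq> T" by (auto simp: mid_def)
  then have m12: "(\<Sum>a\<in>T. if a \<in> mid then 12 else 0) = 12 * int (card mid)"
    using fin by (simp add: sum.If_cases Int_absorb1 Int_absorb2 Int_commute)
  have "0 \<le> (\<Sum>a\<in>T. 2 * r a - 8 + (if a \<in> mid then 12 else 0) + (\<Sum>b\<in>N a \<inter> T. t b a - t a b))"
    by (intro sum_nonneg nonneg)
  also have "\<dots> = 2 * (\<Sum>a\<in>T. r a) - 8 * int (card T) + 12 * int (card mid)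
      + (\<Sum>a\<in>T. \<Sum>b\<in>N a \<inter> T. t b a - t a b)"
    by (simp add: sum.distrib sum_subtractf sum_distrib_left[symmetric] m12)
  also have "(\<Sum>a\<in>T. \<Sum>b\<in>N a \<inter> T. t b a - t a b) = 0" by (rule transfer_balance[OF fin(1)])
  also have "(\<Sum>a\<in>T. r a) = (\<Sum>u\<in>B. \<Sum>a\<in>N u \<inter> T. hp u a)"
    unfolding r_def by (rule nb_sum_swap[symmetric]) (use fin in auto)
  finally show ?thesis by simp
qed

text \<open>Common bookkeeping for D = 4 and D \<ge> 5: \<open>hp\<close> pays the 2-vertices, while
  \<open>\<psi>\<close> is the net expense on everything else and must in total cover the 6 credited
  per middle vertex.\<close>

lemma dense_from_charge:
  fixes hp :: "'a \<Rightarrow> 'a \<Rightarrow> int" and \<psi> :: "'a \<Rightarrow> int"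
  assumes "4 * int (card T) \<le> (\<Sum>u\<in>B. \<Sum>a\<in>N u \<inter> T. hp u a) + 6 * int (card mid)"
    and "\<And>v. v \<in> B \<Longrightarrow> (\<Sum>a\<in>N v \<inter> T. hp v a) + \<psi> v \<le> 11 * int (dg v) - 26"
    and "6 * int (card mid) \<le> (\<Sum>v\<in>B. \<psi> v)"
  shows "26 * card V \<le> 11 * card E"
proof -
  have "(\<Sum>v\<in>B. (\<Sum>a\<in>N v \<inter> T. hp v a) + \<psi> v) \<le> (\<Sum>v\<in>B. 11 * int (dg v) - 26)"
    by (intro sum_mono assms(2))
  then have "4 * int (card T) \<le> 11 * (\<Sum>v\<in>B. int (dg v)) - 26 * int (card B)"
    using assms(1,3) by (simp add: sum.distrib sum_subtractf sum_distrib_left[symmetric])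
  then have "26 * int (card V) \<le> 11 * int (card E)" using card_split by simp
  then show ?thesis by linarith
qed

text \<open>With three 2-neighbors \<open>y\<close> would have at most 3 < K conflicts and lie
  outside the core; but an end of a thread outside the core has degree D.\<close>

lemma deg3_thread_nb:
  assumes "dg y = 3" "thread y b a w"
  shows "card (N y \<inter> T) \<le> 2"
proof (rule ccontr)
  assume "\<not> card (N y \<inter> T) \<le> 2"
  moreover have "card (N y \<inter> T) \<le> 3" using assms(1) card_mono[OF finite_nb[of y], of "N y \<inter> T"] by auto
  ultimately have "card (N y \<inter> T) = dg y" using assms(1) by simp
  then have "N y \<inter> T = N y" using finite_nb by (intro card_subset_eq) auto
  then have "dg u = 2" if "u \<in> N y" for u using that T_iff by blast
  then have "(\<Sum>u\<in>N y. dg u - 1) = (\<Sum>u\<in>N y. 1)" by (intro sum.cong refl) simp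
  then have "card (F y \<inter> Q) < K" using conf_le_sum[of y Q] assms(1) K_eq D_ge by simp
  then have "y \<notin> Q" by (rule not_core_card)
  then have "dg y = D" using thread_ends(3)[OF assms(2)] by blast
  then show False using assms(1) D_ge by simp
qed

section \<open>Paths of three 2-vertices, and maximum degree at least 5\<close>

definition end3 :: "'a set" where "end3 = {c. \<exists>d\<in>mid. c \<in> N d}"

lemma end3E:
  assumes "c \<in> end3"
  obtains d x where "d \<in> mid" "N c = {d, x}" "x \<noteq> d" "dg x = D" "c \<in> Q" "dg c = 2" "c \<notin> mid" "x \<notin> mid"
    "card (F c \<inter> Q) \<le> K" "F c \<subseteq> Q"
proof -
  obtain d where "d \<in> mid" "c \<in> N d" using assms by (auto simp: end3_def)
  then show ?thesis by (rule mid_nb) (rule that[OF \<open>d \<in> mid\<close>])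
qed

lemma end3_iff: "c \<in> end3 \<longleftrightarrow> N c \<inter> mid \<noteq> {}"
  using nb_sym by (auto simp: end3_def)

text \<open>The points are two ends per middle vertex; the blocks are the middle vertices and the
  far neighbors of the ends: 2 |mid| \<le> |mid| + |KN|.\<close>

lemma three_threads_le: "card mid \<le> card {v\<in>V. dg v = D \<and> N v \<inter> end3 \<noteq> {}}"
proof -
  let ?KN = "{v\<in>V. dg v = D \<and> N v \<inter> end3 \<noteq> {}}"
  have finite: "finite end3" "finite ?KN"
    using finite_Field fin finite_nb by (auto simp: end3_def)
  have "card end3 \<le> card (\<Union>(N ` end3))"
  proof (rule points_le_blocks)
    show "end3 \<subseteq> Q" by (auto elim: end3E)
    fix p assume p: "p \<in> end3"
    then show "card (N p) = 2" "card (F p \<inter> Q) \<le> K" by (auto elim: end3E)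
    show "\<exists>x\<in>N p. x \<notin> Q" using p by (rule end3E) (use mid_not_core in auto)
  qed auto
  also have "\<dots> \<le> card (mid \<union> ?KN)"
  proof (rule card_mono)
    show "\<Union>(N ` end3) \<subseteq> mid \<union> ?KN"
    proof clarify
      fix v c assume c: "c \<in> end3" "v \<in> N c" "v \<notin> mid"
      then have "dg v = D" by (auto elim: end3E)
      then show "v \<in> V \<and> dg v = D \<and> N v \<inter> end3 \<noteq> {}"
        using c nb_Field[of v c] nb_sym[of v c] by auto
    qed
  qed (use finite fin in auto)
  also have "\<dots> \<le> card mid + card ?KN" by (rule card_Un_le)
  finally have up: "card end3 \<le> card mid + card ?KN" .
  have "card (N c \<inter> mid) = 1" if "c \<in> end3" for c
    using that
  proof (rule end3E)
    fix d x assume "d \<in> mid" "N c = {d, x}" "x \<notin> mid"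
    then have "N c \<inter> mid = {d}" by auto
    then show ?thesis by simp
  qed
  then have "card end3 = (\<Sum>c\<in>end3. card (N c \<inter> mid))" by simp
  also have "\<dots> = (\<Sum>d\<in>mid. card (N d \<inter> end3))" by (rule double_count) (use finite fin in auto)
  also have "\<dots> = (\<Sum>d\<in>mid. 2)"
  proof (intro sum.cong refl)
    fix d assume d: "d \<in> mid"
    then have "N d \<inter> end3 = N d" by (auto simp: end3_def)
    then show "card (N d \<inter> end3) = 2" using d by (simp add: mid_def T_def)
  qed
  finally show ?thesis using up by simp
qed

text \<open>Vertices of \<open>KN\<close> pay 6 to the pot for middle vertices. The ends of a thread
  pay 4 + 4, or 5 + 3 with the 3 from an end of degree below D. For D = 5 a vertex of
  \<open>KN\<close> may be exhausted: 3 + 4 * 5 + 6 = 55 - 26. For D = 4 four payments of 5 would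
  already exceed 44 - 26 = 18.\<close>

lemma dense_5:
  assumes D5: "5 \<le> D"
  shows "26 * card V \<le> 11 * card E"
proof -
  define KN where "KN = {v\<in>V. dg v = D \<and> N v \<inter> end3 \<noteq> {}}"
  define hp :: "'a \<Rightarrow> 'a \<Rightarrow> int" where
    "hp u a = (if a \<in> end3 then 3 else if \<exists>b w. thread u a b w then
       (if dg u < D then 3 else if \<exists>b w. thread u a b w \<and> dg w = D then 4 else 5) else 2)" for u a
  have KNB: "KN \<subseteq> B" using D5 by (auto simp: KN_def B_def)
  show ?thesis
  proof (rule dense_from_charge[of hp "\<lambda>v. if v \<in> KN then 6 else 0"])
    show "4 * int (card T) \<le> (\<Sum>u\<in>B. \<Sum>a\<in>N u \<inter> T. hp u a) + 6 * int (card mid)"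
    proof (rule thread_payment)
      fix d a u assume "d \<in> mid" "N a = {d, u}"
      then show "3 \<le> hp u a" using end3_iff[of a] by (auto simp: hp_def)
    next
      fix u a b w assume t: "thread u a b w"
      have n: "a \<notin> end3" "b \<notin> end3"
        using thread_not_mid[OF t] thread_not_mid[OF thread_sym[OF t]] by (auto simp: end3_iff)
      have ex: "(\<exists>b w. thread u a b w \<and> dg w = D) \<longleftrightarrow> dg w = D"
        "(\<exists>b' w'. thread w b b' w' \<and> dg w' = D) \<longleftrightarrow> dg u = D"
        using t thread_unique[OF t] thread_unique[OF thread_sym[OF t]] thread_sym[OF t] by blast+
      show "8 \<le> hp u a + hp w b"
        using n ex t thread_sym[OF t] thread_ends(1)[OF t] deg_le[of u] deg_le[of w]
        unfolding hp_def by auto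
    qed (auto simp: hp_def)
  next
    fix v assume v: "v \<in> B"
    have hp5: "hp v a \<le> 5" for a by (simp add: hp_def)
    have bound: "(\<Sum>a\<in>N v \<inter> T. hp v a) \<le> c * int (dg v)" if "\<And>a. hp v a \<le> c" "c \<ge> 0" for c
    proof -
      have "(\<Sum>a\<in>N v \<inter> T. hp v a) \<le> of_nat (card (N v \<inter> T)) * c"
        by (intro sum_bounded_above that)
      also have "\<dots> \<le> of_nat (dg v) * c"
        using card_mono[OF finite_nb[of v], of "N v \<inter> T"] that by (intro mult_right_mono) auto
      finally show ?thesis by (simp add: mult.commute)
    qed
    consider "v \<in> KN" | "dg v = D" "v \<notin> KN" | "4 \<le> dg v" "dg v < D" | "dg v = 3"
      using v deg_le[of v] D5 by (force simp: B_def)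
    then show "(\<Sum>a\<in>N v \<inter> T. hp v a) + (if v \<in> KN then 6 else 0) \<le> 11 * int (dg v) - 26"
    proof cases
      case 1
      then obtain a where a: "a \<in> N v" "a \<in> end3" "dg v = D" by (auto simp: KN_def)
      then have aT: "a \<in> N v \<inter> T" by (auto simp: T_iff elim: end3E)
      have "(\<Sum>a\<in>N v \<inter> T. hp v a) = hp v a + (\<Sum>a\<in>N v \<inter> T - {a}. hp v a)"
        using aT finite_nb by (intro sum.remove) auto
      also have "\<dots> \<le> 3 + of_nat (card (N v \<inter> T - {a})) * 5"
        using a hp5 by (intro add_mono sum_bounded_above) (auto simp: hp_def)
      also have "card (N v \<inter> T - {a}) \<le> card (N v - {a})"
        using finite_nb by (intro card_mono) auto
      also have "card (N v - {a}) = D - 1" using a finite_nb by (simp add: card_Diff_singleton)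
      finally show ?thesis using 1 a D5 by auto
    next
      case 2
      then show ?thesis using bound[of 5] hp5 D5 by auto
    next
      case 3
      have "hp v a \<le> 3" for a using 3 by (simp add: hp_def)
      then have "(\<Sum>a\<in>N v \<inter> T. hp v a) \<le> 3 * int (dg v)" by (intro bound) auto
      then show ?thesis using 3 by (auto simp: KN_def)
    next
      case 4
      then have nK: "v \<notin> KN" using D5 by (auto simp: KN_def)
      have "(\<Sum>a\<in>N v \<inter> T. hp v a) \<le> 6"
      proof (cases "\<exists>a b w. thread v a b w")
        case True
        then have c: "card (N v \<inter> T) \<le> 2" using deg3_thread_nb 4 by blast
        have "(\<Sum>a\<in>N v \<inter> T. hp v a) \<le> of_nat (card (N v \<inter> T)) * 3"
          using 4 D5 by (intro sum_bounded_above) (auto simp: hp_def)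
        then show ?thesis using c by simp
      next
        case False
        have "hp v a = 2" if "a \<in> N v \<inter> T" for a
        proof -
          have "a \<notin> end3"
          proof
            assume "a \<in> end3"
            then obtain d x where "d \<in> mid" "N a = {d, x}" "dg x = D" by (rule end3E)
            moreover have "v \<in> N a" using that nb_sym[of a v] by auto
            ultimately show False using 4 D5 by (auto simp: mid_def T_def)
          qed
          then show ?thesis using False by (auto simp: hp_def)
        qed
        then have "(\<Sum>a\<in>N v \<inter> T. hp v a) \<le> of_nat (card (N v \<inter> T)) * 2"
          by (intro sum_bounded_above) auto
        moreover have "card (N v \<inter> T) \<le> 3" using card_mono[OF finite_nb[of v], of "N v \<inter> T"] 4 by simp
        ultimately show ?thesis by simp
      qed
      then show ?thesis using nK 4 by simp
    qed
  next
    have "(\<Sum>v\<in>B. if v \<in> KN then 6 else 0) = 6 * int (card KN)"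
      using fin KNB by (simp add: sum.If_cases Int_absorb1 Int_absorb2 Int_commute)
    then show "6 * int (card mid) \<le> (\<Sum>v\<in>B. if v \<in> KN then 6 else 0)"
      using three_threads_le by (simp add: KN_def)
  qed
qed

end

section \<open>Maximum degree 4\<close>

context critical_eq
begin

text \<open>
  In the case \<open>\<Delta> = 4\<close> the points are \<open>P2 \<union> Y3 \<union> Z\<close> and the blocks are \<open>W \<union> KN\<close>: a vertex of \<open>Y3\<close> joins
  its two \<open>long\<close> neighbors, and a vertex of \<open>Z\<close> two neighbors on threads to 4-vertices outside the
  core.
\<close>

definition long :: "'a \<Rightarrow> 'a set" where "long y = {b\<in>N y. \<exists>a w. thread y b a w}"
definition longfree :: "'a \<Rightarrow> 'a set" where "longfree z = {b\<in>N z. \<exists>a x. thread z b a x \<and> x \<notin> Q}"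
definition Y :: "'a set" where "Y = {y\<in>V. dg y = 3 \<and> card (long y) = 2}"
text \<open>A vertex of \<open>Y\<close> pays at least 5 on each of its two threads but has only 11
  * 3 - 26 = 7. A third neighbor of degree 4 can give the missing 3; one of degree 3 cannot, so the
  vertices of \<open>Y3\<close> draw on the pot.\<close>

definition Y3 :: "'a set" where "Y3 = {y\<in>Y. \<exists>w\<in>N y. dg w = 3}"
text \<open>Such a vertex owes 5 to each member of \<open>longfree z\<close> and could owe up to 20
  in all against its charge 18; it too draws on the pot.\<close>

definition Z :: "'a set" where
  "Z = {z\<in>V. dg z = D \<and> z \<in> Q \<and> (\<forall>a\<in>N z. dg a = 2) \<and> 3 \<le> card (longfree z)}"
text \<open>The choice in \<open>S\<close> is only meaningful for \<open>z \<in> Z\<close>.\<close>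

definition S :: "'a \<Rightarrow> 'a set" where
  "S z = (SOME A. A \<subseteq> longfree z \<and> card A = 2)"
definition W :: "'a set" where "W = mid \<union> \<Union>(long ` Y3) \<union> \<Union>(S ` Z)"
text \<open>This takes over the role of \<open>end3\<close>: the other neighbor again has degree D,
  so these are core vertices with exactly \<open>K\<close> conflicts.\<close>

definition P2 :: "'a set" where "P2 = {a. dg a = 2 \<and> N a \<inter> W \<noteq> {}}"
definition KN :: "'a set" where "KN = {v\<in>V. dg v = D \<and> N v \<inter> P2 \<noteq> {}}"

lemma finite_sets: "finite (long y)" "finite Y" "finite Y3" "finite Z" "finite KN" "finite (longfree z)"
  using finite_Field finite_nb by (auto simp: long_def longfree_def Y_def Y3_def Z_def KN_def)

lemma S_sub: "z \<in> Z \<Longrightarrow> S z \<subseteq> longfree z \<and> card (S z) = 2"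
proof -
  assume "z \<in> Z"
  then have "2 \<le> card (longfree z)" by (simp add: Z_def)
  then have "\<exists>A. A \<subseteq> longfree z \<and> card A = 2" using obtain_subset_with_card_n by metis
  then show ?thesis unfolding S_def by (rule someI_ex)
qed

lemma long_deg: "b \<in> long y \<Longrightarrow> dg b = 2 \<and> b \<in> N y \<and> b \<notin> mid"
  using thread_not_mid by (auto simp: long_def thread_def)

lemma longfree_long: "longfree z \<subseteq> long z"
  by (auto simp: longfree_def long_def)

lemma long_not_core: "b \<in> long y \<Longrightarrow> dg y < D \<Longrightarrow> b \<notin> Q"
  using thread_end_not_core by (auto simp: long_def)

lemma longfree_not_core: "b \<in> longfree z \<Longrightarrow> b \<notin> Q"
  using thread_end_not_core by (auto simp: longfree_def)

lemma third_nb_Y: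
  assumes "y \<in> Y"
  obtains w where "N y = insert w (long y)" "w \<notin> long y" "3 \<le> dg w" "w \<in> N y"
proof -
  have "card (N y - long y) = 1"
    using assms finite_sets by (subst card_Diff_subset) (auto simp: Y_def long_def)
  then obtain w where w: "N y - long y = {w}" by (auto simp: card_1_singleton_iff)
  then have Ny: "N y = insert w (long y)" "w \<notin> long y" "w \<in> N y" by (auto simp: long_def)
  have "long y \<noteq> {}" using assms by (auto simp: Y_def)
  then obtain b a x where "thread y b a x" by (auto simp: long_def)
  then have c: "card (N y \<inter> T) \<le> 2" using deg3_thread_nb assms by (auto simp: Y_def)
  have "dg w \<noteq> 2"
  proof
    assume "dg w = 2"
    then have "N y \<inter> T = N y" using Ny(1) long_deg by (auto simp: T_iff)
    then show False using c assms by (simp add: Y_def)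
  qed
  then show ?thesis using that[of w] Ny nb_deg_ge_2[OF Ny(3)] by simp
qed

lemma Y3_third:
  assumes "y \<in> Y3"
  obtains w where "N y = insert w (long y)" "w \<notin> long y" "dg w = 3"
proof -
  have "y \<in> Y" using assms by (simp add: Y3_def)
  then obtain w where w: "N y = insert w (long y)" "w \<notin> long y" "3 \<le> dg w" "w \<in> N y"
    by (rule third_nb_Y)
  obtain w' where "w' \<in> N y" "dg w' = 3" using assms by (auto simp: Y3_def)
  then have "w' = w" using w(1) long_deg[of w' y] by auto
  then show ?thesis using w that \<open>dg w' = 3\<close> by blast
qed

lemma W_cases:
  assumes "b \<in> W"
  obtains "b \<in> mid" | y where "y \<in> Y3" "b \<in> long y" | z where "z \<in> Z" "b \<in> S z" "b \<in> longfree z" "b \<in> long z"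
proof -
  from assms consider "b \<in> mid" | y where "y \<in> Y3" "b \<in> long y" | z where "z \<in> Z" "b \<in> S z"
    unfolding W_def by auto
  then show ?thesis
  proof cases
    case (3 z)
    then have "b \<in> longfree z" "b \<in> long z" using S_sub[OF 3(1)] longfree_long[of z] by auto
    then show ?thesis using 3 that(3) by simp
  qed (use that in auto)
qed

lemma W_props: "b \<in> W \<Longrightarrow> dg b = 2 \<and> b \<notin> Q"
proof (erule W_cases)
  assume "b \<in> mid" then show ?thesis using mid_not_core by (auto simp: mid_def T_def)
next
  fix y assume "y \<in> Y3" "b \<in> long y"
  then show ?thesis using long_deg long_not_core D_ge by (auto simp: Y3_def Y_def)
next
  fix z assume "b \<in> longfree z" "b \<in> long z"
  then show ?thesis using long_deg longfree_not_core by blast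
qed

lemma P2_cases:
  assumes a: "a \<in> P2" and D4: "D = 4"
  obtains (mid) d u where "N a = {d, u}" "d \<in> mid" "d \<in> W" "dg u = D"
  | (Y3) b y u where "thread u a b y" "y \<in> Y3" "b \<in> W" "dg u = D"
  | (Z) b z u where "thread u a b z" "z \<in> Z" "b \<in> W" "dg u = D" "u \<notin> Q"
proof -
  obtain b where b: "b \<in> W" "b \<in> N a" using a by (auto simp: P2_def)
  have aN: "a \<in> N b" using b nb_sym by blast
  have da: "dg a = 2" using a by (simp add: P2_def)
  show ?thesis
    using b(1)
  proof (cases rule: W_cases)
    case 1
    then show ?thesis using mid_nb[OF 1 aN] mid[of b] b by metis
  next
    case (2 y)
    then obtain a' u where t: "thread y b a' u" by (auto simp: long_def)
    have "dg y = 3" using 2 by (auto simp: Y3_def Y_def)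
    then have "a \<noteq> y" using da by auto
    then have "a = a'" using aN t by (auto simp: thread_def)
    moreover have "dg u = D" using thread_ends(1)[OF t] \<open>dg y = 3\<close> D4 by simp
    ultimately show ?thesis using Y3[of u b y] thread_sym[OF t] 2 b(1) by simp
  next
    case (3 z)
    then obtain a' u where t: "thread z b a' u" "u \<notin> Q" by (auto simp: longfree_def)
    have "dg z = D" using 3 by (simp add: Z_def)
    then have "dg z = 4" using D4 by simp
    then have "a \<noteq> z" using da by auto
    then have "a = a'" using aN t by (auto simp: thread_def)
    moreover have "dg u = D" using thread_ends(3)[OF thread_sym[OF t(1)] t(2)] .
    ultimately show ?thesis using Z[of u b z] thread_sym[OF t(1)] t 3 b(1) by simp
  qed
qed

lemma P2_props:
  assumes a: "a \<in> P2" and D4: "D = 4"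
  obtains b u where "N a = {b, u}" "b \<in> W" "b \<notin> Q" "dg b = 2" "dg u = D" "u \<in> KN" "a \<in> Q"
    "card (F a \<inter> Q) \<le> K" "F a \<subseteq> Q"
proof -
  have "\<exists>b u. N a = {b, u} \<and> b \<in> W \<and> dg u = D"
    using a D4
  proof (cases rule: P2_cases)
    case (mid d u)
    then show ?thesis by blast
  next
    case (Y3 b y u)
    then have "N a = {b, u}" by (simp add: thread_def insert_commute)
    then show ?thesis using Y3 by blast
  next
    case (Z b z u)
    then have "N a = {b, u}" by (simp add: thread_def insert_commute)
    then show ?thesis using Z by blast
  qed
  then obtain b u where bu: "N a = {b, u}" "b \<in> W" "dg u = D" by blast
  have b: "b \<notin> Q" "dg b = 2" using W_props[OF bu(2)] by auto
  then have "b \<noteq> u" using bu D4 by auto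
  have aQ: "a \<in> Q" using edge_meets_core[of b a] bu b by auto
  have "F a \<subseteq> Q" "card (F a \<inter> Q) \<le> K"
    using tight_2[OF bu(1) \<open>b \<noteq> u\<close> aQ] bu b K_eq D_ge by auto
  moreover have "u \<in> KN" using bu a nb_Field[of u a] nb_sym[of u a] by (auto simp: KN_def)
  ultimately show ?thesis using that bu b aQ by blast
qed

text \<open>With k = |Y3| + |Z|, each of these k points owns two blocks of its own, each with one
  further neighbor in \<open>P2\<close>. So there are 2 |mid| + 2k + k points and at most |mid| + 2k
  + |KN| blocks.\<close>

lemma weighted_count:
  assumes D4: "D = 4"
  shows "card mid + card Y3 + card Z \<le> card KN"
proof -
  define \<beta> where "\<beta> p = (if p \<in> Y3 then long p else if p \<in> Z then S p else N p)" for p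
  define YZ where "YZ = Y3 \<union> Z"
  have degY: "dg y = 3" if "y \<in> Y3" for y using that by (simp add: Y3_def Y_def)
  have degZ: "dg z = 4" if "z \<in> Z" for z using that D4 unfolding Z_def by simp
  have disj: "Y3 \<inter> Z = {}" "P2 \<inter> YZ = {}"
  proof -
    have "x \<notin> Z" if "x \<in> Y3" for x using degY[OF that] degZ[of x] by auto
    then show "Y3 \<inter> Z = {}" by auto
    have "x \<notin> YZ" if "x \<in> P2" for x
      using degY[of x] degZ[of x] that by (auto simp: P2_def YZ_def)
    then show "P2 \<inter> YZ = {}" by auto
  qed
  have \<beta>YZ: "\<beta> p \<subseteq> long p" "card (\<beta> p) = 2" "\<beta> p \<subseteq> W" if "p \<in> YZ" for p
    using that S_sub longfree_long disj(1) by (auto simp: \<beta>_def YZ_def Y3_def Y_def W_def)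
  have \<beta>P2: "\<beta> a = N a" if "a \<in> P2" for a using that disj(2) by (auto simp: \<beta>_def YZ_def)
  have finW: "finite W"
    using W_props T_iff fin(1) by (auto intro: finite_subset)
  have finP: "finite P2" using fin(1) T_iff by (auto simp: P2_def intro: finite_subset)
  have finYZ: "finite YZ" using finite_sets by (simp add: YZ_def)
  have "card (P2 \<union> YZ) \<le> card (\<Union>(\<beta> ` (P2 \<union> YZ)))"
  proof (rule points_le_blocks)
    fix p assume p: "p \<in> P2 \<union> YZ"
    show "\<beta> p \<subseteq> N p" using p \<beta>P2 \<beta>YZ(1) by (auto simp: long_def)
    have "p \<in> P2 \<Longrightarrow> dg p = 2" by (simp add: P2_def)
    then show "card (\<beta> p) = 2" using p \<beta>P2[of p] \<beta>YZ(2)[of p] by auto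
    consider "p \<in> P2" | "p \<in> Y3" | "p \<in> Z" using p by (auto simp: YZ_def)
    then show "card (F p \<inter> Q) \<le> K"
    proof cases
      case 1
      then show ?thesis using D4 by (rule P2_props)
    next
      case 2
      obtain w where w: "N p = insert w (long p)" "w \<notin> long p" "dg w = 3" by (rule Y3_third[OF 2])
      have "(\<Sum>x\<in>long p. dg x - 1) = (\<Sum>x\<in>long p. 1)" using long_deg by (intro sum.cong refl) auto
      also have "\<dots> = 2" using 2 by (simp add: Y3_def Y_def)
      finally have "(\<Sum>x\<in>N p. dg x - 1) = 4"
        unfolding w(1) using w(2,3) finite_sets(1) by simp
      then show ?thesis using conf_le_sum[of p Q] K_eq D4 by simp
    next
      case 3
      then have "(\<Sum>x\<in>N p. dg x - 1) = (\<Sum>x\<in>N p. 1)" by (intro sum.cong refl) (auto simp: Z_def)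
      then show ?thesis using conf_le_sum[of p Q] degZ[OF 3] K_eq D4 by simp
    qed
  next
    \<comment> \<open>The blocks of a point in \<open>YZ\<close> are 2-vertices and can carry no
      more than two points.\<close>
    fix p w assume p: "p \<in> P2 \<union> YZ" "\<beta> p \<noteq> N p" "w \<in> \<beta> p"
    then have "w \<in> W" using \<beta>P2 \<beta>YZ(3) by blast
    then have "dg w = 2" using W_props by blast
    moreover have "{q \<in> P2 \<union> YZ. w \<in> \<beta> q} \<subseteq> N w"
    proof clarify
      fix q assume "q \<in> P2 \<union> YZ" "w \<in> \<beta> q"
      then have "w \<in> N q" using \<beta>P2 \<beta>YZ(1) by (auto simp: long_def)
      then show "q \<in> N w" using nb_sym by blast
    qed
    ultimately show "card {q \<in> P2 \<union> YZ. w \<in> \<beta> q} \<le> 2" using card_mono[OF finite_nb[of w]] by metis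
  next
    fix p assume "p \<in> P2 \<union> YZ"
    then consider "p \<in> P2" | "p \<in> YZ" by blast
    then show "\<exists>x\<in>N p. x \<notin> Q"
    proof cases
      case 1
      then show ?thesis using D4 by (rule P2_props) auto
    next
      case 2
      have "\<beta> p \<noteq> {}" using \<beta>YZ(2)[OF 2] by auto
      then obtain b where b: "b \<in> \<beta> p" by blast
      then have "b \<in> N p" using \<beta>YZ(1)[OF 2] long_deg by blast
      moreover have "b \<notin> Q" using b \<beta>YZ(3)[OF 2] W_props by blast
      ultimately show ?thesis by blast
    qed
  next
    have "p \<in> Q" if "p \<in> P2" for p using that D4 by (rule P2_props)
    moreover have "p \<in> Q" if p: "p \<in> YZ" for p
    proof -
      have "\<beta> p \<noteq> {}" using \<beta>YZ(2)[OF p] by auto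
      then obtain b where b: "b \<in> \<beta> p" by blast
      then have "b \<in> N p" using \<beta>YZ(1)[OF p] long_deg by blast
      moreover have "b \<notin> Q" using b \<beta>YZ(3)[OF p] W_props by blast
      ultimately show ?thesis using edge_meets_core by blast
    qed
    ultimately show "P2 \<union> YZ \<subseteq> Q" by blast
  qed
  also have "\<dots> \<le> card (W \<union> KN)"
  proof (rule card_mono)
    have "\<beta> p \<subseteq> W \<union> KN" if "p \<in> P2" for p
      using that D4
    proof (rule P2_props)
      fix b u assume "N p = {b, u}" "b \<in> W" "u \<in> KN"
      then show ?thesis using \<beta>P2[OF that] by auto
    qed
    then show "\<Union>(\<beta> ` (P2 \<union> YZ)) \<subseteq> W \<union> KN" using \<beta>YZ(3) by blast
  qed (use finW finite_sets in auto)
  also have "\<dots> \<le> card W + card KN" by (rule card_Un_le)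
  finally have up: "card (P2 \<union> YZ) \<le> card W + card KN" .
  have cP: "card (P2 \<union> YZ) = card P2 + card YZ" using finP finYZ disj(2) by (rule card_Un_disjoint)
  have cYZ: "card YZ = card Y3 + card Z"
    unfolding YZ_def using finite_sets disj(1) by (intro card_Un_disjoint)
  define W' where "W' = \<Union>(\<beta> ` YZ)"
  have W': "W = mid \<union> W'" 
  proof -
    have "\<beta> ` Y3 = long ` Y3" by (simp add: \<beta>_def)
    moreover have "\<beta> ` Z = S ` Z" using disj(1) by (intro image_cong) (auto simp: \<beta>_def)
    ultimately show ?thesis unfolding W_def W'_def YZ_def image_Un by (simp add: Un_assoc)
  qed
  have "mid \<inter> W' = {}" 
  proof -
    have "b \<notin> mid" if "p \<in> YZ" "b \<in> \<beta> p" for p b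
      using \<beta>YZ(1)[OF that(1)] that(2) long_deg by blast
    then show ?thesis by (auto simp: W'_def)
  qed
  then have cW: "card W = card mid + card W'"
    unfolding W' using finW W' by (intro card_Un_disjoint) (auto intro: finite_subset)
  have uniq: "p = q" if "p \<in> YZ" "q \<in> YZ" "b \<in> \<beta> p" "b \<in> \<beta> q" for p q b
  proof -
    have "b \<in> long p" "b \<in> N q" using \<beta>YZ(1) that long_deg by blast+
    have "dg q \<noteq> 2" using that(2) degY[of q] degZ[of q] by (auto simp: YZ_def)
    obtain a w where t: "thread p b a w" using \<open>b \<in> long p\<close> by (auto simp: long_def)
    have "q \<in> N b" using \<open>b \<in> N q\<close> nb_sym by blast
    then show ?thesis using t \<open>dg q \<noteq> 2\<close> by (auto simp: thread_def)
  qed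
  have "card W' = (\<Sum>p\<in>YZ. card (\<beta> p))"
    unfolding W'_def
  proof (rule card_UN_disjoint[OF finYZ])
    show "\<forall>p\<in>YZ. finite (\<beta> p)" using \<beta>YZ(1) finite_sets(1) finite_subset by blast
    show "\<forall>p\<in>YZ. \<forall>q\<in>YZ. p \<noteq> q \<longrightarrow> \<beta> p \<inter> \<beta> q = {}" using uniq by blast
  qed
  then have cW': "card W' = 2 * card YZ" using \<beta>YZ(2) by simp
  have "card (N a \<inter> W) = 1" if "a \<in> P2" for a
    using that D4
  proof (rule P2_props)
    fix b u assume bu: "N a = {b, u}" "b \<in> W" "dg u = D"
    then have "u \<notin> W" using W_props[of u] D4 by auto
    then have "N a \<inter> W = {b}" using bu by auto
    then show ?thesis by simp
  qed
  then have "card P2 = (\<Sum>a\<in>P2. card (N a \<inter> W))" by simp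
  also have "\<dots> = (\<Sum>b\<in>W. card (N b \<inter> P2))" by (rule double_count[OF finP finW])
  also have "\<dots> = (\<Sum>b\<in>mid. card (N b \<inter> P2)) + (\<Sum>b\<in>W'. card (N b \<inter> P2))"
    unfolding W' using finW W' \<open>mid \<inter> W' = {}\<close> by (intro sum.union_disjoint) (auto intro: finite_subset)
  also have "(\<Sum>b\<in>mid. card (N b \<inter> P2)) = (\<Sum>b\<in>mid. 2)"
  proof (intro sum.cong refl)
    fix b assume b: "b \<in> mid"
    then have "N b \<inter> P2 = N b" using nb_sym by (auto simp: P2_def W_def mid_def)
    then show "card (N b \<inter> P2) = 2" using b by (simp add: mid_def T_def)
  qed
  also have "(\<Sum>b\<in>W'. card (N b \<inter> P2)) = (\<Sum>b\<in>W'. 1)"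
  proof (intro sum.cong refl)
    fix b assume "b \<in> W'"
    then obtain p where p: "p \<in> YZ" "b \<in> \<beta> p" by (auto simp: W'_def)
    then have "b \<in> long p" "b \<in> W" using \<beta>YZ by blast+
    then obtain a w where t: "thread p b a w" by (auto simp: long_def)
    have "p \<notin> P2" using p disj by blast
    moreover have "a \<in> P2" using t \<open>b \<in> W\<close> thread_nb[OF t] by (auto simp: P2_def thread_def)
    ultimately have "N b \<inter> P2 = {a}" using t by (auto simp: thread_def)
    then show "card (N b \<inter> P2) = 1" by simp
  qed
  finally have "card P2 = 2 * card mid + card W'" by simp
  then show ?thesis using up cP cYZ cW cW' by linarith
qed

text \<open>The charges are 7 at a 3-vertex and 18 at a 4-vertex. The pot takes 6 from each vertex
  of \<open>KN\<close> and gives 6 to each middle vertex and each vertex of \<open>Y3\<close> and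
  \<open>Z\<close>; \<open>x\<close> moves 3 from a 4-vertex to each neighbor in
  \<open>Y4\<close>.\<close>

lemma dense_4:
  assumes D4: "D = 4"
  shows "26 * card V \<le> 11 * card E"
proof -
  define Y4 where "Y4 = Y - Y3"
  define far where "far u a R \<longleftrightarrow> (\<exists>b w. thread u a b w \<and> R w)" for u a :: 'a and R :: "'a \<Rightarrow> bool"
  \<comment> \<open>A thread gets 8 as 6 + 2 if one end is in \<open>Y3\<close>, 5 + 3 if one end is
    another 3-vertex, 3 + 5 if one of two 4-vertices is outside the core (both cannot be), and 4 + 4
    otherwise.\<close>
  define hp :: "'a \<Rightarrow> 'a \<Rightarrow> int" where
    "hp u a = (if a \<in> end3 then 3 else if far u a (\<lambda>_. True) then
       (if dg u = 3 then (if u \<in> Y3 then 6 else 5)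
        else if far u a (\<lambda>w. w \<in> Y3) then 2
        else if far u a (\<lambda>w. dg w = 3) then 3
        else if u \<notin> Q then 3
        else if far u a (\<lambda>w. w \<notin> Q) then 5 else 4) else 2)" for u a
  define x :: "'a \<Rightarrow> 'a \<Rightarrow> int" where "x w y = (if dg w = 4 \<and> y \<in> Y4 then 3 else 0)" for w y
  define \<psi> :: "'a \<Rightarrow> int" where
    "\<psi> v = (if v \<in> KN then 6 else 0) - (if v \<in> Y3 then 6 else 0) - (if v \<in> Z then 6 else 0)
       - (\<Sum>u\<in>N v \<inter> B. x u v - x v u)" for v
  have far_iff: "far u a R \<longleftrightarrow> R w" if "thread u a b w" for u a b w R
  proof
    assume "far u a R"
    then obtain b' w' where "thread u a b' w'" "R w'" unfolding far_def by blast
    then show "R w" using thread_unique[OF that, of b' w'] by simp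
  qed (use that in \<open>auto simp: far_def\<close>)
  have sub: "KN \<subseteq> B" "Y3 \<subseteq> B" "Z \<subseteq> B" "Y4 \<subseteq> B"
    using D4 unfolding KN_def Y3_def Y_def Z_def B_def Y4_def by auto
  have deg: "dg v = 3 \<or> dg v = 4" if "v \<in> B" for v
    using that deg_le[of v] D4 by (auto simp: B_def)
  have degY: "dg y = 3" if "y \<in> Y" for y using that by (simp add: Y_def)
  have Y3Y: "Y3 \<subseteq> Y" by (auto simp: Y3_def)
  have long_end3: "a \<notin> end3" if "thread u a b w" for u a b w
    using thread_not_mid[OF that] by (simp add: end3_iff)
  show ?thesis
  proof (rule dense_from_charge[of hp \<psi>])
    show "4 * int (card T) \<le> (\<Sum>u\<in>B. \<Sum>a\<in>N u \<inter> T. hp u a) + 6 * int (card mid)"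
    proof (rule thread_payment)
      fix d a u assume "d \<in> mid" "N a = {d, u}"
      then show "3 \<le> hp u a" using end3_iff[of a] by (auto simp: hp_def)
    next
      fix u a b w assume t: "thread u a b w"
      note t' = thread_sym[OF t]
      have dd: "dg u = 4 \<and> (dg w = 3 \<or> dg w = 4) \<or> dg u = 3 \<and> dg w = 4"
        using thread_ends(1)[OF t] t deg_le[of u] deg_le[of w] D4 by (auto simp: thread_def)
      have y: "p \<in> Y3 \<Longrightarrow> dg p = 3" for p using degY Y3Y by blast
      show "8 \<le> hp u a + hp w b"
        using dd y[of u] y[of w] thread_ends(2)[OF t] long_end3[OF t] long_end3[OF t']
        unfolding hp_def far_iff[OF t] far_iff[OF t'] by auto
    qed (auto simp: hp_def)
  next
    have i1: "(\<Sum>v\<in>B. if v \<in> A then c else 0) = c * int (card A)" if "A \<subseteq> B" for A and c :: int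
      using fin that by (simp add: sum.If_cases Int_absorb1)
    have "(\<Sum>v\<in>B. \<psi> v) = 6 * int (card KN) - 6 * int (card Y3) - 6 * int (card Z)
        - (\<Sum>v\<in>B. \<Sum>u\<in>N v \<inter> B. x u v - x v u)"
      unfolding \<psi>_def by (simp only: sum_subtractf i1 sub)
    also have "(\<Sum>v\<in>B. \<Sum>u\<in>N v \<inter> B. x u v - x v u) = 0" by (rule transfer_balance[OF fin(2)])
    finally show "6 * int (card mid) \<le> (\<Sum>v\<in>B. \<psi> v)" using weighted_count[OF D4] by simp
  next
    fix v assume v: "v \<in> B"
    define inc where "inc = (\<Sum>u\<in>N v \<inter> B. x u v)"
    define out where "out = (\<Sum>u\<in>N v \<inter> B. x v u)"
    have inc0: "inc \<ge> 0" unfolding inc_def by (intro sum_nonneg) (simp add: x_def)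
    have \<psi>: "\<psi> v = (if v \<in> KN then 6 else 0) - (if v \<in> Y3 then 6 else 0) - (if v \<in> Z then 6 else 0) - inc + out"
      by (simp add: \<psi>_def inc_def out_def sum_subtractf)
    have fN: "finite (N v \<inter> T)" "finite (N v)" using finite_nb by auto
    show "(\<Sum>a\<in>N v \<inter> T. hp v a) + \<psi> v \<le> 11 * int (dg v) - 26"
    proof (cases "dg v = 3")
      case d3: True
      then have no: "v \<notin> KN" "v \<notin> Z" "out = 0" using D4 unfolding KN_def Z_def out_def x_def by auto
      have nend: "a \<notin> end3" if "a \<in> N v" for a
      proof
        assume "a \<in> end3"
        then obtain d u where "d \<in> mid" "N a = {d, u}" "dg u = D" by (rule end3E)
        moreover have "v \<in> N a" using that nb_sym[of a v] by auto
        ultimately show False using d3 D4 by (auto simp: mid_def T_def)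
      qed
      have far_long: "far v a (\<lambda>_. True) \<longleftrightarrow> a \<in> long v" if "a \<in> N v" for a
        using that by (auto simp: far_def long_def)
      have hp_long: "hp v a = (if v \<in> Y3 then 6 else 5)" if "a \<in> long v" for a
        using that nend[of a] far_long[of a] d3 by (auto simp: hp_def long_def)
      have hp_short: "hp v a = 2" if "a \<in> N v - long v" for a
        using that nend[of a] far_long[of a] by (auto simp: hp_def)
      have lT: "long v \<subseteq> N v \<inter> T" using long_deg by (auto simp: T_iff)
      have "(\<Sum>a\<in>N v \<inter> T. hp v a) = (\<Sum>a\<in>N v \<inter> T - long v. hp v a) + (\<Sum>a\<in>long v. hp v a)"
        using lT fN by (intro sum.subset_diff) auto
      also have "(\<Sum>a\<in>N v \<inter> T - long v. hp v a) = (\<Sum>a\<in>N v \<inter> T - long v. 2)"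
        using hp_short by (intro sum.cong refl) auto
      also have "\<dots> = 2 * int (card (N v \<inter> T - long v))" by simp
      also have "(\<Sum>a\<in>long v. hp v a) = (if v \<in> Y3 then 6 else 5) * int (card (long v))"
        using hp_long by simp
      finally have sum: "(\<Sum>a\<in>N v \<inter> T. hp v a) =
          2 * int (card (N v \<inter> T - long v)) + (if v \<in> Y3 then 6 else 5) * int (card (long v))" .
      have cd: "card (N v \<inter> T - long v) + card (long v) = card (N v \<inter> T)"
        using lT fN finite_sets(1) by (metis card_Diff_subset card_mono le_add_diff_inverse2)
      have c3: "card (N v \<inter> T) \<le> 3" using card_mono[OF fN(2), of "N v \<inter> T"] d3 by simp
      have c2: "card (N v \<inter> T) \<le> 2" if "card (long v) \<noteq> 0"
      proof -
        have "long v \<noteq> {}" using that by auto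
        then show ?thesis using deg3_thread_nb[OF d3] by (auto simp: long_def)
      qed
      consider "card (long v) = 0" | "card (long v) = 1" | "card (long v) = 2"
        using c2 cd by linarith
      then show ?thesis
      proof cases
        case 1
        then have "v \<notin> Y3" by (auto simp: Y3_def Y_def)
        then show ?thesis using 1 sum cd c3 \<psi> no inc0 d3 by auto
      next
        case 2
        then have "v \<notin> Y3" by (auto simp: Y3_def Y_def)
        then show ?thesis using 2 sum cd c2 \<psi> no inc0 d3 by auto
      next
        case 3
        then have vY: "v \<in> Y" using d3 v by (simp add: Y_def B_def)
        show ?thesis
        proof (cases "v \<in> Y3")
          case True
          then show ?thesis using 3 sum cd c2 \<psi> no inc0 d3 by auto
        next
          case False
          obtain w where w: "N v = insert w (long v)" "w \<notin> long v" "3 \<le> dg w" "w \<in> N v"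
            by (rule third_nb_Y[OF vY])
          have wB: "w \<in> B" using w(3,4) nb_Field by (auto simp: B_def)
          have "dg w \<noteq> 3" using False vY w(4) by (auto simp: Y3_def)
          then have "x w v = 3" using deg[OF wB] False vY by (simp add: x_def Y4_def)
          moreover have "x w v \<le> inc"
            unfolding inc_def using w(4) wB fN by (intro member_le_sum) (auto simp: x_def)
          ultimately show ?thesis using False 3 sum cd c2 \<psi> no d3 by auto
        qed
      qed
    next
      case False
      then have d4: "dg v = 4" using deg[OF v] by simp
      then have nY: "v \<notin> Y3" "v \<notin> Y" using degY Y3Y by auto
      define g where "g u = (if u \<in> T then hp v u else x v u)" for u
      have "(\<Sum>u\<in>N v. g u) = (\<Sum>u\<in>N v \<inter> T. g u) + (\<Sum>u\<in>N v \<inter> B. g u)"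
      proof -
        have "N v = (N v \<inter> T) \<union> (N v \<inter> B)" using VBT nb_Field[of _ v] by blast
        moreover have "(N v \<inter> T) \<inter> (N v \<inter> B) = {}" using VBT by blast
        ultimately show ?thesis using fN by (metis finite_Int sum.union_disjoint)
      qed
      also have "(\<Sum>u\<in>N v \<inter> T. g u) = (\<Sum>a\<in>N v \<inter> T. hp v a)" by (intro sum.cong refl) (simp add: g_def)
      also have "(\<Sum>u\<in>N v \<inter> B. g u) = out"
        unfolding out_def using VBT by (intro sum.cong refl) (auto simp: g_def)
      finally have sum: "(\<Sum>a\<in>N v \<inter> T. hp v a) + out = (\<Sum>u\<in>N v. g u)" by simp
      have notT: "g u \<le> 3" if "u \<notin> T" for u using that by (simp add: g_def x_def)
      have hp_thread: "hp v a = (if w \<in> Y3 then 2 else if dg w = 3 then 3 else if v \<notin> Q then 3 else if w \<notin> Q then 5 else 4)"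
        if t: "thread v a b w" for a b w
        unfolding hp_def far_iff[OF t] using long_end3[OF t] d4 by simp
      have hp_other: "hp v a = (if a \<in> end3 then 3 else 2)" if "a \<notin> long v" "a \<in> N v" for a
        using that by (auto simp: hp_def far_def long_def)
      have longE: "\<exists>b w. thread v a b w" if "a \<in> long v" for a using that by (auto simp: long_def)
      have bound: "(\<Sum>u\<in>N v. g u) \<le> 4 * c" if "\<And>u. u \<in> N v \<Longrightarrow> g u \<le> c" for c
      proof -
        have "(\<Sum>u\<in>N v. g u) \<le> of_nat (dg v) * c" using that by (intro sum_bounded_above) auto
        then show ?thesis using d4 by simp
      qed
      have bound1: "(\<Sum>u\<in>N v. g u) \<le> g a + 3 * c" if "a \<in> N v" "\<And>u. u \<in> N v \<Longrightarrow> g u \<le> c" for a c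
      proof -
        have "(\<Sum>u\<in>N v. g u) = g a + (\<Sum>u\<in>N v - {a}. g u)" using that fN by (intro sum.remove) auto
        also have "(\<Sum>u\<in>N v - {a}. g u) \<le> of_nat (card (N v - {a})) * c"
          using that by (intro sum_bounded_above) auto
        also have "card (N v - {a}) = 3" using that d4 fN by simp
        finally show ?thesis by simp
      qed
      have g5: "g u \<le> 5" if "u \<in> N v" for u
      proof (cases "u \<in> long v")
        case True
        then show ?thesis using longE[OF True] hp_thread notT[of u] by (auto simp: g_def)
      next
        case False
        then show ?thesis using hp_other[OF False that] notT[of u] by (auto simp: g_def)
      qed
      show ?thesis
      proof (cases "v \<in> Q")
        case vQ: False
        have "g u \<le> 3" if "u \<in> N v" for u
        proof (cases "u \<in> long v")
          case True
          then show ?thesis using longE[OF True] hp_thread notT[of u] vQ by (auto simp: g_def)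
        next
          case False
          then show ?thesis using hp_other[OF False that] notT[of u] by (auto simp: g_def)
        qed
        then have "(\<Sum>u\<in>N v. g u) \<le> 12" using bound[of 3] by simp
        moreover have "v \<notin> Z" using vQ by (simp add: Z_def)
        ultimately show ?thesis using sum \<psi> nY inc0 d4 by auto
      next
        case vQ: True
        show ?thesis
        proof (cases "v \<in> KN")
          case True
          then obtain a where a: "a \<in> N v" "a \<in> P2" by (auto simp: KN_def)
          obtain b u where bu: "N a = {b, u}" "b \<in> W" "b \<notin> Q" "dg b = 2" "a \<in> Q" "F a \<subseteq> Q"
            using a(2) D4 by (rule P2_props)
          have vNa: "v \<in> N a" using a(1) nb_sym by blast
          \<comment> \<open>Every other neighbor of \<open>v\<close> conflicts with
            \<open>a\<close>, whose conflicts all lie in the core. So no thread at \<open>v\<close>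
            ends outside the core, and the payment 5 does not occur.\<close>
          have NQ: "N v \<subseteq> Q"
          proof
            fix c assume c: "c \<in> N v"
            then have "c = a \<or> c \<in> F a" using vNa nb_sym[of c v] by (auto simp: conf_iff)
            then show "c \<in> Q" using bu by blast
          qed
          have Qw: "w \<in> Q" if "thread v c e w" for c e w
            using thread_end_not_core[OF that] thread_nb[OF that] NQ by blast
          have g4: "g c \<le> 4" if "c \<in> N v" for c
          proof (cases "c \<in> long v")
            case True
            then show ?thesis using longE[OF True] hp_thread Qw notT[of c] by (auto simp: g_def)
          next
            case False
            then show ?thesis using hp_other[OF False that] notT[of c] by (auto simp: g_def)
          qed
          \<comment> \<open>If every neighbor were paid, each one except \<open>a\<close> would
            contribute at most one core conflict to \<open>v\<close>, and \<open>a\<close> none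
            because \<open>b\<close> is outside the core: 3 conflicts, fewer than \<open>K\<close>.
            An unpaid neighbor lowers the bound to 3 * 4 = 12, leaving 6 for the pot.\<close>
          have "\<exists>c\<in>N v. g c = 0"
          proof (rule ccontr)
            assume nz: "\<not> (\<exists>c\<in>N v. g c = 0)"
            have one: "card ((N c - {v}) \<inter> Q) \<le> 1" if c: "c \<in> N v" for c
            proof (cases "c \<in> T")
              case True
              have "v \<in> N c" using c nb_sym by blast
              then have "card (N c - {v}) = 1" using True finite_nb[of c] by (simp add: T_iff)
              then show ?thesis using card_mono[of "N c - {v}" "(N c - {v}) \<inter> Q"] finite_nb[of c] by simp
            next
              case False
              have "g c \<noteq> 0" using nz c by blast
              then have "c \<in> Y4" using False by (simp add: g_def x_def split: if_splits)
              then have cY: "c \<in> Y" by (simp add: Y4_def)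
              obtain w where w: "N c = insert w (long c)" "w \<notin> long c" by (rule third_nb_Y[OF cY])
              have "v \<in> N c" using c nb_sym by blast
              moreover have "v \<notin> long c" using long_deg[of v c] d4 by auto
              ultimately have "N c - {v} = long c" using w by auto
              moreover have "long c \<inter> Q = {}" using long_not_core[of _ c] degY[OF cY] D4 by auto
              ultimately show ?thesis by simp
            qed
            have "N a = {b, v}" using bu(1,4) vNa d4 by auto
            then have "N a - {v} = {b}" using bu(4) d4 by auto
            then have zero: "(N a - {v}) \<inter> Q = {}" using bu(3) by auto
            have "F v \<inter> Q \<subseteq> (\<Union>c\<in>N v - {a}. (N c - {v}) \<inter> Q)"
              using zero by (auto simp: conf_def)
            then have "card (F v \<inter> Q) \<le> card (\<Union>c\<in>N v - {a}. (N c - {v}) \<inter> Q)"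
              using finite_nb by (intro card_mono) auto
            also have "\<dots> \<le> (\<Sum>c\<in>N v - {a}. card ((N c - {v}) \<inter> Q))"
              using fN by (intro card_UN_le) auto
            also have "\<dots> \<le> (\<Sum>c\<in>N v - {a}. 1)" using one by (intro sum_mono) auto
            also have "\<dots> = 3" using a(1) d4 fN by simp
            finally have "card (F v \<inter> Q) \<le> 3" .
            then show False using core_deg[OF vQ] K_eq D4 by simp
          qed
          then obtain c where "c \<in> N v" "g c = 0" by blast
          then have "(\<Sum>u\<in>N v. g u) \<le> 12" using bound1[of c 4] g4 by simp
          then show ?thesis using sum \<psi> nY inc0 d4 by auto
        next
          case nK: False
          show ?thesis
          proof (cases "v \<in> Z")
            case True
            have "(\<Sum>u\<in>N v. g u) \<le> 20" using bound[of 5] g5 by simp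
            then show ?thesis using sum \<psi> nY inc0 d4 True nK by auto
          next
            case nZ: False
            have "(\<Sum>u\<in>N v. g u) \<le> 18"
            proof (cases "3 \<le> card (longfree v)")
              case True
              \<comment> \<open>Only a neighbor of degree other than 2 can keep \<open>v\<close> out
                of \<open>Z\<close>; it costs at most 3, and 3 + 3 * 5 = 18.\<close>
              then obtain c where c: "c \<in> N v" "dg c \<noteq> 2" using nZ vQ d4 D4 v unfolding Z_def B_def by auto
              then have "g c \<le> 3" using notT[of c] by (simp add: T_iff)
              then show ?thesis using bound1[OF c(1), of 5] g5 by simp
            next
              case few: False
              \<comment> \<open>Only threads ending outside the core cost 5, and \<open>v\<close>
                has at most two of them: 4 * 4 + 2 = 18.\<close>
              have "g u \<le> 4 + (if u \<in> longfree v then 1 else 0)" if u: "u \<in> N v" for u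
              proof (cases "u \<in> long v")
                case True
                then obtain e w where t: "thread v u e w" using longE by blast
                then have "w \<notin> Q \<Longrightarrow> u \<in> longfree v" using u by (auto simp: longfree_def)
                then show ?thesis using hp_thread[OF t] notT[of u] by (auto simp: g_def)
              next
                case False
                then show ?thesis using hp_other[OF False u] notT[of u] by (auto simp: g_def)
              qed
              then have "(\<Sum>u\<in>N v. g u) \<le> (\<Sum>u\<in>N v. 4 + (if u \<in> longfree v then 1 else 0))"
                by (intro sum_mono)
              also have "\<dots> = 16 + (\<Sum>u\<in>N v. if u \<in> longfree v then 1 else 0)"
                using d4 by (simp add: sum.distrib)
              also have "(\<Sum>u\<in>N v. if u \<in> longfree v then 1 else 0) = int (card (N v \<inter> longfree v))"
                using fN by (simp add: sum.If_cases)
              also have "N v \<inter> longfree v = longfree v" by (auto simp: longfree_def)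
              finally show ?thesis using few by simp
            qed
            then show ?thesis using sum \<psi> nY inc0 d4 nZ nK by auto
          qed
        qed
      qed
    qed
  qed
qed

lemma dense: "26 * card V \<le> 11 * card E"
  using dense_4 dense_5 D_ge by (cases "D = 4") auto

end

subsection \<open>Planar graphs\<close>

lemma rtrancl_distinct_path:
  assumes "(u, v) \<in> R\<^sup>*"
  obtains xs where "xs \<noteq> []" "hd xs = u" "last xs = v" "distinct xs" "successively (\<lambda>a b. (a, b) \<in> R) xs"
proof -
  have "\<exists>xs. xs \<noteq> [] \<and> hd xs = u \<and> last xs = v \<and> distinct xs \<and> successively (\<lambda>a b. (a, b) \<in> R) xs"
    using assms
  proof (induction rule: converse_rtrancl_induct)
    case base
    show ?case by (intro exI[of _ "[v]"]) simp
  next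
    case (step x y)
    then obtain xs where xs: "xs \<noteq> []" "hd xs = y" "last xs = v" "distinct xs"
      "successively (\<lambda>a b. (a, b) \<in> R) xs" by blast
    show ?case
    proof (cases "x \<in> set xs")
      case True
      then obtain ys zs where "xs = ys @ x # zs" by (auto simp: in_set_conv_decomp)
      then show ?thesis using xs by (intro exI[of _ "x # zs"]) (auto simp: successively_append_iff)
    next
      case False
      then show ?thesis using xs step.hyps by (intro exI[of _ "x # xs"]) (auto simp: successively_Cons)
    qed
  qed
  then show ?thesis using that by blast
qed

text \<open>The final vertex \<open>w\<close> is independent of \<open>hd xs\<close> to let the
  induction through; taking it equal to \<open>hd xs\<close> closes the walk.\<close>

lemma pawalk_of_list:
  assumes "xs \<noteq> []"
  shows "pcas (hd xs) (zip xs (tl xs @ [w])) w" "pawalk_verts (hd xs) (zip xs (tl xs @ [w])) = xs @ [w]"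
  using assms
proof (induction xs)
  case (Cons x xs)
  {
    case 1
    show ?case using Cons.IH(1) by (cases xs) auto
  next
    case 2
    show ?case using Cons.IH(2) by (cases xs) auto
  }
qed auto

section \<open>From a drawn pair graph to the abstract setting\<close>

context pair_graph
begin

lemma girth_le_length:
  assumes xs: "distinct xs" "3 \<le> length xs" "successively (\<lambda>a b. (a, b) \<in> parcs G) xs"
    "(last xs, hd xs) \<in> parcs G"
  shows "girth G \<le> enat (length xs)"
proof -
  have ne: "xs \<noteq> []" using xs(2) by auto
  define p where "p = zip xs (tl xs @ [hd xs])"
  have len: "length p = length xs" using ne by (simp add: p_def)
  have "set (zip xs (tl xs @ [w])) \<subseteq> parcs G" if "(last xs, w) \<in> parcs G" for w
    using ne xs(3) that
  proof (induction xs)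
    case (Cons x xs)
    then show ?case by (cases xs) auto
  qed simp
  then have "set p \<subseteq> parcs G" using xs(4) by (simp add: p_def)
  moreover have "hd xs \<in> pverts G" using xs(4) in_arcsD2 by blast
  ultimately have "awalk (hd xs) p (hd xs)"
    using pawalk_of_list(1)[OF ne, of "hd xs"] by (simp add: awalk_def p_def)
  moreover have "distinct (tl (pawalk_verts (hd xs) p))"
    using pawalk_of_list(2)[OF ne, of "hd xs"] xs(1) ne by (cases xs) (auto simp: p_def)
  moreover have "p \<noteq> []" using len ne by auto
  ultimately have "cycle p" unfolding cycle_def by blast
  then have "enat (length p) \<in> {enat (length p) | p. cycle p \<and> 3 \<le> length p}"
    using len xs(2) by (intro CollectI exI[of _ p]) auto
  then show ?thesis unfolding girth_def using len by (metis (lifting) Inf_lower)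
qed

lemma sym_parcs: "sym (parcs G)"
  using pair_sym_arcs by (simp add: symmetric_def)

lemma no_loop: "(u, u) \<notin> parcs G"
  using pair_no_loops by fastforce

text \<open>\<open>E\<close> inherits the drawing and the girth bound of \<open>G\<close>. The two
  arcs of an edge have the same image, whence the factor 2. An edge \<open>A\<close> that is not a
  bridge yields a cycle of \<open>G\<close>: a path without repetitions between its ends that avoids
  \<open>A\<close>, closed by \<open>A\<close>.\<close>

lemma drawing_sparse:
  assumes dr: "plane_drawing G pos curve" and E: "E \<subseteq> parcs G" "sym E" "E \<noteq> {}"
    and g: "enat g \<le> girth G" "2 \<le> g"
  shows "(g - 2) * card E < 2 * (g * card (Field E))"
proof -
  have finE: "finite E" using E(1) pair_finite_arcs finite_subset by blast
  have FV: "Field E \<subseteq> pverts G" using E(1) in_arcsD1 in_arcsD2 by (fastforce simp: Field_def)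
  have inj: "inj_on pos (pverts G)" using dr by (simp add: plane_drawing_def)
  have arcs: "Path_Connected.arc (curve (u, v))" "pathstart (curve (u, v)) = pos u" "pathfinish (curve (u, v)) = pos v"
    "curve (v, u) = reversepath (curve (u, v))"
    "path_image (curve (u, v)) \<inter> pos ` pverts G = {pos u, pos v}" if "(u, v) \<in> E" for u v
  proof -
    have "(u, v) \<in> parcs G" using that E(1) by blast
    then show "Path_Connected.arc (curve (u, v))" "pathstart (curve (u, v)) = pos u"
      "pathfinish (curve (u, v)) = pos v" "curve (v, u) = reversepath (curve (u, v))"
      "path_image (curve (u, v)) \<inter> pos ` pverts G = {pos u, pos v}"
      using bspec[OF dr[unfolded plane_drawing_def, THEN conjunct2, THEN conjunct1], of "(u, v)"] by simp_all
  qed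
  have cross: "path_image (curve (u, v)) \<inter> path_image (curve (x, y)) \<subseteq> pos ` ({u, v} \<inter> {x, y})"
    if "(u, v) \<in> E" "(x, y) \<in> E" "{u, v} \<noteq> {x, y}" for u v x y
  proof -
    have "(u, v) \<in> parcs G" "(x, y) \<in> parcs G" using that E(1) by blast+
    then show ?thesis
      using bspec[OF dr[unfolded plane_drawing_def, THEN conjunct2, THEN conjunct2], of "(u, v)"] that(3)
      by (auto dest: bspec[of _ _ "(x, y)"])
  qed
  define V where "V = pos ` Field E"
  define I where "I e = path_image (curve e)" for e
  have IV: "I (u, v) \<inter> V = {pos u, pos v}" if "(u, v) \<in> E" for u v
  proof -
    have "V \<subseteq> pos ` pverts G" using FV unfolding V_def by (rule image_mono)
    moreover have "{pos u, pos v} \<subseteq> V" using that by (auto simp: V_def Field_def)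
    ultimately show ?thesis using arcs(5)[OF that] unfolding I_def by blast
  qed
  have I_sym: "I (v, u) = I (u, v)" if "(u, v) \<in> E" for u v
    using arcs(4)[OF that] by (simp add: I_def)
  have V_ends: "{u, v} = {x, y}" if "(u, v) \<in> E" "(x, y) \<in> E" "I (u, v) = I (x, y)" for u v x y
  proof -
    have "pos ` {u, v} = pos ` {x, y}" using IV[OF that(1)] IV[OF that(2)] that(3) by simp
    moreover have "{u, v} \<subseteq> pverts G" "{x, y} \<subseteq> pverts G" using that FV by (auto simp: Field_def)
    ultimately show ?thesis using inj inj_on_image_eq_iff by metis
  qed
  interpret pl: plane_graph V "I ` E"
  proof
    show "finite V" using finE by (simp add: V_def finite_Field)
    show "finite (I ` E)" using finE by simp
    fix A assume "A \<in> I ` E"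
    then obtain u v where uv: "(u, v) \<in> E" "A = I (u, v)" by auto
    then show "\<exists>g. Path_Connected.arc g \<and> path_image g = A \<and> A \<inter> V = {pathstart g, pathfinish g}"
      using arcs[OF uv(1)] IV[OF uv(1)] by (intro exI[of _ "curve (u, v)"]) (simp add: I_def)
    fix B assume "B \<in> I ` E" "A \<noteq> B"
    then obtain x y where xy: "(x, y) \<in> E" "B = I (x, y)" by auto
    have "{u, v} \<noteq> {x, y}"
      using \<open>A \<noteq> B\<close> uv xy I_sym[OF uv(1)] by (auto simp: doubleton_eq_iff)
    then have "A \<inter> B \<subseteq> pos ` ({u, v} \<inter> {x, y})" using cross uv xy by (simp add: I_def)
    moreover have "{u, v} \<inter> {x, y} \<subseteq> Field E" using uv(1) by (auto simp: Field_def)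
    ultimately show "A \<inter> B \<subseteq> V" unfolding V_def by blast
  qed
  have euler: "(g - 2) * card (I ` E) < g * card V"
  proof (rule pl.euler_girth)
    fix \<B> assume \<B>: "\<B> \<subseteq> I ` E" and cyc: "has_cycle V \<B>"
    obtain A p q where A: "A \<in> \<B>" "A \<inter> V = {p, q}" "(p, q) \<in> (edge_rel V (\<B> - {A}))\<^sup>*"
      using cyc by (auto simp: has_cycle_def)
    obtain u v where uv: "(u, v) \<in> E" "A = I (u, v)" "pos u = p" "pos v = q"
    proof -
      obtain u v where e: "(u, v) \<in> E" "A = I (u, v)" using A(1) \<B> by auto
      then have "{pos u, pos v} = {p, q}" using IV A(2) by simp
      then show ?thesis
        using e that[of u v] that[of v u] I_sym[OF e(1)] symD[OF E(2) e(1)] by (auto simp: doubleton_eq_iff)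
    qed
    define R where "R = {(a, b) \<in> E. I (a, b) \<in> \<B> - {A}}"
    have "\<exists>b\<in>Field E. pos b = q' \<and> (u, b) \<in> R\<^sup>*" if "(p, q') \<in> (edge_rel V (\<B> - {A}))\<^sup>*" for q'
      using that
    proof (induction rule: rtrancl_induct)
      case base
      then show ?case using uv by (auto simp: Field_def)
    next
      case (step y z)
      then obtain b where b: "b \<in> Field E" "pos b = y" "(u, b) \<in> R\<^sup>*" by blast
      obtain C where C: "C \<in> \<B> - {A}" "C \<inter> V = {y, z}" using step.hyps by (auto simp: edge_rel_def)
      then have "C \<in> I ` E" using \<B> by blast
      then obtain c d where cd: "(c, d) \<in> E" "C = I (c, d)" by auto
      have cdV: "{pos c, pos d} = {y, z}" using IV[OF cd(1)] C(2) cd(2) by simp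
      have inF: "c \<in> Field E" "d \<in> Field E" using cd by (auto simp: Field_def)
      have dc: "(d, c) \<in> E" "C = I (d, c)" using symD[OF E(2) cd(1)] I_sym[OF cd(1)] cd by auto
      have injF: "inj_on pos (Field E)" using inj FV inj_on_subset by blast
      have "pos c = y \<and> pos d = z \<or> pos d = y \<and> pos c = z" using cdV by (auto simp: doubleton_eq_iff)
      then show ?case
      proof
        assume h: "pos c = y \<and> pos d = z"
        then have "c = b" using inj_onD[OF injF, of c b] b inF by simp
        then have "(b, d) \<in> R" using C cd by (simp add: R_def)
        then show ?thesis using b h inF by (auto intro: rtrancl_into_rtrancl)
      next
        assume h: "pos d = y \<and> pos c = z"
        then have "d = b" using inj_onD[OF injF, of d b] b inF by simp
        then have "(b, c) \<in> R" using C dc by (simp add: R_def)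
        then show ?thesis using b h inF by (auto intro: rtrancl_into_rtrancl)
      qed
    qed
    then obtain b where b: "b \<in> Field E" "pos b = q" "(u, b) \<in> R\<^sup>*" using A(3) by blast
    have vF: "v \<in> Field E" using uv by (auto simp: Field_def)
    have "b = v" using inj_onD[OF inj, of b v] b uv(4) vF FV by auto
    then obtain xs where xs: "xs \<noteq> []" "hd xs = u" "last xs = v" "distinct xs"
      "successively (\<lambda>a b. (a, b) \<in> R) xs" using b(3) by (auto elim: rtrancl_distinct_path)
    have "u \<noteq> v" using uv(1) E(1) no_loop by auto
    have "(u, v) \<notin> R" using uv by (simp add: R_def)
    have len: "3 \<le> length xs"
    proof (rule ccontr)
      assume "\<not> 3 \<le> length xs"
      then consider a where "xs = [a]" | a b where "xs = [a, b]"
        using xs(1) by (cases xs; cases "tl xs"; cases "tl (tl xs)") auto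
      then show False using xs \<open>u \<noteq> v\<close> \<open>(u, v) \<notin> R\<close> by cases auto
    qed
    have "successively (\<lambda>a b. (a, b) \<in> parcs G) xs"
      using xs(5) E(1) by (auto simp: successively_conv_nth R_def)
    moreover have "(v, u) \<in> parcs G" using uv(1) E(1) sym_parcs by (meson subsetD symD)
    ultimately have "girth G \<le> enat (length xs)"
      using girth_le_length[OF xs(4) len] xs by simp
    then have "g \<le> length xs" using g(1) by (metis enat_ord_simps(1) order_trans)
    also have "length xs \<le> card \<B>"
    proof -
      define f where "f i = I (xs ! i, xs ! Suc i)" for i
      have step: "(xs ! i, xs ! Suc i) \<in> R" if "Suc i < length xs" for i
        using xs(5) that by (simp add: successively_conv_nth)
      have "inj_on f {..<length xs - 1}"
      proof (rule inj_onI)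
        fix i j assume ij: "i \<in> {..<length xs - 1}" "j \<in> {..<length xs - 1}" "f i = f j"
        then have "{xs ! i, xs ! Suc i} = {xs ! j, xs ! Suc j}"
          using step[of i] step[of j] by (intro V_ends) (auto simp: R_def f_def)
        then show "i = j"
          using xs(4) ij by (auto simp: doubleton_eq_iff nth_eq_iff_index_eq)
      qed
      moreover have "f ` {..<length xs - 1} \<subseteq> \<B> - {A}"
      proof (rule image_subsetI)
        fix i assume "i \<in> {..<length xs - 1}"
        then show "f i \<in> \<B> - {A}" using step[of i] by (simp add: R_def f_def)
      qed
      moreover have fB: "finite \<B>" using \<B> finE finite_subset by blast
      \<comment> \<open>The path accounts for \<open>length xs - 1\<close> edges of \<B> other than
        \<open>A\<close>, and \<open>A\<close> is the closing edge of the cycle.\<close>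
      ultimately have "length xs - 1 \<le> card (\<B> - {A})"
        using card_inj_on_le[of f "{..<length xs - 1}" "\<B> - {A}"] by simp
      also have "card (\<B> - {A}) = card \<B> - 1" using A(1) fB by simp
      finally show ?thesis using len A(1) fB card_gt_0_iff[of \<B>] by auto
    qed
    finally show "g \<le> card \<B>" .
  qed (use E g in auto)
  have cV: "card V = card (Field E)"
    unfolding V_def by (rule card_image[OF inj_on_subset[OF inj FV]])
  have "card E \<le> 2 * card (I ` E)"
  proof -
    have "card E = (\<Sum>A\<in>I ` E. card {e\<in>E. I e = A})"
      using finE sum.image_gen[OF finE, of "\<lambda>_. 1 :: nat" I] by simp
    also have "\<dots> \<le> (\<Sum>A\<in>I ` E. 2)"
    proof (rule sum_mono)
      fix A assume "A \<in> I ` E"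
      then obtain u v where uv: "(u, v) \<in> E" "A = I (u, v)" by auto
      have "{e\<in>E. I e = A} \<subseteq> {(u, v), (v, u)}"
      proof
        fix e assume "e \<in> {e\<in>E. I e = A}"
        moreover obtain a b where "e = (a, b)" by (cases e)
        ultimately show "e \<in> {(u, v), (v, u)}"
          using V_ends[of a b u v] uv by (auto simp: doubleton_eq_iff)
      qed
      then have "card {e\<in>E. I e = A} \<le> card {(u, v), (v, u)}" by (intro card_mono) auto
      also have "\<dots> \<le> 2" by (cases "u = v") auto
      finally show "card {e\<in>E. I e = A} \<le> 2" .
    qed
    finally show ?thesis by simp
  qed
  then have "(g - 2) * card E \<le> (g - 2) * (2 * card (I ` E))" by (rule mult_le_mono2)
  also have "\<dots> = 2 * ((g - 2) * card (I ` E))" by (rule mult.left_commute)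
  also have "\<dots> < 2 * (g * card V)" using euler by (rule mult_strict_left_mono) simp
  finally show ?thesis unfolding cV .
qed

lemma out_degree_nb: "out_degree (with_proj G) v = card (nb (parcs G) v)"
proof -
  have "out_arcs (with_proj G) v = Pair v ` nb (parcs G) v"
    by (auto simp: out_arcs_def nb_def)
  then show ?thesis unfolding out_degree_def by (simp add: card_image inj_on_def)
qed

lemma nb_verts: "u \<in> nb (parcs G) v \<Longrightarrow> u \<in> pverts G \<and> v \<in> pverts G"
  using in_arcsD1 in_arcsD2 by (auto simp: nb_def)

lemma deg_le_max: "card (nb (parcs G) v) \<le> max_degree G"
proof (cases "v \<in> pverts G")
  case True
  then show ?thesis
    unfolding max_degree_def out_degree_nb using pair_finite_verts by (intro Max_ge) auto
next
  case False
  then have "nb (parcs G) v = {}" using nb_verts by auto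
  then show ?thesis by simp
qed

lemma max_degree_attained:
  assumes "0 < max_degree G"
  obtains v where "v \<in> pverts G" "card (nb (parcs G) v) = max_degree G"
proof -
  have "max_degree G \<in> insert 0 (out_degree (with_proj G) ` pverts G)"
    unfolding max_degree_def using pair_finite_verts by (intro Max_in) auto
  then show ?thesis using assms that by (auto simp: out_degree_nb)
qed

text \<open>A symmetric set with fewest arcs among the uncolorable ones. Girth at least 7 rules out
  all the short cycles named in \<open>critical\<close>.\<close>

lemma critical_subgraph:
  assumes girth: "7 \<le> girth G" and K: "0 < K" and nc: "\<not> inj_colorable (parcs G) K"
  obtains E where "E \<subseteq> parcs G" "E \<noteq> {}" "critical E K"
proof -
  define Bad where "Bad E \<longleftrightarrow> E \<subseteq> parcs G \<and> sym E \<and> \<not> inj_colorable E K" for E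
  have "Bad (parcs G)" using nc sym_parcs by (simp add: Bad_def)
  then obtain E where E: "Bad E" and least: "\<And>E'. Bad E' \<Longrightarrow> card E \<le> card E'"
    using ex_has_least_nat[of Bad "parcs G" card] by blast
  have Es: "E \<subseteq> parcs G" "sym E" "\<not> inj_colorable E K" using E by (auto simp: Bad_def)
  have finE: "finite E" using Es(1) pair_finite_arcs finite_subset by blast
  have "inj_colorable {} K"
    using K by (auto simp: inj_colorable_def conf_def nb_def intro: exI[of _ "\<lambda>_. 0"])
  then have "E \<noteq> {}" using Es by auto
  have "irrefl E" using Es(1) no_loop by (auto simp: irrefl_def)
  then interpret simple_graph E
    using finE Es(2) by unfold_locales
  have short: False if "distinct xs" "3 \<le> length xs" "length xs \<le> 6"
    "successively (\<lambda>a b. b \<in> nb E a) xs" "hd xs \<in> nb E (last xs)" for xs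
  proof -
    have "successively (\<lambda>a b. (a, b) \<in> parcs G) xs"
      using that(4) Es(1) by (auto simp: successively_conv_nth nb_def)
    moreover have "(last xs, hd xs) \<in> parcs G" using that(5) Es(1) by (auto simp: nb_def)
    ultimately have "girth G \<le> enat (length xs)" using girth_le_length that by blast
    also have "\<dots> \<le> enat 6" using that by simp
    finally have "(7 :: enat) \<le> enat 6" using girth order_trans by blast
    then show False by (simp add: numeral_eq_enat)
  qed
  have "critical E K"
  proof
    show "0 < K" "\<not> inj_colorable E K" using K Es by auto
  next
    fix u v assume uv: "(u, v) \<in> E"
    show "inj_colorable (E - {(u, v), (v, u)}) K"
    proof (rule ccontr)
      assume "\<not> ?thesis"
      then have "Bad (E - {(u, v), (v, u)})" using Es by (auto simp: Bad_def sym_def)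
      moreover have "card (E - {(u, v), (v, u)}) < card E"
        using uv finE by (intro psubset_card_mono) auto
      ultimately show False using least by fastforce
    qed
  next
    fix a b c assume "b \<in> nb E a" "c \<in> nb E b"
    then show "a \<notin> nb E c" using short[of "[a, b, c]"] nb_neq by fastforce
  next
    fix a b c d assume "a \<noteq> c" "b \<noteq> d" "b \<in> nb E a" "c \<in> nb E b" "d \<in> nb E c"
    then show "a \<notin> nb E d" using short[of "[a, b, c, d]"] nb_neq by fastforce
  next
    fix a b c d e f
    assume "distinct [a, b, c, d, e, f]" "b \<in> nb E a" "c \<in> nb E b" "d \<in> nb E c" "e \<in> nb E d" "f \<in> nb E e"
    then show "a \<notin> nb E f" using short[of "[a, b, c, d, e, f]"] by auto
  qed
  then show ?thesis using that Es(1) \<open>E \<noteq> {}\<close> by blast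
qed

section \<open>Colorability and the chromatic number\<close>

lemma inj_colorable_succ:
  assumes "planar G" "4 \<le> max_degree G" "9 \<le> girth G"
  shows "inj_colorable (parcs G) (max_degree G + 1)"
proof (rule ccontr)
  assume nc: "\<not> ?thesis"
  have "(7 :: enat) \<le> 9" by simp
  then have "7 \<le> girth G" using assms(3) order_trans by blast
  then obtain E where E: "E \<subseteq> parcs G" "E \<noteq> {}" "critical E (max_degree G + 1)"
    using critical_subgraph nc by (metis add_gr_0 zero_less_one)
  interpret critical E "max_degree G + 1" by (rule E(3))
  have "card (nb E v) \<le> max_degree G" for v
  proof -
    have "card (nb E v) \<le> card (nb (parcs G) v)"
      using E(1) pair_finite_arcs by (intro card_mono) (auto simp: nb_def intro: finite_Image)
    then show ?thesis using deg_le_max order_trans by blast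
  qed
  then interpret critical_succ E "max_degree G + 1" "max_degree G"
    using assms(2) by unfold_locales auto
  obtain pos curve where "plane_drawing G pos curve" using assms(1) by (auto simp: planar_def)
  then have "(9 - 2) * card E < 2 * (9 * card (Field E))"
    using E sym_E assms(3) by (intro drawing_sparse) (auto simp: numeral_eq_enat)
  then show False using dense by simp
qed

lemma inj_colorable_max_degree:
  assumes "planar G" "4 \<le> max_degree G" "13 \<le> girth G"
  shows "inj_colorable (parcs G) (max_degree G)"
proof (rule ccontr)
  assume nc: "\<not> ?thesis"
  have "(7 :: enat) \<le> 13" by simp
  then have "7 \<le> girth G" using assms(3) order_trans by blast
  moreover have "0 < max_degree G" using assms(2) by simp
  ultimately obtain E where E: "E \<subseteq> parcs G" "E \<noteq> {}" "critical E (max_degree G)"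
    using critical_subgraph nc by blast
  interpret critical E "max_degree G" by (rule E(3))
  have "card (nb E v) \<le> max_degree G" for v
  proof -
    have "card (nb E v) \<le> card (nb (parcs G) v)"
      using E(1) pair_finite_arcs by (intro card_mono) (auto simp: nb_def intro: finite_Image)
    then show ?thesis using deg_le_max order_trans by blast
  qed
  then interpret critical_eq E "max_degree G" "max_degree G"
    using assms(2) by unfold_locales auto
  obtain pos curve where "plane_drawing G pos curve" using assms(1) by (auto simp: planar_def)
  then have "(13 - 2) * card E < 2 * (13 * card (Field E))"
    using E sym_E assms(3) by (intro drawing_sparse) (auto simp: numeral_eq_enat)
  then show False using dense by simp
qed

lemma chromatic_le:
  assumes "inj_colorable (parcs G) K"
  shows "injective_chromatic_number G \<le> K"
proof -
  obtain c where c: "\<forall>v. c v < K" "\<forall>v. \<forall>u\<in>conf (parcs G) v. c u \<noteq> c v"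
    using assms unfolding inj_colorable_def by blast
  have "injective_coloring G c"
    unfolding injective_coloring_def
  proof (intro ballI impI)
    fix u v assume uv: "u \<noteq> v" "\<exists>w\<in>pverts G. (u, w) \<in> parcs G \<and> (v, w) \<in> parcs G"
    then obtain w where w: "(u, w) \<in> parcs G" "(v, w) \<in> parcs G" by blast
    then have "(w, u) \<in> parcs G" using sym_parcs by (meson symD)
    then have "u \<in> conf (parcs G) v" using w uv by (auto simp: conf_def nb_def)
    then show "c u \<noteq> c v" using c(2) by blast
  qed
  then have "injective_chromatic_number G \<le> card (c ` pverts G)"
    unfolding injective_chromatic_number_def by (intro Least_le) blast
  also have "\<dots> \<le> card {..<K}" using c(1) by (intro card_mono) auto
  finally show ?thesis by simp
qed

text \<open>The neighbors of a vertex of maximum degree conflict pairwise through it. The least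
  number is attained, since giving distinct colors to all vertices is an injective coloring.\<close>

lemma max_degree_le_chromatic:
  assumes "0 < max_degree G"
  shows "max_degree G \<le> injective_chromatic_number G"
proof -
  have "injective_coloring G c" if "inj_on c (pverts G)" for c
    using that by (auto simp: injective_coloring_def inj_on_def)
  moreover obtain c :: "'a \<Rightarrow> nat" where "inj_on c (pverts G)"
    using finite_imp_inj_to_nat_seg[OF pair_finite_verts] by blast
  ultimately have "\<exists>k c. injective_coloring G c \<and> card (c ` pverts G) = k" by blast
  then have "\<exists>c. injective_coloring G c \<and> card (c ` pverts G) = injective_chromatic_number G"
    unfolding injective_chromatic_number_def by (rule LeastI_ex)
  then obtain c where c: "injective_coloring G c" "card (c ` pverts G) = injective_chromatic_number G" by blast
  obtain v where v: "v \<in> pverts G" "card (nb (parcs G) v) = max_degree G"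
    using max_degree_attained[OF assms] .
  have "inj_on c (nb (parcs G) v)"
  proof (rule inj_onI, rule ccontr)
    fix x y assume xy: "x \<in> nb (parcs G) v" "y \<in> nb (parcs G) v" "c x = c y" "x \<noteq> y"
    then have "(x, v) \<in> parcs G" "(y, v) \<in> parcs G" using sym_parcs by (auto simp: nb_def dest: symD)
    then show False using c(1) xy v(1) nb_verts unfolding injective_coloring_def by blast
  qed
  then have "max_degree G = card (c ` nb (parcs G) v)" using v(2) by (simp add: card_image)
  also have "\<dots> \<le> card (c ` pverts G)"
    using nb_verts pair_finite_verts by (intro card_mono) auto
  finally show ?thesis using c(2) by simp
qed

end

theorem theorem5:
  fixes G :: "'a pair_pre_digraph"
  assumes "pair_graph G" and "planar G" and "max_degree G \<ge> 4"
  shows "(girth G \<ge> 9 \<longrightarrow> injective_chromatic_number G \<le> max_degree G + 1) \<and>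
         (girth G \<ge> 13 \<longrightarrow> injective_chromatic_number G = max_degree G)"
proof -
  interpret pair_graph G by (rule assms(1))
  have "0 < max_degree G" using assms(3) by simp
  then show ?thesis
    using chromatic_le inj_colorable_succ inj_colorable_max_degree max_degree_le_chromatic assms(2,3)
    by (meson order_antisym)
qed

end
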